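(* Let $\Sigma\le S_n$ be a Young subgroup and $G\le\Sigma$ a subgroup of index $\ell=[\Sigma:G]$. Let $\omega\in\mathbb{Z}[V]^\Sigma$ be a non-zero element of degree 1 and let $z\in\mathbb{Z}^n$ have trivial stabilizer in $\Sigma$ and satisfy $\omega(z)\ne0$. Then, up to sign, $$\mho(G)=\frac{\prod_{d:\ \tau(d)\neq0}\operatorname{covol}(\varepsilon_d(M_d))}{\Delta(G)|_z},$$ and this integer divides $\mho(\theta_* )$ for every choice of secondaries $\theta_*\subset\mathbb{Z}[V]^G$.
   Context: $\Sigma=S_{k_1}\times\cdots\times S_{k_r}$ with $k_1+\dots+k_r=n$. For a commutative ring $R$, $R[V]=R[x_1,\dots,x_n]$, with $S_n$ permuting the variables, and $(g\cdot f)(v)=f(g^{-1}v)$. $R[V]^G_d$ is the degree-$d$ part of the invariant ring. A set of secondaries for $\mathbb{Q}[V]^G$ is a minimal set of homogeneous generators of $\mathbb{Q}[V]^G$ as a $\mathbb{Q}[V]^\Sigma$-module; it has exactly $\ell$ elements and is a module basis, and the multiset of degrees does not depend on the choice; $\tau(d)$ is the number of secondaries of degree $d$. Let $\gamma_1,\dots,\gamma_\ell$ be left coset representatives of $G$ in $\Sigma$. For secondaries $\theta_*\subset\mathbb{Z}[V]^G$, $M(\theta_* )=[\gamma_i\theta_j]_{1\le i,j\le\ell}$ and $\mho(\theta_* )$ is the content (gcd of coefficients) of $\det M(\theta_* )$. $\mho(G)$ is the integer (unique up to sign; it exists) of the form $\mho(\theta_* )$, for a set of secondaries $\theta_*\subset\mathbb{Z}[V]^G$,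 that divides $\mho(\eta_* )$ for every set of secondaries $\eta_*\subset\mathbb{Z}[V]^G$. The $G$-discriminant is $\Delta(G)=\prod_{P}L_P^{e(G,P)}$, the product over the reflecting hyperplanes $P=\{x_i=x_j\}$ of transpositions $g_P=(i\,j)\in\Sigma$, where $L_P=x_i-x_j$ and $e(G,P)$ is the number of orbits of size 2 of $g_P$ acting by left multiplication on the set of left cosets $\Sigma/G$; it is defined up to sign. Put $w_i=\gamma_i^{-1}z$, $X=\{w_1,\dots,w_\ell\}$, $\mathrm{res}_X(f)=(f(w_1),\dots,f(w_\ell))$, $\mathbb{R}L_d=\mathrm{res}_X(\mathbb{R}[V]^G_d)\subseteq\mathbb{R}^\ell$ with $\mathbb{R}L_{-1}=0$ (one has $\mathbb{R}L_{d-1}\subseteq\mathbb{R}L_d$), and $M_d=\mathrm{res}_X(\mathbb{Z}[V]^G_d)$. $\varepsilon_d$ is the orthogonal projection (standard inner product on $\mathbb{R}^\ell$) of $\mathbb{R}L_d$ onto the orthogonal complement of $\mathbb{R}L_{d-1}$ in $\mathbb{R}L_d$, and $\operatorname{covol}$ is the covolume of a full-rank lattice in that orthogonal complement. *)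

theory Defs
  imports
    "HOL-Library.Poly_Mapping"
    "HOL-Algebra.Sym_Groups"
    "HOL-Algebra.Group_Action"
    "HOL-Algebra.Left_Coset"
    "Jordan_Normal_Form.Determinant"
begin

section \<open>Polynomials in the variables \<open>x\<^sub>1, \<dots>, x\<^sub>n\<close>\<close>

text \<open>
  A polynomial is a finitely supported map from monomials to coefficients, and a monomial is a
  finitely supported map from variable indices to exponents. The ring \<open>R[x\<^sub>1, \<dots>, x\<^sub>n]\<close> is the
  subring of those polynomials that only involve variables with index in \<open>{1..n}\<close>.
\<close>

type_synonym monomial = "nat \<Rightarrow>\<^sub>0 nat"
type_synonym 'a mpol = "monomial \<Rightarrow>\<^sub>0 'a"

definition polys :: "nat \<Rightarrow> 'a::comm_ring_1 mpol set" where
  "polys n = {p. \<forall>m \<in> Poly_Mapping.keys p. Poly_Mapping.keys m \<subseteq> {1..n}}"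

definition var :: "nat \<Rightarrow> 'a::comm_ring_1 mpol" where
  "var i = Poly_Mapping.single (Poly_Mapping.single i 1) 1"

definition mon_degree :: "monomial \<Rightarrow> nat" where
  "mon_degree m = (\<Sum>i \<in> Poly_Mapping.keys m. Poly_Mapping.lookup m i)"

text \<open>As usual for graded pieces, the zero polynomial is homogeneous of every degree.\<close>

definition homogeneous :: "nat \<Rightarrow> 'a::comm_ring_1 mpol \<Rightarrow> bool" where
  "homogeneous d p \<longleftrightarrow> (\<forall>m \<in> Poly_Mapping.keys p. mon_degree m = d)"

definition eval_poly :: "'a::comm_ring_1 mpol \<Rightarrow> (nat \<Rightarrow> 'a) \<Rightarrow> 'a" where
  "eval_poly p v =
    (\<Sum>m \<in> Poly_Mapping.keys p. Poly_Mapping.lookup p m *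
       (\<Prod>i \<in> Poly_Mapping.keys m. v i ^ Poly_Mapping.lookup m i))"

definition content :: "int mpol \<Rightarrow> int" where
  "content p = Gcd (range (Poly_Mapping.lookup p))"

definition of_int_poly :: "int mpol \<Rightarrow> 'a::comm_ring_1 mpol" where
  "of_int_poly p = Poly_Mapping.map of_int p"


section \<open>Young subgroups and the actions of permutations\<close>

definition block :: "nat list \<Rightarrow> nat \<Rightarrow> nat set" where
  "block ks i = {sum_list (take i ks) + 1 .. sum_list (take (Suc i) ks)}"

definition young_group :: "nat list \<Rightarrow> (nat \<Rightarrow> nat) monoid" where
  "young_group ks = (sym_group (sum_list ks))
     \<lparr> carrier := {\<sigma> \<in> carrier (sym_group (sum_list ks)).
                     \<forall>i < length ks. \<sigma> ` block ks i = block ks i} \<rparr>"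

text \<open>
  The action on points is \<open>(g v)\<^sub>i = v\<^bsub>g\<^sup>-\<^sup>1 i\<^esub>\<close>, and the action on polynomials is
  \<open>(g \<cdot> f)(v) = f(g\<^sup>-\<^sup>1 v)\<close>, that is, \<open>g \<cdot> x\<^sub>i = x\<^bsub>g i\<^esub>\<close>: the coefficient of \<open>g \<cdot> f\<close> at
  the monomial \<open>m\<close> is the coefficient of \<open>f\<close> at \<open>m \<circ> g\<close>.
\<close>

definition act_point :: "(nat \<Rightarrow> nat) \<Rightarrow> (nat \<Rightarrow> 'a) \<Rightarrow> nat \<Rightarrow> 'a" where
  "act_point g v = v \<circ> Hilbert_Choice.inv g"

definition act_poly :: "(nat \<Rightarrow> nat) \<Rightarrow> 'a::comm_ring_1 mpol \<Rightarrow> 'a mpol" where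
  "act_poly g p = Poly_Mapping.map_key (Poly_Mapping.map_key g) p"

lemma inj_map_key_perm:
  assumes "bij g"
  shows "inj (Poly_Mapping.map_key g :: monomial \<Rightarrow> monomial)"
proof (rule injI)
  fix a b :: monomial
  assume "Poly_Mapping.map_key g a = Poly_Mapping.map_key g b"
  then have "Poly_Mapping.lookup a (g k) = Poly_Mapping.lookup b (g k)" for k
    by (metis assms bij_is_inj map_key.rep_eq comp_apply)
  then show "a = b"
    by (intro poly_mapping_eqI) (metis assms bij_pointE)
qed

lemma act_poly_var:
  assumes "bij g"
  shows "act_poly g (var i) = (var (g i) :: 'a::comm_ring_1 mpol)"
proof -
  have "Poly_Mapping.single i (1::nat) = Poly_Mapping.map_key g (Poly_Mapping.single (g i) 1)"
    by (simp add: assms bij_is_inj)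
  then show ?thesis
    unfolding act_poly_def var_def using inj_map_key_perm[OF assms] by simp
qed

definition inv_ring :: "nat \<Rightarrow> (nat \<Rightarrow> nat) set \<Rightarrow> 'a::comm_ring_1 mpol set" where
  "inv_ring n H = {p \<in> polys n. \<forall>g \<in> H. act_poly g p = p}"

definition inv_ring_deg :: "nat \<Rightarrow> (nat \<Rightarrow> nat) set \<Rightarrow> nat \<Rightarrow> 'a::comm_ring_1 mpol set" where
  "inv_ring_deg n H d = {p \<in> inv_ring n H. homogeneous d p}"

definition left_coset_reps ::
  "(nat \<Rightarrow> nat) monoid \<Rightarrow> (nat \<Rightarrow> nat) set \<Rightarrow> (nat \<Rightarrow> nat) list \<Rightarrow> bool" where
  "left_coset_reps S G \<gamma>s \<longleftrightarrow>
     set \<gamma>s \<subseteq> carrier S \<and>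
     bij_betw (\<lambda>i. (\<gamma>s ! i) <#\<^bsub>S\<^esub> G) {..<length \<gamma>s} (lcosets\<^bsub>S\<^esub> G)"


section \<open>Secondaries\<close>

text \<open>
  Throughout, \<open>S\<close> is the ambient permutation group of \<open>{1..n}\<close> (a Young subgroup) and \<open>G\<close> a
  subgroup of it.
\<close>

definition generates ::
  "nat \<Rightarrow> (nat \<Rightarrow> nat) monoid \<Rightarrow> (nat \<Rightarrow> nat) set \<Rightarrow> rat mpol set \<Rightarrow> bool" where
  "generates n S G \<Theta> \<longleftrightarrow>
     (\<forall>f \<in> inv_ring n G. \<exists>F c. finite F \<and> F \<subseteq> \<Theta> \<and>
        (\<forall>\<theta> \<in> F. c \<theta> \<in> inv_ring n (carrier S)) \<and> f = (\<Sum>\<theta> \<in> F. c \<theta> * \<theta>))"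

definition secondaries ::
  "nat \<Rightarrow> (nat \<Rightarrow> nat) monoid \<Rightarrow> (nat \<Rightarrow> nat) set \<Rightarrow> rat mpol set \<Rightarrow> bool" where
  "secondaries n S G \<Theta> \<longleftrightarrow>
     \<Theta> \<subseteq> inv_ring n G \<and> (\<forall>\<theta> \<in> \<Theta>. \<exists>d. homogeneous d \<theta>) \<and>
     generates n S G \<Theta> \<and> (\<forall>\<Theta>'. \<Theta>' \<subset> \<Theta> \<longrightarrow> \<not> generates n S G \<Theta>')"

text \<open>An enumeration \<open>\<theta>\<^sub>1, \<theta>\<^sub>2, \<dots>\<close> of a set of secondaries with integer coefficients.\<close>

definition int_secondaries ::
  "nat \<Rightarrow> (nat \<Rightarrow> nat) monoid \<Rightarrow> (nat \<Rightarrow> nat) set \<Rightarrow> int mpol list \<Rightarrow> bool" where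
  "int_secondaries n S G \<theta>s \<longleftrightarrow>
     distinct \<theta>s \<and> set \<theta>s \<subseteq> inv_ring n G \<and> secondaries n S G (of_int_poly ` set \<theta>s)"

text \<open>The number of secondaries of degree \<open>d\<close>, which is the same for every set of secondaries.\<close>

definition tau :: "nat \<Rightarrow> (nat \<Rightarrow> nat) monoid \<Rightarrow> (nat \<Rightarrow> nat) set \<Rightarrow> nat \<Rightarrow> nat" where
  "tau n S G d = (THE t. \<exists>\<Theta>. secondaries n S G \<Theta> \<and> t = card {\<theta> \<in> \<Theta>. homogeneous d \<theta>})"

definition sec_matrix :: "(nat \<Rightarrow> nat) list \<Rightarrow> int mpol list \<Rightarrow> int mpol mat" where
  "sec_matrix \<gamma>s \<theta>s =
     mat (length \<gamma>s) (length \<theta>s) (\<lambda>(i, j). act_poly (\<gamma>s ! i) (\<theta>s ! j))"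

definition mho :: "(nat \<Rightarrow> nat) list \<Rightarrow> int mpol list \<Rightarrow> int" where
  "mho \<gamma>s \<theta>s = content (det (sec_matrix \<gamma>s \<theta>s))"

text \<open>
  \<open>m\<close> is a value of the invariant \<open>\<mho>(G)\<close>, which is only determined up to sign. (Changing
  the coset representatives or the order of the secondaries changes \<open>det M(\<theta>)\<close> only by a sign,
  so \<^const>\<open>mho\<close> does not depend on them.)
\<close>

definition is_mho_group ::
  "nat \<Rightarrow> (nat \<Rightarrow> nat) monoid \<Rightarrow> (nat \<Rightarrow> nat) set \<Rightarrow> (nat \<Rightarrow> nat) list \<Rightarrow> int \<Rightarrow> bool" where
  "is_mho_group n S G \<gamma>s m \<longleftrightarrow>
     (\<exists>\<theta>s. int_secondaries n S G \<theta>s \<and> \<bar>m\<bar> = mho \<gamma>s \<theta>s) \<and>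
     (\<forall>\<eta>s. int_secondaries n S G \<eta>s \<longrightarrow> m dvd mho \<gamma>s \<eta>s)"


section \<open>The discriminant of a subgroup\<close>

definition refl_exponent ::
  "(nat \<Rightarrow> nat) monoid \<Rightarrow> (nat \<Rightarrow> nat) set \<Rightarrow> nat \<Rightarrow> nat \<Rightarrow> nat" where
  "refl_exponent S G i j =
     card {Q \<in> orbits (S \<lparr> carrier := generate S {transpose i j} \<rparr>) (lcosets\<^bsub>S\<^esub> G)
                 (\<lambda>g C. g <#\<^bsub>S\<^esub> C). card Q = 2}"

definition group_discriminant ::
  "nat \<Rightarrow> (nat \<Rightarrow> nat) monoid \<Rightarrow> (nat \<Rightarrow> nat) set \<Rightarrow> int mpol" where
  "group_discriminant n S G =
     (\<Prod>(i, j) \<in> {(i, j). i \<in> {1..n} \<and> j \<in> {1..n} \<and> i < j \<and> transpose i j \<in> carrier S}.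
        (var i - var j) ^ refl_exponent S G i j)"


section \<open>Restriction to the points \<open>w\<^sub>i = \<gamma>\<^sub>i\<^sup>-\<^sup>1 z\<close>\<close>

definition point :: "(nat \<Rightarrow> nat) list \<Rightarrow> (nat \<Rightarrow> int) \<Rightarrow> nat \<Rightarrow> nat \<Rightarrow> int" where
  "point \<gamma>s z i = act_point (Hilbert_Choice.inv (\<gamma>s ! i)) z"

definition res :: "(nat \<Rightarrow> nat) list \<Rightarrow> (nat \<Rightarrow> int) \<Rightarrow> real mpol \<Rightarrow> real vec" where
  "res \<gamma>s z f = vec (length \<gamma>s) (\<lambda>i. eval_poly f (\<lambda>k. real_of_int (point \<gamma>s z i k)))"

definition RL ::
  "nat \<Rightarrow> (nat \<Rightarrow> nat) set \<Rightarrow> (nat \<Rightarrow> nat) list \<Rightarrow> (nat \<Rightarrow> int) \<Rightarrow> nat \<Rightarrow> real vec set" where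
  "RL n G \<gamma>s z d = res \<gamma>s z ` inv_ring_deg n G d"

text \<open>\<open>RL_prev \<dots> d\<close> is the space with index \<open>d - 1\<close>, where the one with index \<open>-1\<close> is zero.\<close>

definition RL_prev ::
  "nat \<Rightarrow> (nat \<Rightarrow> nat) set \<Rightarrow> (nat \<Rightarrow> nat) list \<Rightarrow> (nat \<Rightarrow> int) \<Rightarrow> nat \<Rightarrow> real vec set" where
  "RL_prev n G \<gamma>s z d = (case d of 0 \<Rightarrow> {0\<^sub>v (length \<gamma>s)} | Suc e \<Rightarrow> RL n G \<gamma>s z e)"

definition M_lattice ::
  "nat \<Rightarrow> (nat \<Rightarrow> nat) set \<Rightarrow> (nat \<Rightarrow> nat) list \<Rightarrow> (nat \<Rightarrow> int) \<Rightarrow> nat \<Rightarrow> real vec set" where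
  "M_lattice n G \<gamma>s z d = (\<lambda>f. res \<gamma>s z (of_int_poly f)) ` inv_ring_deg n G d"

definition orth_compl_in :: "real vec set \<Rightarrow> real vec set \<Rightarrow> real vec set" where
  "orth_compl_in A B = {v \<in> B. \<forall>u \<in> A. scalar_prod v u = 0}"

definition orth_proj :: "real vec set \<Rightarrow> real vec \<Rightarrow> real vec" where
  "orth_proj W v = (THE w. w \<in> W \<and> (\<forall>u \<in> W. scalar_prod (v - w) u = 0))"

definition eps ::
  "nat \<Rightarrow> (nat \<Rightarrow> nat) set \<Rightarrow> (nat \<Rightarrow> nat) list \<Rightarrow> (nat \<Rightarrow> int) \<Rightarrow> nat \<Rightarrow> real vec \<Rightarrow> real vec" where
  "eps n G \<gamma>s z d = orth_proj (orth_compl_in (RL_prev n G \<gamma>s z d) (RL n G \<gamma>s z d))"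

text \<open>
  The columns of \<open>B\<close> form a \<open>\<int>\<close>-basis of the lattice \<open>L\<close> in \<open>\<real>\<^sup>l\<close>: they are linearly
  independent over the reals and their integer combinations are the elements of \<open>L\<close>. The
  covolume of \<open>L\<close> in its real span is the volume of the parallelepiped spanned by such a basis,
  that is, the square root of its Gram determinant.
\<close>

definition lattice_basis :: "nat \<Rightarrow> real mat \<Rightarrow> real vec set \<Rightarrow> bool" where
  "lattice_basis l B L \<longleftrightarrow>
     dim_row B = l \<and>
     (\<forall>c \<in> carrier_vec (dim_col B). B *\<^sub>v c = 0\<^sub>v l \<longrightarrow> c = 0\<^sub>v (dim_col B)) \<and>
     L = {B *\<^sub>v map_vec real_of_int c | c. c \<in> carrier_vec (dim_col B)}"

definition covol :: "nat \<Rightarrow> real vec set \<Rightarrow> real" where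
  "covol l L = (THE v. \<exists>B. lattice_basis l B L \<and> v = sqrt (det (transpose_mat B * B)))"

end

theory Submission
  imports Defs "HOL-Library.Function_Algebras"
begin

text \<open>
  Let \<open>P\<close> be the set of pairs \<open>i < j\<close> with \<open>(i j) \<in> \<Sigma>\<close>. The polynomial \<open>\<Prod>(x\<^sub>i - y\<^sub>j)\<close> over \<open>P\<close> vanishes
  at \<open>y = g x\<close> for every \<open>g \<in> \<Sigma>\<close> other than the identity, and is \<open>\<Delta> = \<Prod>(x\<^sub>i - x\<^sub>j)\<close> at \<open>y = x\<close>. Its
  expansion \<open>\<Sum> a\<^sub>S(x) b\<^sub>S(y)\<close> gives an interpolation formula (lemmas \<open>kernel\<close>, \<open>interpolation\<close>): each
  polynomial \<open>f\<close> is \<open>\<Sum> \<partial>(f a\<^sub>S) b\<^sub>S\<close>, where \<open>\<partial>\<close> is antisymmetrization divided by \<open>\<Delta>\<close>. Averaged over \<open>G\<close>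
  it expresses an invariant by finitely many generators over the \<open>\<Sigma>\<close>-invariants.

  This explicit formula takes the place of the Cohen-Macaulay property. If the values of an invariant
  form on the orbit \<open>X\<close> of \<open>z\<close> agree with those of an invariant form of smaller degree, then its coefficients
  of degree zero vanish, so it lies in the ideal generated by the \<open>\<Sigma>\<close>-invariants of positive degree
  (\<open>lower_values\<close>). As \<open>\<omega>\<close> has a constant non-zero value on the orbit, multiplication by \<open>\<omega>\<close> raises
  degrees without changing the span of the values. By a graded Nakayama argument the secondaries
  are therefore the homogeneous lifts of bases of the space of values that are adapted to its filtration by
  degree (\<open>secondaries_iff\<close>, \<open>int_secondaries_iff\<close>).

  Modulo \<open>x\<^sub>a - x\<^sub>b\<close> the rows of \<open>M(\<theta>)\<close> that the transposition exchanges coincide, so \<open>\<Delta>(G)\<close> divides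
  \<open>det M(\<theta>)\<close>. The interpolation formula gives a companion matrix \<open>Y\<close> with \<open>M Y = \<Delta> I\<close>, whose determinant
  is divisible by the complementary factor of \<open>\<Delta>\<^sup>l\<close>. Hence \<open>det M(\<theta>)\<close> is a constant times
  \<open>\<Delta>(G)\<close>. As \<open>\<Delta>(G)\<close> has content one, the determinant of the values of the secondaries on the orbit is
  \<open>\<mho>(\<theta>) \<Delta>(G)(z)\<close> up to sign (\<open>det_T_mho\<close>).

  Secondaries for which this determinant is minimal are optimal: every integral invariant form of degree
  \<open>d\<close> has integral coordinates at the secondaries of degree \<open>d\<close>, for otherwise an exchange by Cramer's
  rule would shrink the determinant (\<open>ex_optimal\<close>). The transition matrix from any other secondaries is
  triangular with respect to the degree with integral diagonal blocks, so the minimal determinant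
  divides all others (\<open>optimal_dvd\<close>). Finally, making the values of optimal secondaries orthogonal to
  those of smaller degree keeps the determinant, and turns the part of degree \<open>d\<close> into a lattice basis of
  \<open>\<epsilon>\<^sub>d(M\<^sub>d)\<close>. The Gram determinant is the product of the squared covolumes (\<open>prod_covol\<close>).
\<close>

section \<open>Substitution homomorphisms on polynomials\<close>

definition Const :: "'a::comm_ring_1 \<Rightarrow> 'a mpol" where
  "Const c = Poly_Mapping.single 0 c"

definition mon_eval :: "(nat \<Rightarrow> 'b::comm_ring_1) \<Rightarrow> monomial \<Rightarrow> 'b" where
  "mon_eval v m = (\<Prod>i \<in> Poly_Mapping.keys m. v i ^ Poly_Mapping.lookup m i)"

definition ins :: "('a::comm_ring_1 \<Rightarrow> 'b::comm_ring_1) \<Rightarrow> (nat \<Rightarrow> 'b) \<Rightarrow> 'a mpol \<Rightarrow> 'b" where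
  "ins \<phi> v p = (\<Sum>m \<in> Poly_Mapping.keys p. \<phi> (Poly_Mapping.lookup p m) * mon_eval v m)"

lemma mon_eval_superset:
  assumes "finite A" "Poly_Mapping.keys m \<subseteq> A"
  shows "mon_eval v m = (\<Prod>i \<in> A. v i ^ Poly_Mapping.lookup m i)"
  unfolding mon_eval_def using assms
  by (intro prod.mono_neutral_left) (auto simp: in_keys_iff)

lemma mon_eval_0 [simp]: "mon_eval v 0 = 1"
  by (simp add: mon_eval_def)

lemma mon_eval_add: "mon_eval v (m + m') = mon_eval v m * mon_eval v m'"
proof -
  let ?A = "Poly_Mapping.keys m \<union> Poly_Mapping.keys m'"
  have "Poly_Mapping.keys (m + m') \<subseteq> ?A" by (rule Poly_Mapping.keys_add)
  then show ?thesis
    by (simp add: mon_eval_superset[of ?A] lookup_add power_add prod.distrib)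
qed

lemma mon_eval_single: "mon_eval v (Poly_Mapping.single i k) = v i ^ k"
  by (cases "k = 0") (auto simp: mon_eval_def)

lemma poly_mapping_sum_single:
  "p = (\<Sum>m \<in> Poly_Mapping.keys p. Poly_Mapping.single m (Poly_Mapping.lookup p m))"
  by (rule poly_mapping_eqI)
     (auto simp: lookup_sum lookup_single when_def in_keys_iff)

lemma (in comm_ring_hom) ins_superset:
  assumes "finite A" "Poly_Mapping.keys p \<subseteq> A"
  shows "ins hom v p = (\<Sum>m \<in> A. hom (Poly_Mapping.lookup p m) * mon_eval v m)"
  unfolding ins_def using assms
  by (intro sum.mono_neutral_left) (auto simp: in_keys_iff)

lemma (in comm_ring_hom) ins_add: "ins hom v (p + q) = ins hom v p + ins hom v q"
proof -
  let ?A = "Poly_Mapping.keys p \<union> Poly_Mapping.keys q"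
  have "Poly_Mapping.keys (p + q) \<subseteq> ?A" by (rule Poly_Mapping.keys_add)
  then show ?thesis
    by (simp add: ins_superset[of ?A] lookup_add hom_distribs algebra_simps sum.distrib)
qed

lemma (in comm_ring_hom) ins_single:
  "ins hom v (Poly_Mapping.single m c) = hom c * mon_eval v m"
  by (simp add: ins_superset[of "{m}"])

lemma (in comm_ring_hom) ins_sum:
  "ins hom v (sum f A) = (\<Sum>a\<in>A. ins hom v (f a))"
  by (induction A rule: infinite_finite_induct) (simp_all add: ins_add, simp_all add: ins_def)

lemma (in comm_ring_hom) ins_mult: "ins hom v (p * q) = ins hom v p * ins hom v q"
proof -
  let ?s = "\<lambda>p m. Poly_Mapping.single m (Poly_Mapping.lookup p m)"
  have "p * q = (\<Sum>m \<in> Poly_Mapping.keys p. ?s p m) * (\<Sum>m' \<in> Poly_Mapping.keys q. ?s q m')"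
    using poly_mapping_sum_single[of p] poly_mapping_sum_single[of q] by simp
  also have "\<dots> = (\<Sum>m \<in> Poly_Mapping.keys p. \<Sum>m' \<in> Poly_Mapping.keys q. ?s p m * ?s q m')"
    by (simp add: sum_product)
  finally have "ins hom v (p * q) =
      (\<Sum>m \<in> Poly_Mapping.keys p. \<Sum>m' \<in> Poly_Mapping.keys q. ins hom v (?s p m) * ins hom v (?s q m'))"
    by (simp add: ins_sum ins_single mult_single mon_eval_add hom_distribs algebra_simps)
  also have "\<dots> = ins hom v (\<Sum>m \<in> Poly_Mapping.keys p. ?s p m) * ins hom v (\<Sum>m' \<in> Poly_Mapping.keys q. ?s q m')"
    by (simp add: sum_product ins_sum)
  finally show ?thesis
    using poly_mapping_sum_single[of p] poly_mapping_sum_single[of q] by simp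
qed

lemma (in comm_ring_hom) ins_Const [simp]: "ins hom v (Const c) = hom c"
  by (simp add: Const_def ins_single)

lemma (in comm_ring_hom) ins_var [simp]: "ins hom v (var i) = v i"
  by (simp add: var_def ins_single mon_eval_single)

lemma Const_simps:
  "Const 0 = 0" "Const 1 = 1" "Const (a + b) = Const a + Const b" "Const (a * b) = Const a * Const b"
  by (auto simp: Const_def single_add mult_single)

lemma (in comm_ring_hom) ins_hom: "comm_ring_hom (ins hom v)"
proof
  show "ins hom v 1 = 1" using ins_Const[of v 1] by (simp add: Const_simps)
  show "ins hom v 0 = 0" using ins_Const[of v 0] by (simp add: Const_simps)
qed (simp_all add: ins_add ins_mult)

interpretation Const: comm_ring_hom Const
  by unfold_locales (auto simp: Const_simps)

lemma Const_eq_iff [simp]: "Const a = Const b \<longleftrightarrow> a = b"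
  by (metis Const_def lookup_single_eq)

lemma id_hom: "comm_ring_hom (\<lambda>x. x)"
  by unfold_locales auto

lemma single_decompose: "Poly_Mapping.single m c = Const c * mon_eval var m"
proof -
  have *: "mon_eval var m' = (Poly_Mapping.single m' 1 :: 'a mpol)" for m'
  proof -
    have p: "(var i :: 'a mpol) ^ k = Poly_Mapping.single (Poly_Mapping.single i k) 1" for i k
      by (induction k) (auto simp: var_def mult_single single_add[symmetric])
    have pr: "finite A \<Longrightarrow> (\<Prod>i\<in>A. Poly_Mapping.single (f i) (1::'a)) = Poly_Mapping.single (sum f A) 1"
      for A and f :: "nat \<Rightarrow> monomial"
      by (induction A rule: finite_induct) (auto simp: mult_single)
    show ?thesis
      unfolding mon_eval_def p
      by (subst pr) (auto simp: poly_mapping_sum_single[of m', symmetric])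
  qed
  show ?thesis unfolding * by (simp add: Const_def mult_single)
qed

lemma mpol_expand: "p = (\<Sum>m \<in> Poly_Mapping.keys p. Const (Poly_Mapping.lookup p m) * mon_eval var m)"
  using poly_mapping_sum_single[of p] by (simp add: single_decompose)

text \<open>Almost every identity between operations on polynomials below is an instance of this: two
  ring homomorphisms agree as soon as they agree on constants and variables.\<close>

lemma hom_polys_eqI:
  assumes f: "comm_ring_hom f" and g: "comm_ring_hom g"
    and p: "p \<in> polys n"
    and c: "\<And>c. f (Const c) = g (Const c)" and v: "\<And>i. i \<in> {1..n} \<Longrightarrow> f (var i) = g (var i)"
  shows "f p = g p"
proof -
  interpret f: comm_ring_hom f by fact
  interpret g: comm_ring_hom g by fact
  have m: "f (mon_eval var m) = g (mon_eval var m)" if "m \<in> Poly_Mapping.keys p" for m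
  proof -
    have "i \<in> {1..n}" if "i \<in> Poly_Mapping.keys m" for i
      using p that \<open>m \<in> _\<close> unfolding polys_def by blast
    then show ?thesis using v unfolding mon_eval_def
      by (simp add: f.hom_prod g.hom_prod f.hom_power g.hom_power cong: prod.cong)
  qed
  have "f p = (\<Sum>m \<in> Poly_Mapping.keys p. f (Const (Poly_Mapping.lookup p m)) * f (mon_eval var m))"
    by (subst mpol_expand) (simp add: f.hom_sum f.hom_mult)
  also have "\<dots> = (\<Sum>m \<in> Poly_Mapping.keys p. g (Const (Poly_Mapping.lookup p m)) * g (mon_eval var m))"
    using c m by (intro sum.cong) auto
  also have "\<dots> = g p"
    by (subst (3) mpol_expand) (simp add: g.hom_sum g.hom_mult)
  finally show ?thesis .
qed

lemma hom_eqI: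
  assumes f: "comm_ring_hom f" and g: "comm_ring_hom g"
    and c: "\<And>c. f (Const c) = g (Const c)" and v: "\<And>i. f (var i) = g (var i)"
  shows "f p = g p"
proof -
  interpret f: comm_ring_hom f by fact
  interpret g: comm_ring_hom g by fact
  have m: "f (mon_eval var m) = g (mon_eval var m)" for m
    using v unfolding mon_eval_def
    by (auto simp: f.hom_prod g.hom_prod f.hom_power g.hom_power intro!: prod.cong)
  have "f p = (\<Sum>m \<in> Poly_Mapping.keys p. f (Const (Poly_Mapping.lookup p m)) * f (mon_eval var m))"
    by (subst mpol_expand) (simp add: f.hom_sum f.hom_mult)
  also have "\<dots> = g p"
    by (subst (3) mpol_expand) (simp add: g.hom_sum g.hom_mult c m)
  finally show ?thesis .
qed

lemma comp_hom:
  assumes "comm_ring_hom f" "comm_ring_hom g"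
  shows "comm_ring_hom (\<lambda>x. f (g x))"
proof -
  interpret f: comm_ring_hom f by fact
  interpret g: comm_ring_hom g by fact
  show ?thesis by unfold_locales (simp_all add: f.hom_add f.hom_mult g.hom_add g.hom_mult)
qed

lemma eval_poly_ins: "eval_poly p v = ins (\<lambda>x. x) v p"
  by (simp add: eval_poly_def ins_def mon_eval_def)

interpretation ev: comm_ring_hom "\<lambda>p. eval_poly p v" for v
  unfolding eval_poly_ins by (rule comm_ring_hom.ins_hom[OF id_hom])

lemma eval_poly_Const [simp]: "eval_poly (Const c) v = c"
  and eval_poly_var [simp]: "eval_poly (var i) v = v i"
  by (simp_all add: eval_poly_ins comm_ring_hom.ins_Const[OF id_hom] comm_ring_hom.ins_var[OF id_hom])

lemma of_int_hom': "comm_ring_hom (of_int :: int \<Rightarrow> 'a::comm_ring_1)"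
  by unfold_locales auto

lemma of_int_poly_ins: "of_int_poly p = ins (\<lambda>c. Const (of_int c)) var p"
proof -
  have l: "Poly_Mapping.lookup (of_int_poly p :: 'a mpol) m = of_int (Poly_Mapping.lookup p m)" for m
    by (simp add: of_int_poly_def map.rep_eq when_def)
  have "of_int_poly p = (\<Sum>m \<in> Poly_Mapping.keys p.
      Poly_Mapping.single m (of_int (Poly_Mapping.lookup p m)) :: 'a mpol)"
    by (rule poly_mapping_eqI) (auto simp: l lookup_sum lookup_single when_def in_keys_iff)
  then show ?thesis by (simp add: ins_def single_decompose)
qed

lemma lookup_of_int_poly: "Poly_Mapping.lookup (of_int_poly p) m = of_int (Poly_Mapping.lookup p m)"
  by (simp add: of_int_poly_def map.rep_eq when_def)

interpretation oi: comm_ring_hom "of_int_poly :: int mpol \<Rightarrow> 'a::comm_ring_1 mpol"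
  unfolding of_int_poly_ins[abs_def]
  by (rule comm_ring_hom.ins_hom) (rule comp_hom[OF Const.comm_ring_hom_axioms of_int_hom'])

lemma of_int_poly_Const [simp]: "of_int_poly (Const c) = Const (of_int c)"
  and of_int_poly_var [simp]: "of_int_poly (var i) = var i"
  by (simp_all add: of_int_poly_ins
      comm_ring_hom.ins_Const[OF comp_hom[OF Const.comm_ring_hom_axioms of_int_hom']]
      comm_ring_hom.ins_var[OF comp_hom[OF Const.comm_ring_hom_axioms of_int_hom']])

lemma of_int_poly_inj:
  "(of_int_poly p :: 'a::{comm_ring_1,ring_char_0} mpol) = of_int_poly q \<longleftrightarrow> p = q"
  by (metis lookup_of_int_poly of_int_eq_iff poly_mapping_eqI)

lemma act_poly_ins:
  assumes "bij g"
  shows "act_poly g p = ins Const (\<lambda>i. var (g i)) p"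
proof -
  note i = inj_map_key_perm[OF assms] and ig = bij_is_inj[OF assms]
  have s: "act_poly g (sum f A) = (\<Sum>a\<in>A. act_poly g (f a))" for A and f :: "monomial \<Rightarrow> 'a mpol"
    by (induction A rule: infinite_finite_induct) (simp_all add: act_poly_def map_key_plus[OF i] map_key_zero[OF i])
  have m: "mon_eval v (Poly_Mapping.map_key (Hilbert_Choice.inv g) m) = mon_eval (\<lambda>k. v (g k)) m"
    for v :: "nat \<Rightarrow> 'a mpol" and m
  proof -
    have j: "inj (Hilbert_Choice.inv g)" using assms by (simp add: bij_imp_bij_inv bij_is_inj)
    have "bij_betw g (Poly_Mapping.keys m) (Hilbert_Choice.inv g -` Poly_Mapping.keys m)"
      by (rule bij_betw_byWitness[where f' = "Hilbert_Choice.inv g"])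
        (use assms ig in \<open>auto simp: inv_f_f surj_f_inv_f[OF bij_is_surj]\<close>)
    from prod.reindex_bij_betw[OF this, of "\<lambda>i. v i ^ Poly_Mapping.lookup m (Hilbert_Choice.inv g i)"] show ?thesis
      by (simp add: mon_eval_def keys_map_key[OF j] map_key.rep_eq[OF j] inv_f_f[OF ig])
  qed
  have si: "act_poly g (Poly_Mapping.single m c) = Const c * mon_eval (\<lambda>i. var (g i)) m" for m and c :: 'a
  proof -
    have "Poly_Mapping.map_key g (Poly_Mapping.map_key (Hilbert_Choice.inv g) m) = m"
      using assms by (intro poly_mapping_eqI)
        (simp add: map_key.rep_eq[OF ig] map_key.rep_eq[OF bij_is_inj[OF bij_imp_bij_inv[OF assms]]] inv_f_f[OF ig])
    then have "act_poly g (Poly_Mapping.single m c) =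
        Poly_Mapping.single (Poly_Mapping.map_key (Hilbert_Choice.inv g) m) c"
      unfolding act_poly_def by (metis map_key_single[OF i])
    then show ?thesis by (simp add: single_decompose m)
  qed
  show ?thesis
    by (subst poly_mapping_sum_single) (simp add: s si ins_def)
qed

lemma act_poly_hom:
  assumes "bij g"
  shows "comm_ring_hom (act_poly g :: 'a::comm_ring_1 mpol \<Rightarrow> 'a mpol)"
proof -
  have "act_poly g = (ins Const (\<lambda>i. var (g i)) :: 'a mpol \<Rightarrow> 'a mpol)"
    by (rule ext) (rule act_poly_ins[OF assms])
  then show ?thesis using Const.ins_hom by simp
qed

lemma act_poly_Const [simp]: "bij g \<Longrightarrow> act_poly g (Const c) = Const c"
  by (simp add: act_poly_ins)

lemma act_poly_id [simp]: "act_poly id p = p"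
  by (rule hom_eqI[OF act_poly_hom id_hom]) (simp_all add: act_poly_var)

lemma act_poly_comp: "bij g \<Longrightarrow> bij h \<Longrightarrow> act_poly g (act_poly h p) = act_poly (g \<circ> h) p"
  by (rule hom_eqI[OF comp_hom[OF act_poly_hom act_poly_hom] act_poly_hom])
     (simp_all add: act_poly_var bij_comp)

lemma act_poly_of_int_poly: "bij g \<Longrightarrow> act_poly g (of_int_poly p) = of_int_poly (act_poly g p)"
  by (rule hom_eqI[OF comp_hom[OF act_poly_hom oi.comm_ring_hom_axioms]
        comp_hom[OF oi.comm_ring_hom_axioms act_poly_hom]]) (simp_all add: act_poly_var)

lemma eval_act_poly: "bij g \<Longrightarrow> eval_poly (act_poly g p) v = eval_poly p (v \<circ> g)"
  by (rule hom_eqI[OF comp_hom[OF ev.comm_ring_hom_axioms act_poly_hom] ev.comm_ring_hom_axioms])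
     (simp_all add: act_poly_var)

lemma eval_of_int_poly: "eval_poly (of_int_poly p) (\<lambda>i. of_int (v i)) = of_int (eval_poly p v)"
  by (rule hom_eqI[OF comp_hom[OF ev.comm_ring_hom_axioms oi.comm_ring_hom_axioms]
        comp_hom[OF of_int_hom' ev.comm_ring_hom_axioms]]) simp_all

subsection \<open>The ring of polynomials in the first variables\<close>

text \<open>A retraction onto the ring of polynomials in the first variables; membership becomes an equation
  between homomorphisms.\<close>

definition trunc_vars :: "nat \<Rightarrow> 'a::comm_ring_1 mpol \<Rightarrow> 'a mpol" where
  "trunc_vars n p = ins Const (\<lambda>i. if i \<in> {1..n} then var i else 0) p"

interpretation tv: comm_ring_hom "trunc_vars n :: 'a::comm_ring_1 mpol \<Rightarrow> 'a mpol" for n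
  unfolding trunc_vars_def[abs_def] by (rule Const.ins_hom)

lemma trunc_vars_var: "trunc_vars n (var i) = (if i \<in> {1..n} then var i else 0)"
  and trunc_vars_Const: "trunc_vars n (Const c) = Const c"
  by (simp_all add: trunc_vars_def)

lemma polys_add: "p \<in> polys n \<Longrightarrow> q \<in> polys n \<Longrightarrow> p + q \<in> polys n"
  unfolding polys_def using Poly_Mapping.keys_add[of p q] by blast

lemma polys_single: "Poly_Mapping.keys m \<subseteq> {1..n} \<Longrightarrow> Poly_Mapping.single m c \<in> polys n"
  by (auto simp: polys_def)

lemma polys_0: "0 \<in> polys n"
  by (simp add: polys_def)

lemma polys_sum: "(\<And>a. a \<in> A \<Longrightarrow> f a \<in> polys n) \<Longrightarrow> sum f A \<in> polys n"
  by (induction A rule: infinite_finite_induct) (auto simp: polys_add polys_0)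

lemma polys_iff: "p \<in> polys n \<longleftrightarrow> trunc_vars n p = p"
proof
  assume "p \<in> polys n"
  from hom_polys_eqI[OF tv.comm_ring_hom_axioms id_hom this] show "trunc_vars n p = p"
    by (simp add: trunc_vars_var trunc_vars_Const)
next
  have "mon_eval (\<lambda>i. if i \<in> {1..n} then var i else 0) m \<in> polys n" for m
  proof (cases "Poly_Mapping.keys m \<subseteq> {1..n}")
    case True
    then have "mon_eval (\<lambda>i. if i \<in> {1..n} then var i else 0) m = mon_eval var m"
      unfolding mon_eval_def by (intro prod.cong) auto
    also have "\<dots> = Poly_Mapping.single m 1" by (simp add: single_decompose Const_simps)
    finally show ?thesis using polys_single[OF True, of 1] by metis
  next
    case False
    then obtain i where "i \<in> Poly_Mapping.keys m" "i \<notin> {1..n}" by blast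
    then have "mon_eval (\<lambda>i. if i \<in> {1..n} then var i else 0) m = 0"
      unfolding mon_eval_def by (intro prod_zero bexI[of _ i]) (auto simp: in_keys_iff power_0_left)
    then show ?thesis using polys_0 by metis
  qed
  moreover have "Const c * p \<in> polys n" if "p \<in> polys n" for c and p :: "'a mpol"
  proof -
    have "Poly_Mapping.lookup (Const c * p) m = c * Poly_Mapping.lookup p m" for m
      unfolding Const_def using mult_map_scale_conv_mult[of c p, symmetric]
      by (simp add: map.rep_eq when_def)
    then have "Poly_Mapping.keys (Const c * p) \<subseteq> Poly_Mapping.keys p"
      by (auto simp: in_keys_iff)
    then show ?thesis using that by (auto simp: polys_def)
  qed
  ultimately have "trunc_vars n p \<in> polys n"
    unfolding trunc_vars_def ins_def by (intro polys_sum) auto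
  then show "trunc_vars n p = p \<Longrightarrow> p \<in> polys n" by simp
qed

lemma polys_closed:
  "0 \<in> polys n" "1 \<in> polys n" "Const c \<in> polys n"
  "i \<in> {1..n} \<Longrightarrow> var i \<in> polys n"
  "p \<in> polys n \<Longrightarrow> q \<in> polys n \<Longrightarrow> p + q \<in> polys n"
  "p \<in> polys n \<Longrightarrow> q \<in> polys n \<Longrightarrow> p - q \<in> polys n"
  "p \<in> polys n \<Longrightarrow> q \<in> polys n \<Longrightarrow> p * q \<in> polys n"
  "p \<in> polys n \<Longrightarrow> - p \<in> polys n"
  "p \<in> polys n \<Longrightarrow> p ^ k \<in> polys n"
  by (auto simp: polys_iff trunc_vars_var trunc_vars_Const tv.hom_add tv.hom_minus tv.hom_mult tv.hom_uminus tv.hom_power)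

lemma polys_prod: "(\<And>a. a \<in> A \<Longrightarrow> f a \<in> polys n) \<Longrightarrow> prod f A \<in> polys n"
  by (induction A rule: infinite_finite_induct) (auto simp: polys_closed)

lemma polys_act:
  assumes "g permutes {1..n}" "p \<in> polys n"
  shows "act_poly g p \<in> polys n"
proof -
  have b: "bij g" using assms(1) permutes_bij by blast
  have "trunc_vars n (act_poly g p) = act_poly g p"
    by (rule hom_polys_eqI[OF comp_hom[OF tv.comm_ring_hom_axioms act_poly_hom[OF b]] act_poly_hom[OF b] assms(2)])
      (use permutes_in_image[OF assms(1)] in \<open>auto simp: trunc_vars_Const b act_poly_var trunc_vars_var\<close>)
  then show ?thesis by (simp add: polys_iff)
qed

lemma polys_of_int_poly: "p \<in> polys n \<Longrightarrow> of_int_poly p \<in> polys n"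
  by (auto simp: polys_def in_keys_iff lookup_of_int_poly)

section \<open>Homogeneous components\<close>

text \<open>The polynomial \<open>p(x\<^sub>1 t, x\<^sub>2 t, \<dots>)\<close> in \<open>t\<close>. It depends on \<open>p\<close> by a ring homomorphism, and its
  coefficients are the homogeneous components.\<close>

definition Psi :: "'a::comm_ring_1 mpol \<Rightarrow> 'a mpol poly" where
  "Psi p = ins (\<lambda>c. [:Const c:]) (\<lambda>i. Polynomial.monom (var i) 1) p"

definition hc :: "nat \<Rightarrow> 'a::comm_ring_1 mpol \<Rightarrow> 'a mpol" where
  "hc d p = Polynomial.coeff (Psi p) d"

lemma Const_pCons_hom: "comm_ring_hom (\<lambda>c. [:Const c:])"
  by unfold_locales (auto simp: Const_simps)

interpretation Psi: comm_ring_hom "Psi :: 'a::comm_ring_1 mpol \<Rightarrow> 'a mpol poly"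
  unfolding Psi_def[abs_def] by (rule comm_ring_hom.ins_hom[OF Const_pCons_hom])

lemma Psi_single: "Psi (Poly_Mapping.single m c) = Polynomial.monom (Poly_Mapping.single m c) (mon_degree m)"
proof -
  have pm: "finite A \<Longrightarrow> (\<Prod>i\<in>A. Polynomial.monom (f i) (k i)) = Polynomial.monom (\<Prod>i\<in>A. f i) (\<Sum>i\<in>A. k i)"
    for A and f :: "nat \<Rightarrow> 'a mpol" and k
    by (induction A rule: finite_induct) (auto simp: mult_monom)
  show ?thesis
    unfolding Psi_def comm_ring_hom.ins_single[OF Const_pCons_hom]
    by (simp add: mon_eval_def monom_power pm mon_degree_def smult_monom single_decompose)
qed

lemma lookup_hc: "Poly_Mapping.lookup (hc d p) m = (if mon_degree m = d then Poly_Mapping.lookup p m else 0)"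
proof -
  have "Psi p = (\<Sum>m \<in> Poly_Mapping.keys p. Polynomial.monom (Poly_Mapping.single m (Poly_Mapping.lookup p m)) (mon_degree m))"
    by (subst poly_mapping_sum_single) (simp add: Psi.hom_sum Psi_single)
  then have "Poly_Mapping.lookup (hc d p) m = (\<Sum>m' \<in> Poly_Mapping.keys p. Poly_Mapping.lookup
      (Polynomial.coeff (Polynomial.monom (Poly_Mapping.single m' (Poly_Mapping.lookup p m')) (mon_degree m')) d) m)"
    by (simp only: hc_def coeff_sum lookup_sum)
  also have "\<dots> = (\<Sum>m' \<in> Poly_Mapping.keys p.
      if m' = m then if mon_degree m = d then Poly_Mapping.lookup p m else 0 else 0)"
    by (intro sum.cong) (auto simp: lookup_single when_def)
  finally show ?thesis by (auto simp: in_keys_iff)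
qed

lemma hc_0 [simp]: "hc d 0 = 0"
  and hc_add: "hc d (p + q) = hc d p + hc d q"
  and hc_minus: "hc d (p - q) = hc d p - hc d q"
  and hc_sum: "hc d (sum f A) = (\<Sum>a\<in>A. hc d (f a))"
  by (simp_all add: hc_def Psi.hom_add Psi.hom_minus Psi.hom_sum coeff_sum)

lemma homogeneous_hc: "homogeneous d (hc d p)"
  by (auto simp: homogeneous_def in_keys_iff lookup_hc split: if_splits)

lemma homogeneous_iff: "homogeneous d p \<longleftrightarrow> hc d p = p"
proof
  assume "homogeneous d p"
  then show "hc d p = p"
    by (intro poly_mapping_eqI) (auto simp: lookup_hc homogeneous_def in_keys_iff)
qed (metis homogeneous_hc)

lemma hc_homogeneous: "homogeneous d p \<Longrightarrow> hc e p = (if e = d then p else 0)"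
  by (intro poly_mapping_eqI) (auto simp: lookup_hc homogeneous_def in_keys_iff)

lemma Psi_homogeneous: "homogeneous d p \<longleftrightarrow> Psi p = Polynomial.monom p d"
proof
  assume "homogeneous d p"
  then show "Psi p = Polynomial.monom p d"
    using hc_homogeneous[of d p, unfolded hc_def] by (intro poly_eqI) auto
qed (simp add: homogeneous_iff hc_def)

lemma sum_hc: "p = (\<Sum>d \<le> Polynomial.degree (Psi p). hc d p)"
proof (rule poly_mapping_eqI)
  fix m
  have "mon_degree m \<le> Polynomial.degree (Psi p)" if "Poly_Mapping.lookup p m \<noteq> 0"
  proof (rule le_degree)
    have "Poly_Mapping.lookup (hc (mon_degree m) p) m \<noteq> 0" using that by (simp add: lookup_hc)
    then show "Polynomial.coeff (Psi p) (mon_degree m) \<noteq> 0" by (auto simp: hc_def)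
  qed
  then show "Poly_Mapping.lookup p m = Poly_Mapping.lookup (\<Sum>d \<le> Polynomial.degree (Psi p). hc d p) m"
    by (auto simp: lookup_sum lookup_hc)
qed

lemma hc_mult_homogeneous:
  assumes "homogeneous e q"
  shows "hc k (q * p) = (if k < e then 0 else q * hc (k - e) p)"
  using assms unfolding Psi_homogeneous hc_def by (simp add: Psi.hom_mult coeff_monom_mult)

lemma homogeneous_0 [simp]: "homogeneous d 0"
  by (simp add: homogeneous_iff)

lemma homogeneous_Const: "homogeneous 0 (Const c)"
  unfolding Psi_homogeneous Const_def by (simp add: Psi_single mon_degree_def)

lemma homogeneous_var: "homogeneous 1 (var i)"
  unfolding Psi_homogeneous var_def by (simp add: Psi_single mon_degree_def)

lemma homogeneous_add: "homogeneous d p \<Longrightarrow> homogeneous d q \<Longrightarrow> homogeneous d (p + q)"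
  and homogeneous_minus: "homogeneous d p \<Longrightarrow> homogeneous d q \<Longrightarrow> homogeneous d (p - q)"
  by (simp_all add: homogeneous_iff hc_add hc_minus)

lemma homogeneous_sum: "(\<And>a. a \<in> A \<Longrightarrow> homogeneous d (f a)) \<Longrightarrow> homogeneous d (sum f A)"
  by (simp add: homogeneous_iff hc_sum)

lemma homogeneous_mult: "homogeneous d p \<Longrightarrow> homogeneous e q \<Longrightarrow> homogeneous (d + e) (p * q)"
  by (simp add: homogeneous_iff[of "d + e"] hc_mult_homogeneous hc_homogeneous)

lemma homogeneous_Const_mult: "homogeneous d p \<Longrightarrow> homogeneous d (Const c * p)"
  using homogeneous_mult[OF homogeneous_Const] by fastforce

lemma homogeneous_prod:
  "(\<And>a. a \<in> A \<Longrightarrow> homogeneous (k a) (f a)) \<Longrightarrow> homogeneous (sum k A) (prod f A)"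
  using homogeneous_Const[of 1]
  by (induction A rule: infinite_finite_induct) (auto simp: Const_simps homogeneous_mult)

lemma homogeneous_power: "homogeneous d p \<Longrightarrow> homogeneous (k * d) (p ^ k)"
  using homogeneous_prod[of "{..<k}" "\<lambda>_. d" "\<lambda>_. p"] by simp

lemma homogeneous_0_Const: "homogeneous 0 p \<Longrightarrow> p = Const (Poly_Mapping.lookup p 0)"
  unfolding homogeneous_def
proof (rule poly_mapping_eqI)
  fix m assume *: "\<forall>m\<in>Poly_Mapping.keys p. mon_degree m = 0"
  show "Poly_Mapping.lookup p m = Poly_Mapping.lookup (Const (Poly_Mapping.lookup p 0)) m"
  proof (cases "m = 0")
    case False
    then obtain i where "Poly_Mapping.lookup m i \<noteq> 0" by (metis lookup_zero poly_mapping_eqI)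
    then have "mon_degree m \<noteq> 0" by (auto simp: mon_degree_def in_keys_iff)
    with * have "m \<notin> Poly_Mapping.keys p" by auto
    with False show ?thesis by (simp add: Const_def lookup_single when_def in_keys_iff)
  qed (simp add: Const_def)
qed

lemma homogeneous_act:
  assumes g: "bij g" and p: "homogeneous d p"
  shows "homogeneous d (act_poly g p)"
proof -
  have "homogeneous d (Const c * mon_eval (\<lambda>i. var (g i)) m)" if "mon_degree m = d" for m and c :: 'a
  proof (rule homogeneous_Const_mult)
    show "homogeneous d (mon_eval (\<lambda>i. var (g i) :: 'a mpol) m)"
      unfolding that[symmetric] mon_degree_def mon_eval_def
      using homogeneous_power[OF homogeneous_var] by (intro homogeneous_prod) simp
  qed
  with p show ?thesis
    unfolding act_poly_ins[OF g] ins_def homogeneous_def[of d p] by (intro homogeneous_sum) auto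
qed

lemma hc_act:
  assumes g: "bij g"
  shows "hc d (act_poly g p) = act_poly g (hc d p)"
proof -
  interpret a: comm_ring_hom "act_poly g :: 'a mpol \<Rightarrow> 'a mpol" by (rule act_poly_hom[OF g])
  let ?N = "Polynomial.degree (Psi p)"
  have "hc d (act_poly g p) = (\<Sum>e\<le>?N. hc d (act_poly g (hc e p)))"
    by (subst sum_hc) (simp only: a.hom_sum hc_sum)
  also have "\<dots> = (\<Sum>e\<le>?N. act_poly g (hc d (hc e p)))"
    by (intro sum.cong) (auto simp: hc_homogeneous[OF homogeneous_act[OF g homogeneous_hc]]
        hc_homogeneous[OF homogeneous_hc])
  also have "\<dots> = act_poly g (hc d p)"
    by (subst (5) sum_hc) (simp only: a.hom_sum hc_sum)
  finally show ?thesis .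
qed

lemma hc_polys: "p \<in> polys n \<Longrightarrow> hc d p \<in> polys n"
  by (auto simp: polys_def in_keys_iff lookup_hc split: if_splits)

lemma homogeneous_of_int_poly: "homogeneous d p \<Longrightarrow> homogeneous d (of_int_poly p)"
  by (auto simp: homogeneous_def in_keys_iff lookup_of_int_poly)

lemma homogeneous_of_int_poly_iff:
  "homogeneous d (of_int_poly p :: 'a::{comm_ring_1,ring_char_0} mpol) \<longleftrightarrow> homogeneous d p"
proof -
  have "Poly_Mapping.keys (of_int_poly p :: 'a mpol) = Poly_Mapping.keys p"
    by (auto simp: in_keys_iff lookup_of_int_poly)
  then show ?thesis by (simp add: homogeneous_def)
qed

lemma dvd_Const_imp_Const:
  fixes p q :: "'a::idom mpol"
  assumes "p * q = Const c" "c \<noteq> 0"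
  obtains a where "p = Const a" "a \<noteq> 0"
proof -
  have "Psi p * Psi q = [:Const c:]"
    using assms(1) homogeneous_Const[of c] by (metis Psi.hom_mult Psi_homogeneous monom_0)
  moreover have "[:Const c:] \<noteq> 0" using assms(2) by (metis Const.hom_zero Const_eq_iff pCons_eq_0_iff)
  ultimately have "Polynomial.degree (Psi p) = 0"
    by (metis degree_mult_eq_0 degree_pCons_0 mult_zero_left mult_zero_right)
  then have "p = hc 0 p" by (subst sum_hc) simp
  then have "p = Const (Poly_Mapping.lookup p 0)" using homogeneous_0_Const homogeneous_hc by metis
  then show ?thesis using assms that by (metis Const.hom_zero Const_eq_iff mult_zero_left)
qed

lemma homogeneous_quotient:
  fixes D q :: "'a::idom mpol"
  assumes D: "homogeneous r D" "D \<noteq> 0" and d: "homogeneous d (D * q)"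
  shows "homogeneous (d - r) q" and "d < r \<Longrightarrow> q = 0"
proof -
  have *: "D * q = (if d < r then 0 else D * hc (d - r) q)"
    using d hc_mult_homogeneous[OF D(1)] by (simp add: homogeneous_iff)
  show q0: "q = 0" if "d < r" using * D(2) that by simp
  show "homogeneous (d - r) q"
  proof (cases "d < r")
    case False
    then have "q = hc (d - r) q" using * D(2) by simp
    then show ?thesis using homogeneous_hc by metis
  qed (simp add: q0)
qed

section \<open>Divisibility by products of differences of variables\<close>

text \<open>The kernel of this homomorphism is the ideal generated by \<open>x\<^sub>i - x\<^sub>j\<close>, so divisibility by
  \<open>x\<^sub>i - x\<^sub>j\<close> is an equation.\<close>

definition ident :: "nat \<Rightarrow> nat \<Rightarrow> 'a::comm_ring_1 mpol \<Rightarrow> 'a mpol" where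
  "ident i j p = ins Const (\<lambda>k. if k = i then var j else var k) p"

interpretation ident: comm_ring_hom "ident i j :: 'a::comm_ring_1 mpol \<Rightarrow> 'a mpol" for i j
  unfolding ident_def[abs_def] by (rule Const.ins_hom)

lemma ident_var: "ident i j (var k) = (if k = i then var j else var k)"
  and ident_Const: "ident i j (Const c) = Const c"
  by (simp_all add: ident_def)

lemma dvd_prod_diff:
  fixes L :: "'a::comm_ring_1"
  assumes "\<And>a. a \<in> A \<Longrightarrow> L dvd f a - g a"
  shows "L dvd prod f A - prod g A"
  using assms
proof (induction A rule: infinite_finite_induct)
  case (insert x F)
  have "f x * prod f F - g x * prod g F = (f x - g x) * prod f F + g x * (prod f F - prod g F)"
    by (simp add: algebra_simps)
  with insert show ?case by simp
qed auto

lemma dvd_diff_ident: "(var i - var j) dvd p - ident i j p"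
proof -
  let ?v = "\<lambda>k. if k = i then var j else var k :: 'a mpol"
  have "(var i - var j) dvd mon_eval var m - mon_eval ?v m" for m
  proof (unfold mon_eval_def, rule dvd_prod_diff)
    fix k
    have "(var i - var j) dvd (\<Prod>l\<in>{..<Poly_Mapping.lookup m k}. var k) - (\<Prod>l\<in>{..<Poly_Mapping.lookup m k}. ?v k)"
      by (rule dvd_prod_diff) auto
    then show "(var i - var j) dvd var k ^ Poly_Mapping.lookup m k - ?v k ^ Poly_Mapping.lookup m k" by simp
  qed
  moreover have "p - ident i j p = (\<Sum>m \<in> Poly_Mapping.keys p. Const (Poly_Mapping.lookup p m) * (mon_eval var m - mon_eval ?v m))"
    by (subst mpol_expand) (simp add: ident_def ins_def sum_subtractf[symmetric] algebra_simps)
  ultimately show ?thesis by (auto intro!: dvd_sum)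
qed

lemma var_eq_iff [simp]: "(var i :: 'a::comm_ring_1 mpol) = var j \<longleftrightarrow> i = j"
proof
  assume "(var i :: 'a mpol) = var j"
  then have "eval_poly (var i) (\<lambda>k. if k = i then 1 else 0) = eval_poly (var j) (\<lambda>k. if k = i then (1::'a) else 0)"
    by simp
  then show "i = j" by (auto split: if_splits)
qed simp

lemma dvd_iff_ident: "(var i - var j) dvd p \<longleftrightarrow> ident i j p = 0"
proof
  assume "(var i - var j) dvd p"
  then obtain q where "p = (var i - var j) * q" ..
  then show "ident i j p = 0" by (simp add: ident.hom_mult ident.hom_minus ident_var)
next
  assume "ident i j p = 0"
  with dvd_diff_ident[of i j p] show "(var i - var j) dvd p" by simp
qed

lemma ident_act_transpose: "ident i j (act_poly (transpose i j) p) = ident i j p"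
proof -
  have b: "bij (transpose i j)" by simp
  show ?thesis
    by (rule hom_eqI[OF comp_hom[OF ident.comm_ring_hom_axioms act_poly_hom[OF b]] ident.comm_ring_hom_axioms])
       (auto simp: act_poly_var ident_var ident_Const transpose_def)
qed

lemma dvd_power_cancel:
  fixes A y :: "'a::idom mpol"
  assumes "i \<noteq> j" "(var i - var j) ^ e dvd A * y" "ident i j A \<noteq> 0"
  shows "(var i - var j) ^ e dvd y"
  using assms(2)
proof (induction e arbitrary: y)
  case (Suc e)
  let ?L = "var i - var j :: 'a mpol"
  have L0: "?L \<noteq> 0" using assms(1) by simp
  have "?L dvd ?L ^ Suc e" by simp
  then have "?L dvd A * y" using Suc.prems by (rule dvd_trans)
  then have "ident i j A * ident i j y = 0" unfolding dvd_iff_ident ident.hom_mult .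
  then have "?L dvd y" using assms(3) unfolding dvd_iff_ident by simp
  then obtain y' where y: "y = ?L * y'" ..
  have "?L * ?L ^ e dvd ?L * (A * y')" using Suc.prems unfolding y by (simp only: power_Suc ac_simps)
  then have "?L ^ e dvd A * y'" using L0 unfolding dvd_mult_cancel_left by blast
  then have "?L ^ e dvd y'" by (rule Suc.IH)
  then show ?case unfolding y power_Suc by (rule mult_dvd_mono[OF dvd_refl])
qed simp

text \<open>The differences are primes and pairwise not associated: identifying the two variables of one of
  them does not annihilate the others.\<close>

lemma prod_diff_dvd:
  fixes x :: "'a::idom mpol"
  assumes "finite P" "\<And>i j. (i, j) \<in> P \<Longrightarrow> i < j" "\<And>i j. (i, j) \<in> P \<Longrightarrow> (var i - var j) ^ e i j dvd x"
  shows "(\<Prod>(i, j) \<in> P. (var i - var j) ^ e i j) dvd x"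
  using assms
proof (induction P rule: finite_induct)
  case (insert q P)
  obtain i j where q: "q = (i, j)" by (cases q)
  let ?A = "\<Prod>(i, j) \<in> P. (var i - var j) ^ e i j :: 'a mpol"
  have "?A dvd x" using insert by auto
  then obtain y where x: "x = ?A * y" ..
  have ij: "i < j" using insert.prems(1) q by auto
  have I1: "ident i j ?A \<noteq> 0"
  proof -
    have "ident i j (case p of (k, l) \<Rightarrow> (var k - var l) ^ e k l) \<noteq> (0 :: 'a mpol)" if "p \<in> P" for p
    proof -
      obtain k l where p: "p = (k, l)" by (cases p)
      have "k < l" "(k, l) \<noteq> (i, j)" using insert q that p by auto
      then show ?thesis using ij
        by (auto simp: p ident.hom_power ident.hom_minus ident_var)
    qed
    then show ?thesis using insert(1) by (simp add: ident.hom_prod)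
  qed
  have "(var i - var j) ^ e i j dvd x"
    by (rule insert.prems(2)) (simp add: q)
  then have I2: "(var i - var j) ^ e i j dvd ?A * y" using x by (rule back_subst)
  have "(var i - var j) ^ e i j dvd y"
    by (rule dvd_power_cancel[OF less_imp_neq[OF ij] I2 I1])
  then have "?A * (var i - var j) ^ e i j dvd ?A * y" by (rule mult_dvd_mono[OF dvd_refl])
  moreover have "(\<Prod>(i, j) \<in> insert q P. (var i - var j) ^ e i j) = (var i - var j) ^ e i j * ?A"
    by (subst prod.insert[OF insert(1,2)]) (simp only: q prod.case)
  ultimately show ?case unfolding x by (simp only: mult.commute)
qed simp

lemma prod_diff_neq_0:
  assumes "finite P" "\<And>i j. (i, j) \<in> P \<Longrightarrow> i < j"
  shows "(\<Prod>(i, j) \<in> P. (var i - var j) ^ e i j) \<noteq> (0 :: 'a::idom mpol)"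
  using assms(1) by (auto simp: prod_zero_iff dest: assms(2))

section \<open>Content\<close>

lemma lookup_Const_mult: "Poly_Mapping.lookup (Const c * p) m = c * Poly_Mapping.lookup p m"
  unfolding Const_def using mult_map_scale_conv_mult[of c p, symmetric]
  by (simp add: map.rep_eq when_def)

lemma content_Const_mult: "content (Const c * p) = \<bar>c\<bar> * content p"
proof -
  have "range (Poly_Mapping.lookup (Const c * p)) = (*) c ` range (Poly_Mapping.lookup p)"
    by (auto simp: lookup_Const_mult image_def)
  then show ?thesis by (simp add: content_def Gcd_mult abs_mult)
qed

text \<open>Under \<open>x\<^sub>i \<mapsto> t\<^sup>i\<close> each factor becomes a polynomial in \<open>t\<close> with leading coefficient
  \<open>\<plusminus>1\<close>, so no integer other than a unit divides the product.\<close>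

lemma content_prod_diff:
  assumes "finite P" "\<And>i j. (i, j) \<in> P \<Longrightarrow> i < j"
  shows "content (\<Prod>(i, j) \<in> P. (var i - var j) ^ e i j) = 1"
proof -
  define p :: "int mpol" where "p = (\<Prod>(i, j) \<in> P. (var i - var j) ^ e i j)"
  have h: "comm_ring_hom (\<lambda>c::int. [:c:])" by unfold_locales auto
  define k where "k = ins (\<lambda>c::int. [:c:]) (\<lambda>i. Polynomial.monom 1 i)"
  interpret k: comm_ring_hom k unfolding k_def by (rule comm_ring_hom.ins_hom[OF h])
  have kv: "k (var i) = Polynomial.monom 1 i" "k (Const c) = [:c:]" for i c
    by (simp_all add: k_def comm_ring_hom.ins_var[OF h] comm_ring_hom.ins_Const[OF h])
  have l: "lead_coeff (Polynomial.monom 1 i - Polynomial.monom 1 j :: int poly) = -1" if "i < j" for i j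
  proof -
    have "Polynomial.degree (Polynomial.monom 1 i - Polynomial.monom 1 j :: int poly) = j"
    proof (rule antisym)
      show "Polynomial.degree (Polynomial.monom 1 i - Polynomial.monom 1 j :: int poly) \<le> j"
        using that by (intro degree_diff_le) (auto simp: degree_monom_eq)
      show "j \<le> Polynomial.degree (Polynomial.monom 1 i - Polynomial.monom 1 j :: int poly)"
        using that by (intro le_degree) auto
    qed
    then show ?thesis using that by simp
  qed
  have "lead_coeff (k p) = (\<Prod>(i, j) \<in> P. (-1) ^ e i j)"
    unfolding p_def k.hom_prod lead_coeff_prod
  proof (intro prod.cong refl, clarify)
    fix i j assume "(i, j) \<in> P"
    from l[OF assms(2)[OF this]] show "lead_coeff (k ((var i - var j) ^ e i j)) = (-1) ^ e i j"
      by (simp only: k.hom_power k.hom_minus kv lead_coeff_power)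
  qed
  moreover have "\<bar>\<Prod>(i, j) \<in> P. (-1) ^ e i j :: int\<bar> = 1"
    unfolding abs_prod by (rule prod.neutral) (auto simp: power_abs)
  ultimately have u: "\<bar>lead_coeff (k p)\<bar> = 1" by metis
  define f where "f m = Poly_Mapping.lookup p m div content p" for m
  have f: "Poly_Mapping.lookup p m = content p * f m" for m
    by (simp add: content_def f_def)
  define S where "S = (\<Sum>m \<in> Poly_Mapping.keys p. Const (f m) * mon_eval var m :: int mpol)"
  have p1: "p = (\<Sum>m \<in> Poly_Mapping.keys p. Const (content p) * (Const (f m) * mon_eval var m))"
    by (subst mpol_expand, intro sum.cong refl) (simp only: f Const_simps mult.assoc)
  have "p = Const (content p) * S" unfolding S_def sum_distrib_left by (rule p1)
  then have "k p = k (Const (content p) * S)" by (rule arg_cong)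
  also have "\<dots> = [:content p:] * k S" by (simp only: k.hom_mult kv)
  finally have kp: "k p = [:content p:] * k S" .
  have "lead_coeff (k p) = lead_coeff [:content p:] * lead_coeff (k S)"
    unfolding kp by (rule lead_coeff_mult)
  moreover have "lead_coeff [:c:] = c" for c :: int by simp
  ultimately have "content p dvd lead_coeff (k p)" by (metis dvd_triv_left)
  then have "content p dvd \<bar>lead_coeff (k p)\<bar>" unfolding dvd_abs_iff .
  then have "content p dvd 1" unfolding u .
  moreover have "content p \<ge> 0" by (simp add: content_def)
  ultimately have "content p = 1" by (metis abs_of_nonneg zdvd1_eq)
  then show ?thesis unfolding p_def .
qed

lemma act_poly_distribs:
  fixes p q :: "'a::comm_ring_1 mpol"
  assumes "bij g"
  shows "act_poly g (p + q) = act_poly g p + act_poly g q"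
    "act_poly g (p - q) = act_poly g p - act_poly g q"
    "act_poly g (p * q) = act_poly g p * act_poly g q"
    "act_poly g (- p) = - act_poly g p"
    "act_poly g (0 :: 'a mpol) = 0"
    "act_poly g (1 :: 'a mpol) = 1"
    "act_poly g (sum f A) = (\<Sum>x\<in>A. act_poly g (f x :: 'a mpol))"
    "act_poly g (prod f A) = (\<Prod>x\<in>A. act_poly g (f x :: 'a mpol))"
proof -
  interpret a: comm_ring_hom "act_poly g :: 'a mpol \<Rightarrow> 'a mpol" by (rule act_poly_hom[OF assms])
  show "act_poly g (p + q) = act_poly g p + act_poly g q" by (rule a.hom_add)
  show "act_poly g (p - q) = act_poly g p - act_poly g q" by (rule a.hom_minus)
  show "act_poly g (p * q) = act_poly g p * act_poly g q" by (rule a.hom_mult)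
  show "act_poly g (- p) = - act_poly g p" by (rule a.hom_uminus)
  show "act_poly g (0 :: 'a mpol) = 0" by (rule a.hom_zero)
  show "act_poly g (1 :: 'a mpol) = 1" by (rule a.hom_one)
  show "act_poly g (sum f A) = (\<Sum>x\<in>A. act_poly g (f x :: 'a mpol))" by (rule a.hom_sum)
  show "act_poly g (prod f A) = (\<Prod>x\<in>A. act_poly g (f x :: 'a mpol))" by (rule a.hom_prod)
qed

section \<open>Antisymmetric polynomials and the interpolation kernel\<close>

locale perm_group =
  fixes n :: nat and H :: "(nat \<Rightarrow> nat) set"
  assumes perm: "g \<in> H \<Longrightarrow> g permutes {1..n}"
    and id_in: "id \<in> H"
    and comp_in: "g \<in> H \<Longrightarrow> h \<in> H \<Longrightarrow> g \<circ> h \<in> H"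
    and inv_in: "g \<in> H \<Longrightarrow> Hilbert_Choice.inv g \<in> H"
begin

lemma bij_H: "g \<in> H \<Longrightarrow> bij g"
  using perm permutes_bij by blast

lemma finite_H: "finite H"
  by (rule finite_subset[OF _ finite_permutations[of "{1..n}"]]) (use perm in auto)

lemma inv_comp: "g \<in> H \<Longrightarrow> Hilbert_Choice.inv g \<circ> g = id" "g \<in> H \<Longrightarrow> g \<circ> Hilbert_Choice.inv g = id"
  by (rule inv_o_cancel[OF bij_is_inj[OF bij_H]], assumption)
     (rule surj_iff[THEN iffD1, OF bij_is_surj[OF bij_H]], assumption)

lemma bij_betw_comp:
  assumes "g \<in> H"
  shows "bij_betw (\<lambda>h. g \<circ> h) H H" "bij_betw (\<lambda>h. h \<circ> g) H H"
proof -
  note i = inv_comp[OF assms]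
  have l: "g \<circ> (Hilbert_Choice.inv g \<circ> h) = h" "Hilbert_Choice.inv g \<circ> (g \<circ> h) = h" for h
    unfolding o_assoc i id_comp by (rule refl)+
  have r: "(h \<circ> Hilbert_Choice.inv g) \<circ> g = h" "(h \<circ> g) \<circ> Hilbert_Choice.inv g = h" for h
    unfolding comp_assoc i comp_id by (rule refl)+
  show "bij_betw (\<lambda>h. g \<circ> h) H H"
    by (rule bij_betw_byWitness[where f' = "\<lambda>h. Hilbert_Choice.inv g \<circ> h"])
       (use assms in \<open>simp_all add: l image_subset_iff comp_in inv_in\<close>)
  show "bij_betw (\<lambda>h. h \<circ> g) H H"
    by (rule bij_betw_byWitness[where f' = "\<lambda>h. h \<circ> Hilbert_Choice.inv g"])
       (use assms in \<open>simp_all add: r image_subset_iff comp_in inv_in\<close>)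
qed

lemma sum_comp: "g \<in> H \<Longrightarrow> (\<Sum>h\<in>H. f (g \<circ> h)) = (\<Sum>h\<in>H. f h)"
  and sum_comp_right: "g \<in> H \<Longrightarrow> (\<Sum>h\<in>H. f (h \<circ> g)) = (\<Sum>h\<in>H. f h)"
  by (rule sum.reindex_bij_betw, erule bij_betw_comp)+

lemma act_comp: "g \<in> H \<Longrightarrow> h \<in> H \<Longrightarrow> act_poly g (act_poly h p) = act_poly (g \<circ> h) p"
  by (simp add: act_poly_comp bij_H)

lemmas act_distribs = act_poly_distribs[OF bij_H]

end

text \<open>A Young subgroup acts on each of its orbits as the full symmetric group; the transpositions of
  two points of an orbit are all that the arguments need.\<close>

locale young = perm_group n Sig for n and Sig :: "(nat \<Rightarrow> nat) set" +
  assumes transp_in: "g \<in> Sig \<Longrightarrow> transpose (g j) j \<in> Sig"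
begin

definition P :: "(nat \<times> nat) set" where
  "P = {(i, j). i \<in> {1..n} \<and> j \<in> {1..n} \<and> i < j \<and> transpose i j \<in> Sig}"

definition Delta :: "rat mpol" where
  "Delta = (\<Prod>(i, j) \<in> P. var i - var j)"

definition sgn_Sig :: "(nat \<Rightarrow> nat) \<Rightarrow> rat" where
  "sgn_Sig g = (if act_poly g Delta = Delta then 1 else - 1)"

definition Alt :: "rat mpol \<Rightarrow> rat mpol" where
  "Alt f = (\<Sum>g \<in> Sig. Const (sgn_Sig g) * act_poly g f)"

text \<open>The divided difference for the longest element. It maps into the \<open>\<Sigma>\<close>-invariants and lowers
  degrees by the number of reflections.\<close>

definition ddiff :: "rat mpol \<Rightarrow> rat mpol" where
  "ddiff f = (SOME q. Alt f = Delta * q)"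

text \<open>Expanding the product of \<open>x\<^sub>i - y\<^sub>j\<close> over \<open>(i, j) \<in> P\<close> yields the sum of \<open>aS S\<close> in the \<open>x\<close>
  times \<open>bS S\<close> in the \<open>y\<close> over all \<open>S \<subseteq> P\<close>.\<close>

definition aS :: "(nat \<times> nat) set \<Rightarrow> 'a::comm_ring_1 mpol" where
  "aS S = (\<Prod>(i, j) \<in> P - S. var i)"

definition bS :: "(nat \<times> nat) set \<Rightarrow> 'a::comm_ring_1 mpol" where
  "bS S = (\<Prod>(i, j) \<in> S. - var j)"

lemma P_less: "(i, j) \<in> P \<Longrightarrow> i < j"
  by (auto simp: P_def)

lemma finite_P: "finite P"
  by (rule finite_subset[of _ "{1..n} \<times> {1..n}"]) (auto simp: P_def)

lemma finite_sub_P: "S \<subseteq> P \<Longrightarrow> finite S"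
  using finite_P finite_subset by blast

lemma Delta_neq_0: "Delta \<noteq> 0"
  using prod_diff_neq_0[OF finite_P P_less, of "\<lambda>_ _. 1"] by (simp only: Delta_def power_one_right) simp

lemma homogeneous_Delta: "homogeneous (card P) Delta"
proof -
  have "homogeneous (\<Sum>p\<in>P. 1) Delta"
    unfolding Delta_def by (intro homogeneous_prod) (auto intro!: homogeneous_minus simp: homogeneous_var[simplified])
  then show ?thesis by simp
qed

lemma Delta_polys: "Delta \<in> polys n"
  unfolding Delta_def by (intro polys_prod) (auto simp: P_def intro!: polys_closed)

lemma act_Delta_cases:
  assumes g: "g \<in> Sig"
  shows "act_poly g Delta = Delta \<or> act_poly g Delta = - Delta"
proof -
  note b = bij_H[OF g]
  define Q where "Q = {(i, j). i \<in> {1..n} \<and> j \<in> {1..n} \<and> i \<noteq> j \<and> transpose i j \<in> Sig}"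
  have finQ: "finite Q" by (rule finite_subset[of _ "{1..n} \<times> {1..n}"]) (auto simp: Q_def)
  have Q: "Q = P \<union> prod.swap ` P" "P \<inter> prod.swap ` P = {}"
    by (auto simp: Q_def P_def transpose_commute image_iff)
  have "(\<Prod>(i, j) \<in> Q. var i - var j) = Delta * (\<Prod>(i, j) \<in> prod.swap ` P. var i - var j :: rat mpol)"
    unfolding Q(1) Delta_def using finite_P Q(2) by (intro prod.union_disjoint) auto
  also have "(\<Prod>(i, j) \<in> prod.swap ` P. var i - var j :: rat mpol) = (\<Prod>(i, j) \<in> P. var j - var i)"
    by (subst prod.reindex) (auto simp: case_prod_beta)
  also have "\<dots> = (\<Prod>(i, j) \<in> P. (-1) * (var i - var j))"
    by (intro prod.cong) auto
  also have "\<dots> = (-1) ^ card P * Delta"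
    unfolding Delta_def case_prod_beta prod.distrib by simp
  finally have *: "(\<Prod>(i, j) \<in> Q. var i - var j) = (-1) ^ card P * (Delta * Delta)"
    by (simp add: ac_simps)
  have m: "(g i, g j) \<in> Q" if "(i, j) \<in> Q" for i j
  proof -
    have "transpose (g i) (g j) = g \<circ> transpose i j \<circ> Hilbert_Choice.inv g"
    proof -
      have "transpose (g i) (g j) \<circ> g = g \<circ> transpose i j"
        using bij_is_inj[OF b] by (auto simp: fun_eq_iff transpose_def inj_eq)
      then have "transpose (g i) (g j) \<circ> (g \<circ> Hilbert_Choice.inv g) = g \<circ> transpose i j \<circ> Hilbert_Choice.inv g"
        unfolding o_assoc by (rule arg_cong)
      then show ?thesis unfolding inv_comp[OF g] comp_id .
    qed
    then have "transpose (g i) (g j) \<in> Sig" using that g by (auto simp: Q_def intro!: comp_in inv_in)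
    moreover have "g i \<in> {1..n}" "g j \<in> {1..n}"
      using that permutes_in_image[OF perm[OF g]] unfolding Q_def by blast+
    moreover have "g i \<noteq> g j" using that b by (auto simp: Q_def inj_eq[OF bij_is_inj[OF b]])
    ultimately show ?thesis by (simp add: Q_def)
  qed
  have "inj_on (\<lambda>(i, j). (g i, g j)) Q"
    using b by (auto simp: inj_on_def inj_eq[OF bij_is_inj[OF b]])
  moreover have "(\<lambda>(i, j). (g i, g j)) ` Q \<subseteq> Q" using m by auto
  ultimately have "bij_betw (\<lambda>(i, j). (g i, g j)) Q Q"
    using endo_inj_surj[OF finQ] by (simp add: bij_betw_def)
  from prod.reindex_bij_betw[OF this, of "\<lambda>(i, j). var i - var j :: rat mpol"]
  have "(\<Prod>(i, j) \<in> Q. var (g i) - var (g j)) = (\<Prod>(i, j) \<in> Q. var i - var j :: rat mpol)"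
    by (simp add: case_prod_beta)
  moreover have "act_poly g (\<Prod>(i, j) \<in> Q. var i - var j :: rat mpol) = (\<Prod>(i, j) \<in> Q. var (g i) - var (g j))"
    by (simp add: act_poly_distribs[OF b] case_prod_beta act_poly_var[OF b])
  ultimately have "act_poly g ((-1) ^ card P * (Delta * Delta)) = (-1) ^ card P * (Delta * Delta)"
    using * by simp
  moreover have "act_poly g ((-1) ^ card P * (Delta * Delta)) = (-1) ^ card P * (act_poly g Delta * act_poly g Delta)"
  proof -
    have "(-1 :: rat mpol) ^ card P = Const ((-1) ^ card P)"
      by (simp add: Const.hom_power Const.hom_uminus)
    then show ?thesis by (simp add: act_poly_distribs[OF b] b)
  qed
  ultimately have "(act_poly g Delta)^2 = Delta^2"
    by (simp add: power2_eq_square)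
  then show ?thesis by (simp add: power2_eq_iff)
qed

lemma act_Delta: "g \<in> Sig \<Longrightarrow> act_poly g Delta = Const (sgn_Sig g) * Delta"
  using act_Delta_cases[of g] by (auto simp: sgn_Sig_def Const.hom_uminus)

lemma sgn_Sig_square: "sgn_Sig g * sgn_Sig g = 1"
  by (simp add: sgn_Sig_def)

lemma sgn_Sig_id: "sgn_Sig id = 1"
  by (simp add: sgn_Sig_def)

lemma sgn_Sig_mult:
  assumes "g \<in> Sig" "h \<in> Sig"
  shows "sgn_Sig (g \<circ> h) = sgn_Sig g * sgn_Sig h"
proof -
  have "Const (sgn_Sig (g \<circ> h)) * Delta = act_poly (g \<circ> h) Delta"
    using assms by (simp only: act_Delta comp_in)
  also have "\<dots> = act_poly g (act_poly h Delta)"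
    using assms by (simp only: act_comp)
  also have "\<dots> = Const (sgn_Sig g * sgn_Sig h) * Delta"
    using assms by (simp add: act_Delta act_distribs Const.hom_mult bij_H)
  finally show ?thesis using Delta_neq_0 by simp
qed

lemma sgn_Sig_transpose:
  assumes "(i, j) \<in> P"
  shows "sgn_Sig (transpose i j) = - 1"
proof (rule ccontr)
  assume "sgn_Sig (transpose i j) \<noteq> - 1"
  then have inv: "act_poly (transpose i j) Delta = Delta" by (auto simp: sgn_Sig_def split: if_splits)
  have b: "bij (transpose i j)" by simp
  have ij: "i < j" using P_less[OF assms] .
  define D where "D = (\<Prod>(k, l) \<in> P - {(i, j)}. var k - var l :: rat mpol)"
  have Delta: "Delta = (var i - var j) * D"
    unfolding Delta_def D_def using prod.remove[OF finite_P assms, of "\<lambda>(i, j). var i - var j"] by simp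
  have "act_poly (transpose i j) Delta = (var j - var i) * act_poly (transpose i j) D"
    unfolding Delta act_poly_distribs[OF b] act_poly_var[OF b] by simp
  then have "(var i - var j) * D = (var j - var i) * act_poly (transpose i j) D"
    using inv Delta by metis
  also have "\<dots> = (var i - var j) * (- act_poly (transpose i j) D)"
    by (simp add: algebra_simps)
  finally have "var i - var j = (0 :: rat mpol) \<or> D = - act_poly (transpose i j) D"
    unfolding mult_cancel_left .
  then have D: "D = - act_poly (transpose i j) D" using ij by auto
  have "ident i j D = ident i j (- act_poly (transpose i j) D)" by (rule arg_cong[OF D])
  then have "ident i j D = - ident i j D" unfolding ident.hom_uminus ident_act_transpose .
  then have "2 * ident i j D = 0" by simp
  then have 0: "ident i j D = 0" by simp
  have "ident i j D \<noteq> 0"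
  proof -
    have "ident i j (case p of (k, l) \<Rightarrow> var k - var l) \<noteq> (0 :: rat mpol)" if "p \<in> P - {(i, j)}" for p
    proof -
      obtain k l where p: "p = (k, l)" by (cases p)
      have "k < l" "(k, l) \<noteq> (i, j)" using that p P_less by auto
      then show ?thesis using ij by (auto simp: p ident.hom_minus ident_var)
    qed
    then show ?thesis unfolding D_def ident.hom_prod using finite_P by (simp add: prod_zero_iff)
  qed
  with 0 show False by simp
qed

lemma act_Alt:
  assumes "g \<in> Sig"
  shows "act_poly g (Alt f) = Const (sgn_Sig g) * Alt f"
proof -
  have "act_poly g (Alt f) = (\<Sum>h \<in> Sig. Const (sgn_Sig h) * act_poly (g \<circ> h) f)"
    unfolding Alt_def using assms by (simp add: act_distribs bij_H act_comp)
  also have "\<dots> = (\<Sum>h \<in> Sig. Const (sgn_Sig g) * (Const (sgn_Sig (g \<circ> h)) * act_poly (g \<circ> h) f))"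
  proof (intro sum.cong refl)
    fix h assume "h \<in> Sig"
    then have "sgn_Sig g * sgn_Sig (g \<circ> h) = sgn_Sig h"
      using sgn_Sig_mult[OF assms] sgn_Sig_square[of g] by (metis mult.assoc mult_1)
    then have "Const (sgn_Sig g) * Const (sgn_Sig (g \<circ> h)) = Const (sgn_Sig h)" by (metis Const.hom_mult)
    then show "Const (sgn_Sig h) * act_poly (g \<circ> h) f = Const (sgn_Sig g) * (Const (sgn_Sig (g \<circ> h)) * act_poly (g \<circ> h) f)"
      by (simp only: mult.assoc[symmetric])
  qed
  also have "\<dots> = (\<Sum>h \<in> Sig. Const (sgn_Sig g) * (Const (sgn_Sig h) * act_poly h f))"
    by (rule sum_comp[OF assms])
  finally show ?thesis by (simp add: Alt_def sum_distrib_left)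
qed

lemma Delta_dvd_Alt: "Delta dvd Alt f"
proof -
  have "(var i - var j) ^ 1 dvd Alt f" if "(i, j) \<in> P" for i j
  proof -
    have t: "transpose i j \<in> Sig" using that by (simp add: P_def)
    have "ident i j (act_poly (transpose i j) (Alt f)) = ident i j (Const (- 1) * Alt f)"
      by (simp only: act_Alt[OF t] sgn_Sig_transpose[OF that])
    then have "ident i j (Alt f) = - ident i j (Alt f)"
      by (simp add: ident_act_transpose ident.hom_mult ident_Const Const.hom_uminus ident.hom_uminus)
    then have "2 * ident i j (Alt f) = 0" by simp
    then have "ident i j (Alt f) = 0" by simp
    then show ?thesis by (simp add: dvd_iff_ident)
  qed
  then have "(\<Prod>(i, j) \<in> P. (var i - var j) ^ 1) dvd Alt f"
    by (intro prod_diff_dvd finite_P P_less)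
  then show ?thesis by (simp only: Delta_def power_one_right)
qed

lemma Alt_ddiff: "Alt f = Delta * ddiff f"
  unfolding ddiff_def using Delta_dvd_Alt[of f] by (metis (mono_tags, lifting) dvdE someI_ex)

lemma act_ddiff:
  assumes "g \<in> Sig"
  shows "act_poly g (ddiff f) = ddiff f"
proof -
  have "act_poly g (Delta * ddiff f) = Const (sgn_Sig g) * Delta * act_poly g (ddiff f)"
    unfolding act_distribs(3)[OF assms] act_Delta[OF assms] ..
  moreover have "act_poly g (Delta * ddiff f) = Const (sgn_Sig g) * Delta * ddiff f"
    using act_Alt[OF assms, of f] unfolding Alt_ddiff mult.assoc .
  moreover have "Const (sgn_Sig g) * Delta \<noteq> 0"
    using Delta_neq_0 by (simp add: sgn_Sig_def Const.hom_uminus)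
  ultimately show ?thesis by (metis mult_left_cancel)
qed

lemma Alt_polys: "f \<in> polys n \<Longrightarrow> Alt f \<in> polys n"
  unfolding Alt_def by (intro polys_sum polys_closed(3,7) polys_act perm)

lemma ddiff_polys:
  assumes "f \<in> polys n"
  shows "ddiff f \<in> polys n"
proof -
  have "trunc_vars n (Alt f) = Alt f" using Alt_polys[OF assms] by (simp add: polys_iff)
  then have "trunc_vars n Delta * trunc_vars n (ddiff f) = Delta * ddiff f"
    unfolding Alt_ddiff tv.hom_mult .
  then show ?thesis using Delta_polys Delta_neq_0 by (simp add: polys_iff)
qed

lemma homogeneous_Alt: "homogeneous d f \<Longrightarrow> homogeneous d (Alt f)"
  unfolding Alt_def by (intro homogeneous_sum homogeneous_Const_mult homogeneous_act) (auto intro: bij_H)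

lemma homogeneous_ddiff:
  assumes "homogeneous d f"
  shows "homogeneous (d - card P) (ddiff f)" and "d < card P \<Longrightarrow> ddiff f = 0"
  using homogeneous_quotient[OF homogeneous_Delta Delta_neq_0, of d "ddiff f"] homogeneous_Alt[OF assms]
  by (simp_all add: Alt_ddiff)

lemma ddiff_inv_ring: "f \<in> polys n \<Longrightarrow> ddiff f \<in> inv_ring n Sig"
  by (simp add: inv_ring_def ddiff_polys act_ddiff)

text \<open>Provides the vanishing factor of the kernel at a permutation other than the identity.\<close>

lemma descent:
  assumes g: "g \<in> Sig" "g \<noteq> id"
  obtains j where "(g j, j) \<in> P"
proof -
  let ?N = "{j. g j \<noteq> j}"
  have sub: "?N \<subseteq> {1..n}" using perm[OF g(1)] by (auto simp: permutes_def)
  have fin: "finite ?N" using sub finite_subset by blast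
  have ne: "?N \<noteq> {}" using g(2) by (auto simp: fun_eq_iff)
  define j where "j = Max ?N"
  have j: "j \<in> ?N" unfolding j_def by (rule Max_in[OF fin ne])
  then have gj: "g j \<in> ?N" by (auto simp: inj_eq[OF bij_is_inj[OF bij_H[OF g(1)]]])
  then have "g j \<le> j" unfolding j_def by (rule Max_ge[OF fin])
  with j have "g j < j" by auto
  moreover have "g j \<in> {1..n}" "j \<in> {1..n}" using sub j gj by blast+
  ultimately show ?thesis
    using that[of j] transp_in[OF g(1), of j] by (auto simp: P_def)
qed

text \<open>For \<open>y = g x\<close> the product of the \<open>x\<^sub>i - y\<^sub>j\<close> has the factor zero unless \<open>g\<close> is the identity.\<close>

lemma kernel:
  assumes g: "g \<in> Sig"
  shows "(\<Sum>S \<in> Pow P. aS S * act_poly g (bS S)) = (if g = id then Delta else 0)"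
proof -
  note b = bij_H[OF g]
  have "(\<Sum>S \<in> Pow P. aS S * act_poly g (bS S)) = 
      (\<Sum>S \<in> Pow P. (\<Prod>(i, j) \<in> S. - var (g j)) * (\<Prod>(i, j) \<in> P - S. var i :: rat mpol))"
    by (simp add: aS_def bS_def act_poly_distribs[OF b] case_prod_beta act_poly_var[OF b] mult.commute)
  also have "\<dots> = (\<Prod>p \<in> P. (case p of (i, j) \<Rightarrow> - var (g j)) + (case p of (i, j) \<Rightarrow> var i))"
    by (rule prod_add[OF finite_P, symmetric])
  also have "\<dots> = (\<Prod>(i, j) \<in> P. var i - var (g j))"
    by (intro prod.cong) auto
  also have "\<dots> = (if g = id then Delta else 0)"
  proof (cases "g = id")
    case False
    obtain j where "(g j, j) \<in> P" using descent[OF g False] .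
    then show ?thesis using False finite_P by (auto intro!: prod_zero bexI[of _ "(g j, j)"])
  qed (simp add: Delta_def)
  finally show ?thesis .
qed

text \<open>Antisymmetrize the kernel identity after multiplication by \<open>f\<close>: only the term of the identity
  survives, and \<open>Delta\<close> cancels.\<close>

lemma interpolation: "f = (\<Sum>S \<in> Pow P. ddiff (f * aS S) * bS S)"
proof -
  have "Delta * (\<Sum>S \<in> Pow P. ddiff (f * aS S) * bS S) = (\<Sum>S \<in> Pow P. Alt (f * aS S) * bS S)"
    by (simp add: Alt_ddiff sum_distrib_left mult.assoc)
  also have "\<dots> = (\<Sum>S \<in> Pow P. \<Sum>g \<in> Sig. Const (sgn_Sig g) * act_poly g f * (act_poly g (aS S) * bS S))"
    by (simp add: Alt_def sum_distrib_right act_distribs mult.assoc)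
  also have "\<dots> = (\<Sum>g \<in> Sig. Const (sgn_Sig g) * act_poly g f * (\<Sum>S \<in> Pow P. act_poly g (aS S) * bS S))"
    by (subst sum.swap) (simp add: sum_distrib_left)
  also have "\<dots> = (\<Sum>g \<in> Sig. if g = id then Delta * f else 0)"
  proof (intro sum.cong refl)
    fix g assume g: "g \<in> Sig"
    let ?h = "Hilbert_Choice.inv g"
    have h: "?h \<in> Sig" using g by (rule inv_in)
    have "(\<Sum>S \<in> Pow P. act_poly g (aS S) * bS S) = act_poly g (\<Sum>S \<in> Pow P. aS S * act_poly ?h (bS S))"
      using g h by (simp add: act_distribs act_comp inv_comp)
    also have "\<dots> = (if g = id then Delta else 0)"
    proof -
      have "?h = id \<longleftrightarrow> g = id" using inv_comp[OF g] by auto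
      then show ?thesis using g by (simp add: kernel[OF h] act_distribs)
    qed
    finally show "Const (sgn_Sig g) * act_poly g f * (\<Sum>S \<in> Pow P. act_poly g (aS S) * bS S) =
        (if g = id then Delta * f else 0)"
      by (simp add: sgn_Sig_id Const_simps mult.commute)
  qed
  also have "\<dots> = Delta * f" using finite_H id_in by simp
  finally show ?thesis using Delta_neq_0 by simp
qed

lemma aS_polys: "S \<subseteq> P \<Longrightarrow> aS S \<in> polys n"
  unfolding aS_def by (intro polys_prod) (auto simp: P_def intro!: polys_closed)

lemma bS_polys: "S \<subseteq> P \<Longrightarrow> bS S \<in> polys n"
  unfolding bS_def by (intro polys_prod) (auto simp: P_def intro!: polys_closed)

lemma homogeneous_aS:
  assumes "S \<subseteq> P"
  shows "homogeneous (card P - card S) (aS S)"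
proof -
  have "homogeneous (\<Sum>p\<in>P - S. 1) (aS S)"
    unfolding aS_def by (intro homogeneous_prod) (auto simp: homogeneous_var[simplified])
  then show ?thesis using assms finite_P by (simp add: card_Diff_subset finite_sub_P)
qed

lemma homogeneous_bS:
  assumes "S \<subseteq> P"
  shows "homogeneous (card S) (bS S)"
proof -
  have "homogeneous (\<Sum>p\<in>S. 1) (bS S)"
    unfolding bS_def using homogeneous_minus[OF homogeneous_0 homogeneous_var]
    by (intro homogeneous_prod) auto
  then show ?thesis by simp
qed

end

section \<open>Invariant rings\<close>

lemma Const_eq_0_iff [simp]: "Const a = 0 \<longleftrightarrow> a = 0"
  by (metis Const.hom_zero Const_eq_iff)

definition dg :: "'a::comm_ring_1 mpol \<Rightarrow> nat" where
  "dg p = Polynomial.degree (Psi p)"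

lemma dg_homogeneous: "homogeneous d p \<Longrightarrow> p \<noteq> 0 \<Longrightarrow> dg p = d"
  by (simp add: dg_def Psi_homogeneous degree_monom_eq)

lemma homogeneous_dg: "homogeneous d p \<Longrightarrow> homogeneous (dg p) p"
  by (cases "p = 0") (simp_all add: dg_homogeneous)

context perm_group
begin

lemma inv_ring_act: "p \<in> inv_ring n H \<Longrightarrow> g \<in> H \<Longrightarrow> act_poly g p = p"
  by (simp add: inv_ring_def)

lemma inv_ring_polys: "p \<in> inv_ring n H \<Longrightarrow> p \<in> polys n"
  by (simp add: inv_ring_def)

lemma inv_ring_Const: "Const c \<in> inv_ring n H"
  by (simp add: inv_ring_def polys_closed bij_H)

lemma inv_ring_0: "0 \<in> inv_ring n H"
  using inv_ring_Const[of 0] by simp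

lemma inv_ring_1: "1 \<in> inv_ring n H"
  using inv_ring_Const[of 1] by simp

lemma inv_ring_add: "p \<in> inv_ring n H \<Longrightarrow> q \<in> inv_ring n H \<Longrightarrow> p + q \<in> inv_ring n H"
  and inv_ring_minus: "p \<in> inv_ring n H \<Longrightarrow> q \<in> inv_ring n H \<Longrightarrow> p - q \<in> inv_ring n H"
  and inv_ring_mult: "p \<in> inv_ring n H \<Longrightarrow> q \<in> inv_ring n H \<Longrightarrow> p * q \<in> inv_ring n H"
  by (simp_all add: inv_ring_def polys_closed act_distribs)

lemma inv_ring_sum: "(\<And>a. a \<in> A \<Longrightarrow> f a \<in> inv_ring n H) \<Longrightarrow> sum f A \<in> inv_ring n H"
  by (induction A rule: infinite_finite_induct) (simp_all add: inv_ring_0 inv_ring_add)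

lemma inv_ring_power: "p \<in> inv_ring n H \<Longrightarrow> p ^ k \<in> inv_ring n H"
  by (induction k) (simp_all add: inv_ring_1 inv_ring_mult)

lemma inv_ring_hc: "p \<in> inv_ring n H \<Longrightarrow> hc d p \<in> inv_ring n H"
  by (simp add: inv_ring_def hc_polys hc_act[symmetric] bij_H)

lemma inv_ring_of_int_poly: "p \<in> inv_ring n H \<Longrightarrow> of_int_poly p \<in> inv_ring n H"
  by (simp add: inv_ring_def polys_of_int_poly act_poly_of_int_poly bij_H)

definition orbit_sum :: "'a::comm_ring_1 mpol \<Rightarrow> 'a mpol" where
  "orbit_sum p = (\<Sum>h\<in>H. act_poly h p)"

lemma orbit_sum_inv:
  assumes "p \<in> polys n"
  shows "orbit_sum p \<in> inv_ring n H"
proof -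
  have "act_poly g (orbit_sum p) = orbit_sum p" if "g \<in> H" for g
    unfolding orbit_sum_def act_distribs(7)[OF that]
    using sum_comp[OF that, of "\<lambda>h. act_poly h p"] by (simp add: act_comp that)
  moreover have "orbit_sum p \<in> polys n"
    unfolding orbit_sum_def by (intro polys_sum polys_act perm assms)
  ultimately show ?thesis by (simp add: inv_ring_def)
qed

lemma homogeneous_orbit_sum: "homogeneous d p \<Longrightarrow> homogeneous d (orbit_sum p)"
  unfolding orbit_sum_def by (intro homogeneous_sum homogeneous_act bij_H)

lemma of_int_poly_orbit_sum: "of_int_poly (orbit_sum p) = orbit_sum (of_int_poly p)"
  by (simp add: orbit_sum_def oi.hom_sum act_poly_of_int_poly bij_H)

lemma card_H_pos: "card H > 0"
  using finite_H id_in by (auto simp: card_gt_0_iff)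

lemma orbit_sum_inv_mult:
  assumes "c \<in> inv_ring n H"
  shows "orbit_sum (c * p) = c * orbit_sum p"
  unfolding orbit_sum_def sum_distrib_left using assms
  by (intro sum.cong refl) (simp add: act_distribs inv_ring_act)

lemma orbit_sum_of_inv: "c \<in> inv_ring n H \<Longrightarrow> orbit_sum c = of_nat (card H) * c"
  by (simp add: orbit_sum_def inv_ring_act)

end

section \<open>The filtration by degree\<close>

locale setting = young n Sig + G: perm_group n G for n Sig and G :: "(nat \<Rightarrow> nat) set" +
  fixes \<gamma>s :: "(nat \<Rightarrow> nat) list" and z :: "nat \<Rightarrow> int" and \<omega> :: "int mpol"
  assumes G_sub: "G \<subseteq> Sig"
    and reps: "set \<gamma>s \<subseteq> Sig"
    and cosets: "g \<in> Sig \<Longrightarrow> \<exists>i < length \<gamma>s. \<exists>h \<in> G. g = \<gamma>s ! i \<circ> h"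
    and cosets_unique: "i < length \<gamma>s \<Longrightarrow> i' < length \<gamma>s \<Longrightarrow> h \<in> G \<Longrightarrow> \<gamma>s ! i' \<circ> h = \<gamma>s ! i \<Longrightarrow> i' = i"
    and stab: "g \<in> Sig \<Longrightarrow> z \<circ> g = z \<Longrightarrow> g = id"
    and omega: "\<omega> \<in> inv_ring n Sig" "homogeneous 1 \<omega>" "eval_poly \<omega> z \<noteq> 0"
begin

abbreviation l :: nat where "l \<equiv> length \<gamma>s"

abbreviation zr :: "nat \<Rightarrow> rat" where "zr \<equiv> (\<lambda>k. of_int (z k))"

definition rv :: "rat mpol \<Rightarrow> nat \<Rightarrow> rat" where
  "rv f i = eval_poly (act_poly (\<gamma>s ! i) f) zr"

definition GS :: "(nat \<times> nat) set \<Rightarrow> 'a::comm_ring_1 mpol" where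
  "GS S = G.orbit_sum (bS S)"

lemma rep_in: "i < l \<Longrightarrow> \<gamma>s ! i \<in> Sig"
  using reps by auto

lemma rep_bij: "i < l \<Longrightarrow> bij (\<gamma>s ! i)"
  using rep_in bij_H by blast

lemma G_in: "h \<in> G \<Longrightarrow> h \<in> Sig"
  using G_sub by blast

lemma inv_Sig_G: "p \<in> inv_ring n Sig \<Longrightarrow> p \<in> inv_ring n G"
  using G_sub by (auto simp: inv_ring_def)

lemma rv_add: "i < l \<Longrightarrow> rv (f + h) i = rv f i + rv h i"
  and rv_minus: "i < l \<Longrightarrow> rv (f - h) i = rv f i - rv h i"
  and rv_mult: "i < l \<Longrightarrow> rv (f * h) i = rv f i * rv h i"
  and rv_sum: "i < l \<Longrightarrow> rv (sum F A) i = (\<Sum>a\<in>A. rv (F a) i)"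
  by (simp_all add: rv_def act_poly_distribs[OF rep_bij] ev.hom_add ev.hom_minus ev.hom_mult ev.hom_sum)

lemma rv_inv_Sig: "i < l \<Longrightarrow> c \<in> inv_ring n Sig \<Longrightarrow> rv c i = eval_poly c zr"
  by (simp add: rv_def inv_ring_act rep_in)

lemma rv_Const: "i < l \<Longrightarrow> rv (Const c) i = c"
  by (simp add: rv_def rep_bij)

lemma eval_Delta: "eval_poly Delta zr \<noteq> 0"
proof -
  have "zr i \<noteq> zr j" if "(i, j) \<in> P" for i j
  proof
    assume "zr i = zr j"
    then have "z \<circ> transpose i j = z" by (auto simp: fun_eq_iff transpose_def)
    moreover have "transpose i j \<in> Sig" using that by (simp add: P_def)
    ultimately have "transpose i j = id" using stab by blast
    then have "transpose i j i = i" by simp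
    then show False using P_less[OF that] by simp
  qed
  then show ?thesis
    unfolding Delta_def ev.hom_prod using finite_P by (auto simp: prod_zero_iff ev.hom_minus)
qed

lemma kernel2:
  assumes g: "g \<in> Sig" "g' \<in> Sig"
  shows "(\<Sum>S \<in> Pow P. act_poly g (aS S) * act_poly g' (bS S)) = (if g = g' then Const (sgn_Sig g) * Delta else 0)"
proof -
  let ?k = "Hilbert_Choice.inv g \<circ> g'"
  have i: "Hilbert_Choice.inv g \<in> Sig" using g(1) by (rule inv_in)
  have k: "?k \<in> Sig" using i g(2) by (rule comp_in)
  have gk: "g \<circ> ?k = g'" unfolding o_assoc inv_comp[OF g(1)] id_comp ..
  have "(\<Sum>S \<in> Pow P. act_poly g (aS S) * act_poly g' (bS S)) =
      act_poly g (\<Sum>S \<in> Pow P. aS S * act_poly ?k (bS S))"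
    unfolding act_distribs(7)[OF g(1)] act_distribs(3)[OF g(1)] act_comp[OF g(1) k] gk ..
  also have "\<dots> = (if g = g' then Const (sgn_Sig g) * Delta else 0)"
  proof -
    have "?k = id \<longleftrightarrow> g = g'" using gk inv_comp(1)[OF g(1)] by auto
    then show ?thesis unfolding kernel[OF k] using act_Delta[OF g(1)] act_distribs(5)[OF g(1)] by auto
  qed
  finally show ?thesis .
qed

lemma rep_comp_eq_iff:
  assumes "i < l" "i' < l" "h \<in> G"
  shows "\<gamma>s ! i = \<gamma>s ! i' \<circ> h \<longleftrightarrow> i = i' \<and> h = id"
proof
  assume *: "\<gamma>s ! i = \<gamma>s ! i' \<circ> h"
  then have ii: "i' = i" using cosets_unique[OF assms] by simp
  have "Hilbert_Choice.inv (\<gamma>s ! i) \<circ> (\<gamma>s ! i \<circ> h) = Hilbert_Choice.inv (\<gamma>s ! i) \<circ> \<gamma>s ! i"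
    using * ii by simp
  then have "h = id" unfolding o_assoc inv_comp[OF rep_in[OF assms(1)]] id_comp .
  with ii show "i = i' \<and> h = id" by simp
qed auto

text \<open>The kernel averaged over the subgroup separates the cosets.\<close>

lemma kernel_G:
  assumes i: "i < l" "i' < l"
  shows "(\<Sum>S \<in> Pow P. act_poly (\<gamma>s ! i) (aS S) * act_poly (\<gamma>s ! i') (GS S)) =
    (if i = i' then Const (sgn_Sig (\<gamma>s ! i)) * Delta else 0)"
proof -
  note g = rep_in[OF i(1)] rep_in[OF i(2)]
  have "act_poly (\<gamma>s ! i') (GS S) = (\<Sum>h\<in>G. act_poly (\<gamma>s ! i' \<circ> h) (bS S) :: rat mpol)" for S
    unfolding GS_def G.orbit_sum_def act_distribs(7)[OF g(2)]
    by (intro sum.cong refl act_comp g(2) G_in)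
  then have "(\<Sum>S \<in> Pow P. act_poly (\<gamma>s ! i) (aS S) * act_poly (\<gamma>s ! i') (GS S)) =
      (\<Sum>S \<in> Pow P. \<Sum>h\<in>G. act_poly (\<gamma>s ! i) (aS S) * act_poly (\<gamma>s ! i' \<circ> h) (bS S) :: rat mpol)"
    by (simp add: sum_distrib_left)
  also have "\<dots> = (\<Sum>h\<in>G. \<Sum>S \<in> Pow P. act_poly (\<gamma>s ! i) (aS S) * act_poly (\<gamma>s ! i' \<circ> h) (bS S))"
    by (rule sum.swap)
  also have "\<dots> = (\<Sum>h\<in>G. if h = id then if i = i' then Const (sgn_Sig (\<gamma>s ! i)) * Delta else 0 else 0)"
    by (intro sum.cong refl) (auto simp: kernel2[OF g(1) comp_in[OF g(2) G_in]] rep_comp_eq_iff[OF i])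
  also have "\<dots> = (if i = i' then Const (sgn_Sig (\<gamma>s ! i)) * Delta else 0)"
    using G.finite_H G.id_in by simp
  finally show ?thesis .
qed

lemma GS_inv: "S \<subseteq> P \<Longrightarrow> GS S \<in> inv_ring n G"
  unfolding GS_def by (intro G.orbit_sum_inv bS_polys)

lemma homogeneous_GS: "S \<subseteq> P \<Longrightarrow> homogeneous (card S) (GS S)"
  unfolding GS_def by (intro G.homogeneous_orbit_sum homogeneous_bS)

lemma of_int_poly_GS: "of_int_poly (GS S) = (GS S :: 'a::comm_ring_1 mpol)"
proof -
  have "of_int_poly (bS S :: int mpol) = (bS S :: 'a mpol)"
    by (simp add: bS_def oi.hom_prod oi.hom_uminus case_prod_beta)
  then show ?thesis by (simp add: GS_def G.of_int_poly_orbit_sum)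
qed

text \<open>The averaged kernel with one argument fixed at a point of the orbit, divided by the value of
  \<open>Delta\<close> there, which is not zero because the stabilizer is trivial.\<close>

lemma separate:
  assumes "i0 < l"
  obtains f where "f \<in> inv_ring n G" "\<And>i. i < l \<Longrightarrow> rv f i = (if i = i0 then 1 else 0)"
proof -
  let ?c = "\<lambda>S. eval_poly (act_poly (\<gamma>s ! i0) (aS S)) zr"
  let ?f = "\<Sum>S \<in> Pow P. Const (?c S) * GS S"
  let ?d = "sgn_Sig (\<gamma>s ! i0) * eval_poly Delta zr"
  have f: "?f \<in> inv_ring n G"
    by (intro G.inv_ring_sum G.inv_ring_mult G.inv_ring_Const GS_inv) auto
  have v: "rv ?f i = (if i = i0 then ?d else 0)" if "i < l" for i
  proof -
    have "rv ?f i = eval_poly (\<Sum>S \<in> Pow P. act_poly (\<gamma>s ! i0) (aS S) * act_poly (\<gamma>s ! i) (GS S)) zr"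
      by (simp add: rv_sum rv_mult rv_Const that ev.hom_sum ev.hom_mult) (simp add: rv_def)
    then show ?thesis unfolding kernel_G[OF assms that] by (auto simp: ev.hom_mult)
  qed
  have d: "?d \<noteq> 0" using eval_Delta by (simp add: sgn_Sig_def)
  show thesis
  proof (rule that[of "Const (1 / ?d) * ?f"])
    show "Const (1 / ?d) * ?f \<in> inv_ring n G" by (intro G.inv_ring_mult G.inv_ring_Const f)
    show "rv (Const (1 / ?d) * ?f) i = (if i = i0 then 1 else 0)" if "i < l" for i
      unfolding rv_mult[OF that] rv_Const[OF that] v[OF that] using d by auto
  qed
qed

lemma interpolation_G:
  assumes "f \<in> inv_ring n G"
  shows "of_nat (card G) * f = (\<Sum>S \<in> Pow P. ddiff (f * aS S) * GS S)"
proof -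
  have "ddiff (f * aS S) \<in> inv_ring n G" if "S \<in> Pow P" for S
    using that by (intro inv_Sig_G[OF ddiff_inv_ring] polys_closed(7) aS_polys G.inv_ring_polys[OF assms]) auto
  then have "G.orbit_sum (\<Sum>S \<in> Pow P. ddiff (f * aS S) * bS S) = (\<Sum>S \<in> Pow P. ddiff (f * aS S) * GS S)"
    unfolding GS_def
    by (simp add: G.orbit_sum_inv_mult[symmetric]) (simp add: G.orbit_sum_def G.act_distribs sum.swap[of _ "Pow P"])
  then show ?thesis unfolding interpolation[symmetric] G.orbit_sum_of_inv[OF assms] .
qed

lemma eval_act_cong:
  assumes f: "f \<in> inv_ring n G" and h: "h \<in> inv_ring n G" and eq: "\<And>i. i < l \<Longrightarrow> rv f i = rv h i"
    and g: "g \<in> Sig"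
  shows "eval_poly (act_poly g f) zr = eval_poly (act_poly g h) zr"
proof -
  obtain i k where ik: "i < l" "k \<in> G" "g = \<gamma>s ! i \<circ> k" using cosets[OF g] by blast
  have "act_poly g p = act_poly (\<gamma>s ! i) p" if "p \<in> inv_ring n G" for p :: "rat mpol"
    using G.inv_ring_act[OF that ik(2)] act_comp[OF rep_in[OF ik(1)] G_in[OF ik(2)], of p] ik(3) by simp
  then show ?thesis using f h eq[OF ik(1)] by (simp add: rv_def)
qed

text \<open>The key point, which replaces the Cohen-Macaulay property: an invariant form whose values on
  the orbit are those of an invariant form of smaller degree lies in the ideal of the invariant ring
  that is generated by the \<open>\<Sigma>\<close>-invariants of positive degree. The coefficient
  \<open>ddiff (f * aS S)\<close> has degree \<open>d - card S\<close>. In degree zero it is a constant, which depends on the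
  values of \<open>f\<close> on the orbit only, and which vanishes for a form of smaller degree.\<close>

lemma lower_values:
  assumes f: "f \<in> inv_ring n G" "homogeneous d f"
    and h: "h \<in> inv_ring n G" "homogeneous e h" "e < d \<or> h = 0"
    and eq: "\<And>i. i < l \<Longrightarrow> rv f i = rv h i"
  shows "of_nat (card G) * f = (\<Sum>S \<in> {S \<in> Pow P. card S < d}. ddiff (f * aS S) * GS S)"
proof -
  have "ddiff (f * aS S) = 0" if S: "S \<subseteq> P" "d \<le> card S" for S
  proof (cases "card S = d")
    case False
    have "card S \<le> card P" using S finite_P by (intro card_mono) auto
    then have "d + (card P - card S) < card P" using False S by linarith
    then show ?thesis
      using homogeneous_ddiff(2)[OF homogeneous_mult[OF f(2) homogeneous_aS[OF S(1)]]] by simp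
  next
    case True
    have cS: "card S \<le> card P" using S finite_P by (intro card_mono) auto
    have "homogeneous (d + (card P - card S)) (f * aS S)"
      by (rule homogeneous_mult[OF f(2) homogeneous_aS[OF S(1)]])
    from homogeneous_ddiff(1)[OF this] have "homogeneous 0 (ddiff (f * aS S))"
      using True cS by simp
    then obtain c where c: "ddiff (f * aS S) = Const c" using homogeneous_0_Const by blast
    have "Alt (h * aS S) = 0"
    proof (cases "h = 0")
      case True
      then show ?thesis by (simp add: Alt_def act_distribs)
    next
      case F: False
      then have "e + (card P - card S) < card P" using h(3) True cS by linarith
      then show ?thesis
        using homogeneous_ddiff(2)[OF homogeneous_mult[OF h(2) homogeneous_aS[OF S(1)]]]
        by (simp add: Alt_ddiff)
    qed
    then have "eval_poly (Alt (h * aS S)) zr = 0" by simp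
    moreover have "eval_poly (Alt (f * aS S)) zr = eval_poly (Alt (h * aS S)) zr"
      unfolding Alt_def ev.hom_sum ev.hom_mult eval_poly_Const
      by (intro sum.cong refl) (simp add: act_distribs ev.hom_mult eval_act_cong[OF f(1) h(1) eq])
    ultimately have "eval_poly (Alt (f * aS S)) zr = 0" by simp
    then have "eval_poly Delta zr * c = 0" unfolding Alt_ddiff c ev.hom_mult by simp
    then show ?thesis using eval_Delta c by simp
  qed
  then have "(\<Sum>S \<in> Pow P. ddiff (f * aS S) * GS S) = (\<Sum>S \<in> {S \<in> Pow P. card S < d}. ddiff (f * aS S) * GS S)"
    using finite_P by (intro sum.mono_neutral_right) (auto simp: not_less)
  then show ?thesis unfolding interpolation_G[OF f(1)] .
qed

end

section \<open>Secondaries and bases of the filtration\<close>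

interpretation fv: vector_space "\<lambda>(c::rat) (f::nat \<Rightarrow> rat) i. c * f i"
  by unfold_locales (auto simp: fun_eq_iff algebra_simps)

context setting
begin

definition mspan :: "rat mpol set \<Rightarrow> rat mpol set" where
  "mspan \<Theta> = {f. \<exists>F c. finite F \<and> F \<subseteq> \<Theta> \<and> (\<forall>\<theta> \<in> F. c \<theta> \<in> inv_ring n Sig) \<and> f = (\<Sum>\<theta> \<in> F. c \<theta> * \<theta>)}"

definition forms :: "rat mpol set \<Rightarrow> bool" where
  "forms \<Theta> \<longleftrightarrow> \<Theta> \<subseteq> inv_ring n G \<and> (\<forall>\<theta> \<in> \<Theta>. \<exists>d. homogeneous d \<theta>)"

definition indep :: "rat mpol set \<Rightarrow> bool" where
  "indep \<Theta> \<longleftrightarrow> (\<forall>F q. finite F \<longrightarrow> F \<subseteq> \<Theta> \<longrightarrow> (\<forall>i < l. (\<Sum>\<theta> \<in> F. q \<theta> * rv \<theta> i) = 0) \<longrightarrow> (\<forall>\<theta> \<in> F. q \<theta> = 0))"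

definition spans :: "rat mpol set \<Rightarrow> bool" where
  "spans \<Theta> \<longleftrightarrow> (\<forall>d. \<forall>f \<in> inv_ring n G. homogeneous d f \<longrightarrow> (\<exists>F q. finite F \<and> F \<subseteq> \<Theta> \<and>
     (\<forall>\<theta> \<in> F. dg \<theta> \<le> d) \<and> (\<forall>i < l. rv f i = (\<Sum>\<theta> \<in> F. q \<theta> * rv \<theta> i))))"

lemma indepD:
  assumes "indep \<Theta>" "finite F" "F \<subseteq> \<Theta>" "\<And>i. i < l \<Longrightarrow> (\<Sum>\<theta> \<in> F. q \<theta> * rv \<theta> i) = 0" "\<theta> \<in> F"
  shows "q \<theta> = 0"
  using assms(1)[unfolded indep_def, rule_format, OF assms(2,3)] assms(4,5) by blast

lemma mspanI:
  "finite F \<Longrightarrow> F \<subseteq> \<Theta> \<Longrightarrow> (\<And>\<theta>. \<theta> \<in> F \<Longrightarrow> c \<theta> \<in> inv_ring n Sig) \<Longrightarrow> (\<Sum>\<theta> \<in> F. c \<theta> * \<theta>) \<in> mspan \<Theta>"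
  unfolding mspan_def by blast

lemma mspan_0: "0 \<in> mspan \<Theta>"
  using mspanI[of "{}"] by simp

lemma mspan_base: "\<theta> \<in> \<Theta> \<Longrightarrow> \<theta> \<in> mspan \<Theta>"
  using mspanI[of "{\<theta>}" \<Theta> "\<lambda>_. 1"] by (simp add: inv_ring_1)

lemma mspan_add:
  assumes "f \<in> mspan \<Theta>" "g \<in> mspan \<Theta>"
  shows "f + g \<in> mspan \<Theta>"
proof -
  obtain F1 c1 where 1: "finite F1" "F1 \<subseteq> \<Theta>" "\<And>\<theta>. \<theta> \<in> F1 \<Longrightarrow> c1 \<theta> \<in> inv_ring n Sig" "f = (\<Sum>\<theta> \<in> F1. c1 \<theta> * \<theta>)"
    using assms(1) unfolding mspan_def by blast
  obtain F2 c2 where 2: "finite F2" "F2 \<subseteq> \<Theta>" "\<And>\<theta>. \<theta> \<in> F2 \<Longrightarrow> c2 \<theta> \<in> inv_ring n Sig" "g = (\<Sum>\<theta> \<in> F2. c2 \<theta> * \<theta>)"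
    using assms(2) unfolding mspan_def by blast
  let ?c = "\<lambda>\<theta>. (if \<theta> \<in> F1 then c1 \<theta> else 0) + (if \<theta> \<in> F2 then c2 \<theta> else 0)"
  have "f = (\<Sum>\<theta> \<in> F1 \<union> F2. (if \<theta> \<in> F1 then c1 \<theta> else 0) * \<theta>)"
    unfolding 1(4) using 1(1) 2(1) by (intro sum.mono_neutral_cong_left) auto
  moreover have "g = (\<Sum>\<theta> \<in> F1 \<union> F2. (if \<theta> \<in> F2 then c2 \<theta> else 0) * \<theta>)"
    unfolding 2(4) using 1(1) 2(1) by (intro sum.mono_neutral_cong_left) auto
  ultimately have "f + g = (\<Sum>\<theta> \<in> F1 \<union> F2. ?c \<theta> * \<theta>)"
    by (simp only: distrib_right sum.distrib)
  moreover have "\<dots> \<in> mspan \<Theta>"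
    using 1 2 by (intro mspanI inv_ring_add) (auto simp: inv_ring_0)
  ultimately show ?thesis by simp
qed

lemma mspan_smult:
  assumes "f \<in> mspan \<Theta>" "a \<in> inv_ring n Sig"
  shows "a * f \<in> mspan \<Theta>"
proof -
  obtain F c where 1: "finite F" "F \<subseteq> \<Theta>" "\<And>\<theta>. \<theta> \<in> F \<Longrightarrow> c \<theta> \<in> inv_ring n Sig" "f = (\<Sum>\<theta> \<in> F. c \<theta> * \<theta>)"
    using assms(1) unfolding mspan_def by blast
  have "a * f = (\<Sum>\<theta> \<in> F. (a * c \<theta>) * \<theta>)" unfolding 1(4) by (simp add: sum_distrib_left mult.assoc)
  then show ?thesis using mspanI[OF 1(1,2), of "\<lambda>\<theta>. a * c \<theta>"] 1(3) assms(2) by (simp add: inv_ring_mult)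
qed

lemma mspan_sum: "(\<And>a. a \<in> A \<Longrightarrow> f a \<in> mspan \<Theta>) \<Longrightarrow> sum f A \<in> mspan \<Theta>"
  by (induction A rule: infinite_finite_induct) (simp_all add: mspan_0 mspan_add)

lemma mspan_trans: "\<Theta> \<subseteq> mspan \<Theta>' \<Longrightarrow> f \<in> mspan \<Theta> \<Longrightarrow> f \<in> mspan \<Theta>'"
  unfolding mspan_def[of \<Theta>] by (auto intro!: mspan_sum mspan_smult)

lemma mspan_Const_cancel:
  assumes "of_nat k * f \<in> mspan \<Theta>" "k > 0"
  shows "f \<in> mspan \<Theta>"
proof -
  have "Const (1 / of_nat k) * (of_nat k * f) \<in> mspan \<Theta>"
    by (intro mspan_smult assms(1) inv_ring_Const)
  moreover have "Const (1 / of_nat k) * of_nat k = (1 :: rat mpol)"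
    using assms(2) by (simp flip: Const.hom_of_nat Const.hom_mult)
  ultimately show ?thesis by (simp flip: mult.assoc)
qed

lemma generates_iff:
  assumes "carrier S = Sig"
  shows "generates n S G \<Theta> \<longleftrightarrow> inv_ring n G \<subseteq> mspan \<Theta>"
  unfolding generates_def mspan_def assms by blast

lemma forms_homogeneous: "forms \<Theta> \<Longrightarrow> \<theta> \<in> \<Theta> \<Longrightarrow> homogeneous (dg \<theta>) \<theta>"
  unfolding forms_def using homogeneous_dg by blast

lemma forms_inv: "forms \<Theta> \<Longrightarrow> \<theta> \<in> \<Theta> \<Longrightarrow> \<theta> \<in> inv_ring n G"
  unfolding forms_def by blast

abbreviation W :: "rat mpol" where "W \<equiv> of_int_poly \<omega>"

lemma W: "W \<in> inv_ring n Sig" "homogeneous 1 W" "eval_poly W zr \<noteq> 0"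
  using omega by (simp_all add: inv_ring_of_int_poly homogeneous_of_int_poly eval_of_int_poly)

text \<open>Multiplication by powers of \<open>\<omega>\<close> raises the degree without changing the values, up to a constant.\<close>

lemma lift_degree:
  assumes F: "finite F" "\<And>\<theta>. \<theta> \<in> F \<Longrightarrow> \<theta> \<in> inv_ring n G \<and> homogeneous (dg \<theta>) \<theta> \<and> dg \<theta> < d"
  obtains h where "h \<in> inv_ring n G" "homogeneous (d - 1) h" "d - 1 < d \<or> h = 0"
    "\<And>i. i < l \<Longrightarrow> rv h i = (\<Sum>\<theta> \<in> F. q \<theta> * rv \<theta> i)"
proof
  let ?k = "\<lambda>\<theta>. d - 1 - dg \<theta>" and ?w = "eval_poly W zr"
  let ?h = "\<Sum>\<theta> \<in> F. Const (q \<theta> / ?w ^ ?k \<theta>) * (\<theta> * W ^ ?k \<theta>)"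
  show "?h \<in> inv_ring n G"
    using F(2) by (intro G.inv_ring_sum G.inv_ring_mult G.inv_ring_Const inv_Sig_G[OF inv_ring_power] W(1)) auto
  show "homogeneous (d - 1) ?h"
  proof (intro homogeneous_sum homogeneous_Const_mult)
    fix \<theta> assume "\<theta> \<in> F"
    then have "homogeneous (dg \<theta> + ?k \<theta> * 1) (\<theta> * W ^ ?k \<theta>)"
      using F(2) by (intro homogeneous_mult homogeneous_power W(2)) auto
    moreover have "dg \<theta> + ?k \<theta> * 1 = d - 1" using F(2)[OF \<open>\<theta> \<in> F\<close>] by linarith
    ultimately show "homogeneous (d - 1) (\<theta> * W ^ ?k \<theta>)" by simp
  qed
  show "d - 1 < d \<or> ?h = 0"
  proof (cases "d = 0")
    case True
    then have "F = {}" using F(2) by auto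
    then show ?thesis by simp
  qed simp
  fix i assume i: "i < l"
  have "rv (W ^ k) i = ?w ^ k" for k
    using rv_inv_Sig[OF i inv_ring_power[OF W(1)]] by (simp add: ev.hom_power)
  then show "rv ?h i = (\<Sum>\<theta> \<in> F. q \<theta> * rv \<theta> i)"
    unfolding rv_sum[OF i] rv_mult[OF i] rv_Const[OF i] using W(3) by (intro sum.cong refl) simp
qed

lemma rv_Const_mult_sum: "i < l \<Longrightarrow> rv (\<Sum>\<theta> \<in> F. Const (q \<theta>) * \<theta>) i = (\<Sum>\<theta> \<in> F. q \<theta> * rv \<theta> i)"
  by (simp add: rv_sum rv_mult rv_Const)

lemma homogeneous_combination:
  assumes "\<And>\<theta>. \<theta> \<in> F \<Longrightarrow> \<theta> \<in> inv_ring n G \<and> homogeneous d \<theta>"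
  shows "(\<Sum>\<theta> \<in> F. Const (q \<theta>) * \<theta>) \<in> inv_ring n G" "homogeneous d (\<Sum>\<theta> \<in> F. Const (q \<theta>) * \<theta>)"
  using assms by (auto intro!: G.inv_ring_sum G.inv_ring_mult G.inv_ring_Const homogeneous_sum homogeneous_Const_mult)

text \<open>Graded Nakayama, in both directions.\<close>

lemma spans_imp_generates:
  assumes \<Theta>: "forms \<Theta>" and sp: "spans \<Theta>"
  shows "inv_ring n G \<subseteq> mspan \<Theta>"
proof -
  have hom: "f \<in> mspan \<Theta>" if "f \<in> inv_ring n G" "homogeneous d f" for f d
    using that
  proof (induction d arbitrary: f rule: less_induct)
    case (less d)
    obtain F q where F: "finite F" "F \<subseteq> \<Theta>" "\<And>\<theta>. \<theta> \<in> F \<Longrightarrow> dg \<theta> \<le> d"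
      and v: "\<And>i. i < l \<Longrightarrow> rv f i = (\<Sum>\<theta> \<in> F. q \<theta> * rv \<theta> i)"
      using sp[unfolded spans_def, rule_format, OF less.prems] by blast
    have Fh: "\<theta> \<in> inv_ring n G" "homogeneous (dg \<theta>) \<theta>" if "\<theta> \<in> F" for \<theta>
      using that F(2) forms_homogeneous[OF \<Theta>] forms_inv[OF \<Theta>] by auto
    define A where "A = {\<theta> \<in> F. dg \<theta> = d}"
    define B where "B = {\<theta> \<in> F. dg \<theta> < d}"
    have AB: "finite A" "finite B" "A \<inter> B = {}" "F = A \<union> B"
      using F(1,3) by (auto simp: A_def B_def le_less)
    define a where "a = (\<Sum>\<theta> \<in> A. Const (q \<theta>) * \<theta>)"
    have a: "a \<in> inv_ring n G" "homogeneous d a"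
      unfolding a_def by (rule homogeneous_combination[where d = d], use Fh in \<open>auto simp: A_def\<close>)+
    have "\<And>\<theta>. \<theta> \<in> B \<Longrightarrow> \<theta> \<in> inv_ring n G \<and> homogeneous (dg \<theta>) \<theta> \<and> dg \<theta> < d"
      using Fh by (auto simp: B_def)
    then obtain h where h: "h \<in> inv_ring n G" "homogeneous (d - 1) h" "d - 1 < d \<or> h = 0"
      and hv: "\<And>i. i < l \<Longrightarrow> rv h i = (\<Sum>\<theta> \<in> B. q \<theta> * rv \<theta> i)"
      using lift_degree[OF AB(2), of d q] by blast
    have eq: "rv (f - a) i = rv h i" if "i < l" for i
      unfolding rv_minus[OF that] v[OF that] hv[OF that] a_def rv_Const_mult_sum[OF that] AB(4)
      by (simp add: sum.union_disjoint AB(1-3))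
    have "of_nat (card G) * (f - a) = (\<Sum>S \<in> {S \<in> Pow P. card S < d}. ddiff ((f - a) * aS S) * GS S)"
      by (rule lower_values[OF G.inv_ring_minus[OF less.prems(1) a(1)]
            homogeneous_minus[OF less.prems(2) a(2)] h eq])
    also have "\<dots> \<in> mspan \<Theta>"
    proof (intro mspan_sum mspan_smult)
      fix S assume S: "S \<in> {S \<in> Pow P. card S < d}"
      show "GS S \<in> mspan \<Theta>"
        using S by (intro less.IH[of "card S"] GS_inv homogeneous_GS) auto
      show "ddiff ((f - a) * aS S) \<in> inv_ring n Sig"
        using S by (intro ddiff_inv_ring polys_closed(7) aS_polys G.inv_ring_polys G.inv_ring_minus less.prems(1) a(1)) auto
    qed
    finally have "f - a \<in> mspan \<Theta>" using mspan_Const_cancel G.card_H_pos by blast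
    moreover have "a \<in> mspan \<Theta>"
      unfolding a_def using F(2) by (intro mspan_sum mspan_smult mspan_base inv_ring_Const) (auto simp: A_def)
    ultimately have "(f - a) + a \<in> mspan \<Theta>" by (rule mspan_add)
    then show ?case by simp
  qed
  show ?thesis
  proof
    fix f :: "rat mpol" assume f: "f \<in> inv_ring n G"
    have "(\<Sum>d \<le> Polynomial.degree (Psi f). hc d f) \<in> mspan \<Theta>"
      by (intro mspan_sum hom[OF G.inv_ring_hc[OF f] homogeneous_hc])
    then show "f \<in> mspan \<Theta>" by (subst sum_hc)
  qed
qed

lemma mspan_homogeneous:
  assumes \<Theta>: "forms \<Theta>" and f: "f \<in> mspan \<Theta>" "homogeneous d f"
  obtains F c where "finite F" "F \<subseteq> \<Theta>" "\<And>\<theta>. \<theta> \<in> F \<Longrightarrow> dg \<theta> \<le> d \<and> c \<theta> \<in> inv_ring n Sig"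
    "f = (\<Sum>\<theta> \<in> F. c \<theta> * \<theta>)"
proof -
  obtain F c where 1: "finite F" "F \<subseteq> \<Theta>" "\<And>\<theta>. \<theta> \<in> F \<Longrightarrow> c \<theta> \<in> inv_ring n Sig" "f = (\<Sum>\<theta> \<in> F. c \<theta> * \<theta>)"
    using f(1) unfolding mspan_def by blast
  have "f = hc d f" using f(2) by (simp add: homogeneous_iff)
  also have "\<dots> = (\<Sum>\<theta> \<in> F. hc d (\<theta> * c \<theta>))" unfolding 1(4) by (simp add: hc_sum mult.commute)
  also have "\<dots> = (\<Sum>\<theta> \<in> F. if dg \<theta> \<le> d then hc (d - dg \<theta>) (c \<theta>) * \<theta> else 0)"
    using 1(2) by (intro sum.cong refl)
      (auto simp: hc_mult_homogeneous[OF forms_homogeneous[OF \<Theta>]] mult.commute)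
  also have "\<dots> = (\<Sum>\<theta> \<in> {\<theta> \<in> F. dg \<theta> \<le> d}. hc (d - dg \<theta>) (c \<theta>) * \<theta>)"
    using 1(1) by (intro sum.mono_neutral_cong_right) auto
  finally show thesis
    using 1 by (intro that[of "{\<theta> \<in> F. dg \<theta> \<le> d}" "\<lambda>\<theta>. hc (d - dg \<theta>) (c \<theta>)"]) (auto intro: inv_ring_hc)
qed

lemma generates_imp_spans:
  assumes \<Theta>: "forms \<Theta>" and g: "inv_ring n G \<subseteq> mspan \<Theta>"
  shows "spans \<Theta>"
  unfolding spans_def
proof (intro allI ballI impI)
  fix d and f :: "rat mpol" assume f: "f \<in> inv_ring n G" "homogeneous d f"
  obtain F c where F: "finite F" "F \<subseteq> \<Theta>" "\<And>\<theta>. \<theta> \<in> F \<Longrightarrow> dg \<theta> \<le> d \<and> c \<theta> \<in> inv_ring n Sig"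
    "f = (\<Sum>\<theta> \<in> F. c \<theta> * \<theta>)"
    using mspan_homogeneous[OF \<Theta> _ f(2)] g f(1) by blast
  have "rv f i = (\<Sum>\<theta> \<in> F. eval_poly (c \<theta>) zr * rv \<theta> i)" if i: "i < l" for i
    unfolding F(4) rv_sum[OF i] rv_mult[OF i] using F(3) rv_inv_Sig[OF i] by (intro sum.cong refl) simp
  then show "\<exists>F q. finite F \<and> F \<subseteq> \<Theta> \<and> (\<forall>\<theta> \<in> F. dg \<theta> \<le> d) \<and> (\<forall>i < l. rv f i = (\<Sum>\<theta> \<in> F. q \<theta> * rv \<theta> i))"
    using F by (intro exI[of _ F] exI[of _ "\<lambda>\<theta>. eval_poly (c \<theta>) zr"]) blast
qed

text \<open>A linear relation between the values is a relation modulo lower degree, so the member of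
  highest degree in it is generated by the others.\<close>

lemma minimal_imp_indep:
  assumes \<Theta>: "forms \<Theta>" and g: "inv_ring n G \<subseteq> mspan \<Theta>"
    and min: "\<And>\<theta>. \<theta> \<in> \<Theta> \<Longrightarrow> \<not> inv_ring n G \<subseteq> mspan (\<Theta> - {\<theta>})"
  shows "indep \<Theta>"
  unfolding indep_def
proof (intro allI impI, rule ccontr)
  fix F q
  assume F: "finite F" "F \<subseteq> \<Theta>" and rel: "\<forall>i < l. (\<Sum>\<theta> \<in> F. q \<theta> * rv \<theta> i) = 0"
    and nz: "\<not> (\<forall>\<theta> \<in> F. q \<theta> = 0)"
  define F' where "F' = {\<theta> \<in> F. q \<theta> \<noteq> 0}"
  have F': "finite F'" "F' \<subseteq> \<Theta>" "F' \<noteq> {}" using F nz by (auto simp: F'_def)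
  define d where "d = Max (dg ` F')"
  have "d \<in> dg ` F'" unfolding d_def using F' by (intro Max_in) auto
  then obtain t where t: "t \<in> F'" "dg t = d" by auto
  have le: "dg \<theta> \<le> d" if "\<theta> \<in> F'" for \<theta>
    unfolding d_def using F'(1) that by (intro Max_ge) auto
  have Fh: "\<theta> \<in> inv_ring n G" "homogeneous (dg \<theta>) \<theta>" if "\<theta> \<in> F'" for \<theta>
    using that F'(2) forms_homogeneous[OF \<Theta>] forms_inv[OF \<Theta>] by auto
  define A where "A = {\<theta> \<in> F'. dg \<theta> = d}"
  define B where "B = {\<theta> \<in> F'. dg \<theta> < d}"
  have AB: "finite A" "finite B" "A \<inter> B = {}" "F' = A \<union> B" "t \<in> A"
    using F'(1) le t by (auto simp: A_def B_def le_less)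
  have rel': "(\<Sum>\<theta> \<in> A. q \<theta> * rv \<theta> i) = (\<Sum>\<theta> \<in> B. - q \<theta> * rv \<theta> i)" if i: "i < l" for i
  proof -
    have "(\<Sum>\<theta> \<in> F'. q \<theta> * rv \<theta> i) = (\<Sum>\<theta> \<in> F. q \<theta> * rv \<theta> i)"
      unfolding F'_def using F(1) by (intro sum.mono_neutral_left) auto
    then have "(\<Sum>\<theta> \<in> A. q \<theta> * rv \<theta> i) + (\<Sum>\<theta> \<in> B. q \<theta> * rv \<theta> i) = 0"
      using rel i by (simp add: AB(4) sum.union_disjoint AB(1-3))
    then show ?thesis by (simp add: sum_negf eq_neg_iff_add_eq_0)
  qed
  define a where "a = (\<Sum>\<theta> \<in> A. Const (q \<theta>) * \<theta>)"
  have a: "a \<in> inv_ring n G" "homogeneous d a"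
    unfolding a_def by (rule homogeneous_combination[where d = d], use Fh in \<open>auto simp: A_def\<close>)+
  have "\<And>\<theta>. \<theta> \<in> B \<Longrightarrow> \<theta> \<in> inv_ring n G \<and> homogeneous (dg \<theta>) \<theta> \<and> dg \<theta> < d"
    using Fh by (auto simp: B_def)
  then obtain h where h: "h \<in> inv_ring n G" "homogeneous (d - 1) h" "d - 1 < d \<or> h = 0"
    and hv: "\<And>i. i < l \<Longrightarrow> rv h i = (\<Sum>\<theta> \<in> B. - q \<theta> * rv \<theta> i)"
    using lift_degree[OF AB(2), of d "\<lambda>\<theta>. - q \<theta>"] by blast
  let ?\<Theta> = "\<Theta> - {t}"
  have low: "f \<in> mspan ?\<Theta>" if f: "f \<in> inv_ring n G" "homogeneous e f" "e < d" for f e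
  proof -
    obtain F c where F: "finite F" "F \<subseteq> \<Theta>" "\<And>\<theta>. \<theta> \<in> F \<Longrightarrow> dg \<theta> \<le> e \<and> c \<theta> \<in> inv_ring n Sig"
      "f = (\<Sum>\<theta> \<in> F. c \<theta> * \<theta>)"
      using mspan_homogeneous[OF \<Theta> _ f(2)] g f(1) by blast
    have "t \<notin> F" using F(3)[of t] t f(3) by auto
    then show ?thesis unfolding F(4) using F by (intro mspanI) auto
  qed
  have eq: "rv a i = rv h i" if "i < l" for i
    unfolding a_def rv_Const_mult_sum[OF that] hv[OF that] by (rule rel'[OF that])
  have "of_nat (card G) * a = (\<Sum>S \<in> {S \<in> Pow P. card S < d}. ddiff (a * aS S) * GS S)"
    by (rule lower_values[OF a h eq])
  also have "\<dots> \<in> mspan ?\<Theta>"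
  proof (intro mspan_sum mspan_smult)
    fix S assume S: "S \<in> {S \<in> Pow P. card S < d}"
    show "GS S \<in> mspan ?\<Theta>"
      using S by (intro low[of _ "card S"] GS_inv homogeneous_GS) auto
    show "ddiff (a * aS S) \<in> inv_ring n Sig"
      using S a(1) by (intro ddiff_inv_ring polys_closed(7) aS_polys G.inv_ring_polys) auto
  qed
  finally have am: "a \<in> mspan ?\<Theta>" using mspan_Const_cancel G.card_H_pos by blast
  have "(\<Sum>\<theta> \<in> A - {t}. Const (- q \<theta>) * \<theta>) \<in> mspan ?\<Theta>"
    using F'(2) by (intro mspan_sum mspan_smult mspan_base inv_ring_Const) (auto simp: A_def)
  with am have "a + (\<Sum>\<theta> \<in> A - {t}. Const (- q \<theta>) * \<theta>) \<in> mspan ?\<Theta>" by (rule mspan_add)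
  moreover have "a = Const (q t) * t + (\<Sum>\<theta> \<in> A - {t}. Const (q \<theta>) * \<theta>)"
    unfolding a_def by (rule sum.remove[OF AB(1,5)])
  ultimately have "Const (q t) * t \<in> mspan ?\<Theta>"
    by (simp add: Const.hom_uminus sum_negf)
  then have "Const (1 / q t) * (Const (q t) * t) \<in> mspan ?\<Theta>" by (rule mspan_smult[OF _ inv_ring_Const])
  moreover have "Const (1 / q t) * (Const (q t) * t) = t"
    using t(1) by (simp add: F'_def flip: mult.assoc Const.hom_mult)
  ultimately have "t \<in> mspan ?\<Theta>" by simp
  then have "\<theta> \<in> mspan ?\<Theta>" if "\<theta> \<in> \<Theta>" for \<theta>
    using that mspan_base[of \<theta> ?\<Theta>] by (cases "\<theta> = t") simp_all
  then have sub: "\<Theta> \<subseteq> mspan ?\<Theta>" by (rule subsetI)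
  have "inv_ring n G \<subseteq> mspan ?\<Theta>"
    by (rule subsetI, rule mspan_trans[OF sub], rule subsetD[OF g])
  moreover have "t \<in> \<Theta>" using t(1) F'(2) by blast
  ultimately show False using min by blast
qed

lemma mspan_values:
  assumes "f \<in> mspan \<Theta>"
  obtains F q where "finite F" "F \<subseteq> \<Theta>" "\<And>i. i < l \<Longrightarrow> rv f i = (\<Sum>\<theta> \<in> F. q \<theta> * rv \<theta> i)"
proof -
  obtain F c where F: "finite F" "F \<subseteq> \<Theta>" "\<And>\<theta>. \<theta> \<in> F \<Longrightarrow> c \<theta> \<in> inv_ring n Sig" "f = (\<Sum>\<theta> \<in> F. c \<theta> * \<theta>)"
    using assms unfolding mspan_def by blast
  have "rv f i = (\<Sum>\<theta> \<in> F. eval_poly (c \<theta>) zr * rv \<theta> i)" if i: "i < l" for i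
    unfolding F(4) rv_sum[OF i] rv_mult[OF i] using F(3) rv_inv_Sig[OF i] by (intro sum.cong refl) simp
  with F(1,2) show thesis by (rule that)
qed

text \<open>Reduces secondaries, which are defined by modules, to linear algebra with the values on the orbit.\<close>

lemma secondaries_iff:
  assumes S: "carrier S = Sig"
  shows "secondaries n S G \<Theta> \<longleftrightarrow> forms \<Theta> \<and> indep \<Theta> \<and> spans \<Theta>"
proof
  assume s: "secondaries n S G \<Theta>"
  then have f: "forms \<Theta>" and g: "inv_ring n G \<subseteq> mspan \<Theta>"
    by (simp_all add: secondaries_def forms_def generates_iff[OF S])
  moreover have "\<not> inv_ring n G \<subseteq> mspan (\<Theta> - {\<theta>})" if "\<theta> \<in> \<Theta>" for \<theta>
    using s that unfolding secondaries_def generates_iff[OF S] by blast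
  ultimately show "forms \<Theta> \<and> indep \<Theta> \<and> spans \<Theta>"
    using minimal_imp_indep generates_imp_spans by blast
next
  assume *: "forms \<Theta> \<and> indep \<Theta> \<and> spans \<Theta>"
  have "\<not> inv_ring n G \<subseteq> mspan \<Theta>'" if sub: "\<Theta>' \<subset> \<Theta>" for \<Theta>'
  proof
    assume g: "inv_ring n G \<subseteq> mspan \<Theta>'"
    obtain t where t: "t \<in> \<Theta>" "t \<notin> \<Theta>'" using sub by blast
    have tm: "t \<in> mspan \<Theta>'" using t(1) * g forms_inv by blast
    obtain F q where F: "finite F" "F \<subseteq> \<Theta>'" "\<And>i. i < l \<Longrightarrow> rv t i = (\<Sum>\<theta> \<in> F. q \<theta> * rv \<theta> i)"
      by (rule mspan_values[OF tm]) (rule that)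
    let ?q = "\<lambda>\<theta>. if \<theta> = t then - 1 else q \<theta>"
    have tF: "t \<notin> F" using F(2) t(2) by blast
    have "(\<Sum>\<theta> \<in> insert t F. ?q \<theta> * rv \<theta> i) = 0" if "i < l" for i
    proof -
      have "(\<Sum>\<theta> \<in> F. ?q \<theta> * rv \<theta> i) = (\<Sum>\<theta> \<in> F. q \<theta> * rv \<theta> i)"
        using tF by (intro sum.cong) auto
      then show ?thesis using F(1) tF F(3)[OF that] by simp
    qed
    moreover have "insert t F \<subseteq> \<Theta>" using F(2) t(1) sub by blast
    ultimately have "?q t = 0"
      using * F(1) by (intro indepD[of \<Theta> "insert t F" ?q]) auto
    then show False by simp
  qed
  with * show "secondaries n S G \<Theta>"
    using spans_imp_generates by (auto simp: secondaries_def forms_def generates_iff[OF S])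
qed

end

lemma sum_fun_apply: "(\<Sum>a\<in>A. f a) i = (\<Sum>a\<in>A. f a i)" for f :: "'a \<Rightarrow> 'b \<Rightarrow> 'c::comm_monoid_add"
  by (induction A rule: infinite_finite_induct) auto

lemma dg_of_int_poly: "homogeneous d p \<Longrightarrow> dg (of_int_poly p :: rat mpol) = dg p"
proof (cases "p = 0")
  case False
  moreover assume "homogeneous d p"
  moreover have "(of_int_poly p :: rat mpol) \<noteq> 0" using False by (metis oi.hom_zero of_int_poly_inj)
  ultimately show ?thesis by (simp add: dg_homogeneous homogeneous_of_int_poly)
qed (simp add: dg_def)

context setting
begin

definition vv :: "rat mpol \<Rightarrow> nat \<Rightarrow> rat" where
  "vv \<theta> = (\<lambda>i. if i < l then rv \<theta> i else 0)"

lemma vv_eqD: "vv f = vv g \<Longrightarrow> i < l \<Longrightarrow> rv f i = rv g i"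
  unfolding vv_def by metis

lemma indep_inj:
  assumes "indep \<Theta>"
  shows "inj_on vv \<Theta>"
proof (rule inj_onI, rule ccontr)
  fix s t assume st: "s \<in> \<Theta>" "t \<in> \<Theta>" "vv s = vv t" "s \<noteq> t"
  let ?q = "\<lambda>u. if u = s then 1 else - 1 :: rat"
  have "?q s = 0"
  proof (rule indepD[OF assms, of "{s, t}" ?q])
    show "(\<Sum>u \<in> {s, t}. ?q u * rv u i) = 0" if "i < l" for i
      using st(4) vv_eqD[OF st(3) that] by simp
  qed (use st in auto)
  then show False by simp
qed

lemma indep_vv:
  assumes \<Theta>: "indep \<Theta>"
  shows "fv.independent (vv ` \<Theta>)"
  unfolding fv.independent_explicit_module
proof (intro allI impI)
  fix t u v
  assume t: "finite t" "t \<subseteq> vv ` \<Theta>" and s: "(\<Sum>v\<in>t. (\<lambda>i. u v * v i)) = 0" and v: "v \<in> t"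
  obtain F where F: "F \<subseteq> \<Theta>" "t = vv ` F" using t(2) subset_imageE by metis
  have inj: "inj_on vv F" using indep_inj[OF \<Theta>] F(1) inj_on_subset by blast
  have fin: "finite F" using t(1) F(2) inj finite_imageD by blast
  obtain \<theta> where \<theta>: "\<theta> \<in> F" "v = vv \<theta>" using v F(2) by blast
  have "u (vv \<theta>) = 0"
  proof (rule indepD[OF \<Theta> fin F(1) _ \<theta>(1), of "\<lambda>\<theta>. u (vv \<theta>)"])
    fix i assume i: "i < l"
    have "(\<Sum>\<theta>\<in>F. u (vv \<theta>) * rv \<theta> i) = (\<Sum>\<theta>\<in>F. u (vv \<theta>) * vv \<theta> i)"
      using i by (simp add: vv_def)
    also have "\<dots> = (\<Sum>v\<in>t. u v * v i)"
      unfolding F(2) by (simp add: sum.reindex[OF inj])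
    also have "\<dots> = (\<Sum>v\<in>t. (\<lambda>i. u v * v i)) i" by (simp only: sum_fun_apply)
    also have "\<dots> = 0" unfolding s by simp
    finally show "(\<Sum>\<theta>\<in>F. u (vv \<theta>) * rv \<theta> i) = 0" .
  qed
  then show "u v = 0" using \<theta>(2) by simp
qed

lemma vv_in_span:
  assumes "finite F" "\<And>i. i < l \<Longrightarrow> rv f i = (\<Sum>\<theta> \<in> F. q \<theta> * rv \<theta> i)" "vv ` F \<subseteq> V"
  shows "vv f \<in> fv.span V"
proof -
  have "vv f = (\<Sum>\<theta>\<in>F. (\<lambda>i. q \<theta> * vv \<theta> i))"
    by (rule ext) (use assms(2) in \<open>simp add: sum_fun_apply vv_def\<close>)
  also have "\<dots> \<in> fv.span V"
    using assms(3) by (intro fv.span_sum fv.span_scale fv.span_base) auto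
  finally show ?thesis .
qed

text \<open>Hence the number of secondaries of each degree does not depend on the choice.\<close>

lemma card_degree_le:
  assumes \<Theta>: "forms \<Theta>" "indep \<Theta>" "spans \<Theta>"
  shows "card {\<theta> \<in> \<Theta>. dg \<theta> \<le> d} = fv.dim (vv ` {f \<in> inv_ring n G. homogeneous d f})"
proof -
  let ?T = "{\<theta> \<in> \<Theta>. dg \<theta> \<le> d}" and ?U = "{f \<in> inv_ring n G. homogeneous d f}"
  have sub: "vv ` ?T \<subseteq> vv ` ?U"
  proof (rule image_subsetI)
    fix \<theta> assume \<theta>: "\<theta> \<in> ?T"
    have "\<And>t. t \<in> {\<theta>} \<Longrightarrow> t \<in> inv_ring n G \<and> homogeneous (dg t) t \<and> dg t < Suc d"
      using \<theta> forms_homogeneous[OF \<Theta>(1)] forms_inv[OF \<Theta>(1)] by auto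
    then obtain h
      where h: "h \<in> inv_ring n G" "homogeneous d h" "\<And>i. i < l \<Longrightarrow> rv h i = rv \<theta> i"
      using lift_degree[of "{\<theta>}" "Suc d" "\<lambda>_. 1"] by auto
    have "vv \<theta> = vv h" unfolding vv_def using h(3) by auto
    then show "vv \<theta> \<in> vv ` ?U" using h by blast
  qed
  have "vv f \<in> fv.span (vv ` ?T)" if f: "f \<in> ?U" for f
  proof -
    obtain F q where F: "finite F" "F \<subseteq> \<Theta>" "\<forall>\<theta> \<in> F. dg \<theta> \<le> d" "\<forall>i < l. rv f i = (\<Sum>\<theta> \<in> F. q \<theta> * rv \<theta> i)"
      using \<Theta>(3)[unfolded spans_def, rule_format, of f d] f by auto
    show ?thesis using F by (intro vv_in_span[OF F(1)]) auto
  qed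
  then have "vv ` ?U \<subseteq> fv.span (vv ` ?T)" by blast
  moreover have "fv.independent (vv ` ?T)"
    using indep_vv[OF \<Theta>(2)] by (rule fv.independent_mono) auto
  ultimately have "card (vv ` ?T) = fv.dim (vv ` ?U)" using sub by (intro fv.basis_card_eq_dim)
  moreover have "card (vv ` ?T) = card ?T"
    by (rule card_image, rule inj_on_subset[OF indep_inj[OF \<Theta>(2)]]) auto
  ultimately show ?thesis by simp
qed

lemma l_pos: "l > 0"
  using cosets[OF id_in] by auto

lemma card_forms:
  assumes \<Theta>: "forms \<Theta>" "indep \<Theta>" "spans \<Theta>"
  shows "card \<Theta> = l" "finite \<Theta>"
proof -
  let ?V = "vv ` inv_ring n G"
  have "?V \<subseteq> fv.span (vv ` \<Theta>)"
  proof (rule image_subsetI)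
    fix f :: "rat mpol" assume "f \<in> inv_ring n G"
    then have "f \<in> mspan \<Theta>" using spans_imp_generates[OF \<Theta>(1,3)] by blast
    from mspan_values[OF this] obtain F q where "finite F" "F \<subseteq> \<Theta>" "\<And>i. i < l \<Longrightarrow> rv f i = (\<Sum>\<theta> \<in> F. q \<theta> * rv \<theta> i)"
      by blast
    then show "vv f \<in> fv.span (vv ` \<Theta>)" by (intro vv_in_span[of F]) auto
  qed
  moreover have "vv ` \<Theta> \<subseteq> ?V" using forms_inv[OF \<Theta>(1)] by auto
  ultimately have c1: "card (vv ` \<Theta>) = fv.dim ?V"
    using indep_vv[OF \<Theta>(2)] by (intro fv.basis_card_eq_dim)
  define E where "E i = (\<lambda>k. if k = i then 1 else 0 :: rat)" for i :: nat
  have injE: "inj_on E A" for A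
    unfolding E_def by (rule inj_onI) (metis zero_neq_one)
  have "E ` {..<l} \<subseteq> ?V"
  proof (rule image_subsetI)
    fix i assume "i \<in> {..<l}"
    then obtain f where f: "f \<in> inv_ring n G" "\<And>k. k < l \<Longrightarrow> rv f k = (if k = i then 1 else 0)"
      using separate[of i] by auto
    then have "E i = vv f" using \<open>i \<in> {..<l}\<close> by (auto simp: E_def vv_def fun_eq_iff)
    then show "E i \<in> ?V" using f(1) by blast
  qed
  moreover have "?V \<subseteq> fv.span (E ` {..<l})"
  proof (rule image_subsetI)
    fix f :: "rat mpol"
    have "vv f = (\<Sum>k<l. (\<lambda>i. vv f k * E k i))"
      by (rule ext) (simp add: sum_fun_apply E_def vv_def if_distrib cong: if_cong)
    also have "\<dots> \<in> fv.span (E ` {..<l})"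
      by (intro fv.span_sum fv.span_scale fv.span_base) auto
    finally show "vv f \<in> fv.span (E ` {..<l})" .
  qed
  moreover have "fv.independent (E ` {..<l})"
    unfolding fv.independent_explicit_module
  proof (intro allI impI)
    fix t u v
    assume t: "finite t" "t \<subseteq> E ` {..<l}" and s: "(\<Sum>v\<in>t. (\<lambda>i. u v * v i)) = 0" and v: "v \<in> t"
    obtain k where k: "v = E k" using t(2) v by blast
    have wk: "w k = (if w = E k then 1 else 0)" if w: "w \<in> t" for w
    proof -
      obtain m where "w = E m" using w t(2) by blast
      then show ?thesis using injE[of UNIV] by (auto simp: inj_eq) (simp_all add: E_def)
    qed
    have "(\<Sum>w\<in>t. u w * w k) = (\<Sum>w\<in>t. if w = v then u v else 0)"
      unfolding k by (intro sum.cong refl) (auto simp: wk)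
    then have "(\<Sum>w\<in>t. u w * w k) = u v" using t(1) v by simp
    moreover have "(\<Sum>w\<in>t. u w * w k) = (\<Sum>v\<in>t. (\<lambda>i. u v * v i)) k" by (simp only: sum_fun_apply)
    ultimately show "u v = 0" unfolding s by simp
  qed
  ultimately have "card (E ` {..<l}) = fv.dim ?V" by (intro fv.basis_card_eq_dim)
  then have "card (vv ` \<Theta>) = l" using c1 by (simp add: card_image[OF injE])
  then show c: "card \<Theta> = l" using card_image[OF indep_inj[OF \<Theta>(2)]] by simp
  show "finite \<Theta>" using c l_pos by (intro card_ge_0_finite) simp
qed

lemma zero_notin_indep:
  assumes "indep \<Theta>"
  shows "0 \<notin> \<Theta>"
proof
  assume "0 \<in> \<Theta>"
  have "(1::rat) = 0"
  proof (rule indepD[OF assms, of "{0}" "\<lambda>_. 1"])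
    show "(\<Sum>\<theta> \<in> {0}. 1 * rv \<theta> i) = 0" if "i < l" for i
      using rv_Const[OF that, of 0] by simp
  qed (use \<open>0 \<in> \<Theta>\<close> in auto)
  then show False by simp
qed

lemma tau_eq:
  assumes S: "carrier S = Sig" and \<Theta>: "secondaries n S G \<Theta>"
  shows "tau n S G d = card {\<theta> \<in> \<Theta>. homogeneous d \<theta>}"
proof -
  let ?U = "\<lambda>d. fv.dim (vv ` {f \<in> inv_ring n G. homogeneous d f})"
  have *: "card {\<theta> \<in> \<Theta>. homogeneous d \<theta>} = ?U d - (case d of 0 \<Rightarrow> 0 | Suc e \<Rightarrow> ?U e)"
    if "secondaries n S G \<Theta>" for \<Theta>
  proof -
    have \<Theta>: "forms \<Theta>" "indep \<Theta>" "spans \<Theta>" using that by (simp_all add: secondaries_iff[OF S])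
    have h: "homogeneous d \<theta> \<longleftrightarrow> dg \<theta> = d" if "\<theta> \<in> \<Theta>" for \<theta>
    proof
      have "\<theta> \<noteq> 0" using zero_notin_indep[OF \<Theta>(2)] that by blast
      then show "homogeneous d \<theta> \<Longrightarrow> dg \<theta> = d" by (intro dg_homogeneous)
      show "dg \<theta> = d \<Longrightarrow> homogeneous d \<theta>" using forms_homogeneous[OF \<Theta>(1) that] by simp
    qed
    have "{\<theta> \<in> \<Theta>. homogeneous d \<theta>} = {\<theta> \<in> \<Theta>. dg \<theta> \<le> d} - {\<theta> \<in> \<Theta>. dg \<theta> < d}"
      using h by auto
    also have "card \<dots> = card {\<theta> \<in> \<Theta>. dg \<theta> \<le> d} - card {\<theta> \<in> \<Theta>. dg \<theta> < d}"
      using card_forms(2)[OF \<Theta>] by (intro card_Diff_subset) auto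
    finally have "card {\<theta> \<in> \<Theta>. homogeneous d \<theta>} = card {\<theta> \<in> \<Theta>. dg \<theta> \<le> d} - card {\<theta> \<in> \<Theta>. dg \<theta> < d}" .
    moreover have "card {\<theta> \<in> \<Theta>. dg \<theta> < d} = (case d of 0 \<Rightarrow> 0 | Suc e \<Rightarrow> ?U e)"
      by (cases d) (simp_all add: less_Suc_eq_le card_degree_le[OF \<Theta>])
    ultimately show ?thesis by (simp add: card_degree_le[OF \<Theta>])
  qed
  show ?thesis
    unfolding tau_def
  proof (rule the_equality)
    show "\<exists>\<Theta>'. secondaries n S G \<Theta>' \<and> card {\<theta> \<in> \<Theta>. homogeneous d \<theta>} = card {\<theta> \<in> \<Theta>'. homogeneous d \<theta>}"
      using \<Theta> by blast
    fix t assume "\<exists>\<Theta>. secondaries n S G \<Theta> \<and> t = card {\<theta> \<in> \<Theta>. homogeneous d \<theta>}"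
    then obtain \<Theta>' where "secondaries n S G \<Theta>'" "t = card {\<theta> \<in> \<Theta>'. homogeneous d \<theta>}" by blast
    then show "t = card {\<theta> \<in> \<Theta>. homogeneous d \<theta>}" by (simp only: *[OF \<Theta>] *)
  qed
qed

text \<open>The averaged coefficients of the kernel generate, so a minimal subset of them is a set of
  secondaries with integer coefficients.\<close>

lemma ex_int_secondaries:
  assumes S: "carrier S = Sig"
  shows "\<exists>\<theta>s. int_secondaries n S G \<theta>s"
proof -
  let ?Z = "GS ` Pow P :: int mpol set"
  let ?Q = "\<lambda>X. X \<subseteq> ?Z \<and> inv_ring n G \<subseteq> mspan (of_int_poly ` X)"
  have finZ: "finite ?Z" using finite_P by simp
  have "f \<in> mspan (of_int_poly ` ?Z)" if "f \<in> inv_ring n G" for f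
  proof -
    have "(\<Sum>S \<in> Pow P. ddiff (f * aS S) * GS S) \<in> mspan (of_int_poly ` ?Z)"
    proof (intro mspan_sum mspan_smult mspan_base)
      fix S assume "S \<in> Pow P"
      then have "of_int_poly (GS S) \<in> of_int_poly ` ?Z" by (intro imageI)
      then show "GS S \<in> of_int_poly ` ?Z" by (simp only: of_int_poly_GS)
      show "ddiff (f * aS S) \<in> inv_ring n Sig"
        using \<open>S \<in> Pow P\<close> by (intro ddiff_inv_ring polys_closed(7) aS_polys G.inv_ring_polys that) auto
    qed
    then show ?thesis
      unfolding interpolation_G[OF that, symmetric] using G.card_H_pos by (rule mspan_Const_cancel)
  qed
  then have "?Q ?Z" by blast
  from ex_has_least_nat[of ?Q, OF this, of card] obtain X
    where X: "?Q X" "\<And>Y. ?Q Y \<Longrightarrow> card X \<le> card Y" by blast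
  have finX: "finite X" using X(1) finZ finite_subset by blast
  obtain \<theta>s where \<theta>s: "set \<theta>s = X" "distinct \<theta>s" using finite_distinct_list[OF finX] by blast
  let ?\<Theta> = "of_int_poly ` X :: rat mpol set"
  have inv: "X \<subseteq> inv_ring n G" using X(1) GS_inv by blast
  have f: "forms ?\<Theta>"
    unfolding forms_def
  proof safe
    fix p assume p: "p \<in> X"
    show "of_int_poly p \<in> inv_ring n G" using inv p by (intro G.inv_ring_of_int_poly) blast
    have "p \<in> ?Z" using p X(1) by blast
    then obtain S where "S \<subseteq> P" "p = GS S" by blast
    then show "\<exists>d. homogeneous d (of_int_poly p :: rat mpol)" using homogeneous_GS homogeneous_of_int_poly by blast
  qed
  have "\<not> inv_ring n G \<subseteq> mspan (?\<Theta> - {t})" if t: "t \<in> ?\<Theta>" for t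
  proof
    assume g: "inv_ring n G \<subseteq> mspan (?\<Theta> - {t})"
    obtain p where p: "p \<in> X" "t = of_int_poly p" using t by blast
    have "?\<Theta> - {t} = of_int_poly ` (X - {p})" using p by (auto simp: of_int_poly_inj)
    then have "?Q (X - {p})" using X(1) g by auto
    then have "card X \<le> card (X - {p})" by (rule X(2))
    then show False using card_Diff1_less[OF finX p(1)] by simp
  qed
  then have "indep ?\<Theta>" using X(1) f by (intro minimal_imp_indep) auto
  moreover have "spans ?\<Theta>" using X(1) f by (intro generates_imp_spans) auto
  ultimately have "int_secondaries n S G \<theta>s"
    using f \<theta>s inv by (simp add: int_secondaries_def secondaries_iff[OF S])
  then show ?thesis ..
qed

section \<open>The matrix of values\<close>

definition iv :: "int mpol \<Rightarrow> nat \<Rightarrow> int" where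
  "iv \<theta> i = eval_poly (act_poly (\<gamma>s ! i) \<theta>) z"

definition T :: "int mpol list \<Rightarrow> int mat" where
  "T \<theta>s = mat l l (\<lambda>(i, j). iv (\<theta>s ! j) i)"

text \<open>The condition on values for a list with integer coefficients, where independence is the
  non-vanishing of a determinant.\<close>

definition adapted :: "int mpol list \<Rightarrow> bool" where
  "adapted \<theta>s \<longleftrightarrow> length \<theta>s = l \<and> set \<theta>s \<subseteq> inv_ring n G \<and> (\<forall>j < l. homogeneous (dg (\<theta>s ! j)) (\<theta>s ! j)) \<and>
     det (T \<theta>s) \<noteq> 0 \<and>
     (\<forall>d. \<forall>f \<in> inv_ring n G. homogeneous d f \<longrightarrow> (\<exists>c :: nat \<Rightarrow> rat.
        (\<forall>j < l. c j \<noteq> 0 \<longrightarrow> dg (\<theta>s ! j) \<le> d) \<and> (\<forall>i < l. rv f i = (\<Sum>j < l. c j * of_int (iv (\<theta>s ! j) i)))))"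

lemma rv_of_int_poly: "i < l \<Longrightarrow> rv (of_int_poly \<theta>) i = of_int (iv \<theta> i)"
  by (simp add: rv_def iv_def act_poly_of_int_poly[OF rep_bij] eval_of_int_poly)

lemma det_T_kernel:
  "det (T \<theta>s) \<noteq> 0 \<longleftrightarrow> (\<forall>c :: nat \<Rightarrow> rat. (\<forall>i < l. (\<Sum>j < l. c j * of_int (iv (\<theta>s ! j) i)) = 0) \<longrightarrow> (\<forall>j < l. c j = 0))"
proof -
  let ?A = "map_mat (of_int :: int \<Rightarrow> rat) (T \<theta>s)"
  have A: "?A \<in> carrier_mat l l" by (simp add: T_def)
  have mv: "?A *\<^sub>v v = 0\<^sub>v l \<longleftrightarrow> (\<forall>i < l. (\<Sum>j < l. v $ j * of_int (iv (\<theta>s ! j) i)) = 0)"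
    if "v \<in> carrier_vec l" for v
  proof -
    have "(?A *\<^sub>v v) $ i = (\<Sum>j < l. v $ j * of_int (iv (\<theta>s ! j) i))" if "i < l" for i
      using that \<open>v \<in> carrier_vec l\<close>
      by (simp add: T_def scalar_prod_def atLeast0LessThan mult.commute)
    then show ?thesis using that A by (auto simp: vec_eq_iff)
  qed
  have "det (T \<theta>s) \<noteq> 0 \<longleftrightarrow> det ?A \<noteq> 0" by simp
  also have "\<dots> \<longleftrightarrow> (\<forall>v \<in> carrier_vec l. ?A *\<^sub>v v = 0\<^sub>v l \<longrightarrow> v = 0\<^sub>v l)"
    unfolding det_0_iff_vec_prod_zero[OF A] by blast
  also have "\<dots> \<longleftrightarrow> (\<forall>c :: nat \<Rightarrow> rat. (\<forall>i < l. (\<Sum>j < l. c j * of_int (iv (\<theta>s ! j) i)) = 0) \<longrightarrow> (\<forall>j < l. c j = 0))"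
  proof (intro iffI allI impI ballI)
    fix c :: "nat \<Rightarrow> rat" and j
    assume h: "\<forall>v \<in> carrier_vec l. ?A *\<^sub>v v = 0\<^sub>v l \<longrightarrow> v = 0\<^sub>v l"
      and c: "\<forall>i < l. (\<Sum>j < l. c j * of_int (iv (\<theta>s ! j) i)) = 0" and j: "j < l"
    have "vec l c = 0\<^sub>v l" using h c mv[of "vec l c"] by simp
    then have "vec l c $ j = 0\<^sub>v l $ j" by simp
    then show "c j = 0" using j by simp
  next
    fix v :: "rat vec"
    assume h: "\<forall>c :: nat \<Rightarrow> rat. (\<forall>i < l. (\<Sum>j < l. c j * of_int (iv (\<theta>s ! j) i)) = 0) \<longrightarrow> (\<forall>j < l. c j = 0)"
      and v: "v \<in> carrier_vec l" "?A *\<^sub>v v = 0\<^sub>v l"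
    have "\<forall>j < l. v $ j = 0" using h mv[OF v(1)] v(2) by blast
    then show "v = 0\<^sub>v l" using v(1) by (auto simp: vec_eq_iff)
  qed
  finally show ?thesis .
qed

lemma bij_betw_of_int_poly_nth:
  assumes "distinct \<theta>s" "length \<theta>s = k"
  shows "bij_betw (\<lambda>j. of_int_poly (\<theta>s ! j) :: rat mpol) {..<k} (of_int_poly ` set \<theta>s)"
proof -
  have "bij_betw (\<lambda>j. \<theta>s ! j) {..<k} (set \<theta>s)"
    using bij_betw_nth[OF assms(1) _ refl, of "{..<k}"] assms(2) by simp
  moreover have "bij_betw (of_int_poly :: int mpol \<Rightarrow> rat mpol) (set \<theta>s) (of_int_poly ` set \<theta>s)"
    by (auto simp: bij_betw_def inj_on_def of_int_poly_inj)
  ultimately have "bij_betw (of_int_poly \<circ> (\<lambda>j. \<theta>s ! j) :: nat \<Rightarrow> rat mpol) {..<k} (of_int_poly ` set \<theta>s)"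
    by (rule bij_betw_trans)
  then show ?thesis by (simp only: o_def)
qed

lemma int_secondaries_iff:
  assumes S: "carrier S = Sig"
  shows "int_secondaries n S G \<theta>s \<longleftrightarrow> adapted \<theta>s"
proof
  assume s: "int_secondaries n S G \<theta>s"
  let ?h = "of_int_poly :: int mpol \<Rightarrow> rat mpol"
  let ?\<Theta> = "?h ` set \<theta>s"
  have \<Theta>: "forms ?\<Theta>" "indep ?\<Theta>" "spans ?\<Theta>" and d: "distinct \<theta>s" and i: "set \<theta>s \<subseteq> inv_ring n G"
    using s by (simp_all add: int_secondaries_def secondaries_iff[OF S])
  have inj: "inj_on ?h A" for A by (rule inj_onI) (simp add: of_int_poly_inj)
  have len: "length \<theta>s = l"
    using card_forms(1)[OF \<Theta>] by (simp add: card_image[OF inj] distinct_card[OF d])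
  have hom: "homogeneous (dg (\<theta>s ! j)) (\<theta>s ! j)" if "j < l" for j
  proof -
    have "?h (\<theta>s ! j) \<in> ?\<Theta>" using that len by simp
    then obtain e where "homogeneous e (?h (\<theta>s ! j))" using \<Theta>(1) unfolding forms_def by blast
    then show ?thesis using homogeneous_dg homogeneous_of_int_poly_iff by blast
  qed
  have bij: "bij_betw (\<lambda>j. ?h (\<theta>s ! j)) {..<l} ?\<Theta>" by (rule bij_betw_of_int_poly_nth[OF d len])
  have det: "det (T \<theta>s) \<noteq> 0"
    unfolding det_T_kernel
  proof (intro allI impI)
    fix c :: "nat \<Rightarrow> rat" and j
    assume c: "\<forall>i < l. (\<Sum>j < l. c j * of_int (iv (\<theta>s ! j) i)) = 0" and j: "j < l"
    let ?k = "the_inv_into {..<l} (\<lambda>j. ?h (\<theta>s ! j))"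
    have k: "?k (?h (\<theta>s ! j)) = j" if "j < l" for j
      using the_inv_into_f_f[OF bij_betw_imp_inj_on[OF bij]] that by simp
    have "c (?k (?h (\<theta>s ! j))) = 0"
    proof (rule indepD[OF \<Theta>(2), of ?\<Theta> "\<lambda>t. c (?k t)"])
      fix i assume i: "i < l"
      have "(\<Sum>t \<in> ?\<Theta>. c (?k t) * rv t i) = (\<Sum>j < l. c (?k (?h (\<theta>s ! j))) * rv (?h (\<theta>s ! j)) i)"
        by (rule sum.reindex_bij_betw[OF bij, symmetric])
      also have "\<dots> = (\<Sum>j < l. c j * of_int (iv (\<theta>s ! j) i))"
        using i k by (intro sum.cong refl) (simp add: rv_of_int_poly)
      finally show "(\<Sum>t \<in> ?\<Theta>. c (?k t) * rv t i) = 0" using c i by simp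
    qed (use j len in auto)
    then show "c j = 0" using k[OF j] by simp
  qed
  have sp: "\<exists>c :: nat \<Rightarrow> rat. (\<forall>j < l. c j \<noteq> 0 \<longrightarrow> dg (\<theta>s ! j) \<le> d) \<and> (\<forall>i < l. rv f i = (\<Sum>j < l. c j * of_int (iv (\<theta>s ! j) i)))"
    if f: "f \<in> inv_ring n G" "homogeneous d f" for f d
  proof -
    obtain F q where F: "finite F" "F \<subseteq> ?\<Theta>" "\<forall>\<theta> \<in> F. dg \<theta> \<le> d" "\<forall>i < l. rv f i = (\<Sum>\<theta> \<in> F. q \<theta> * rv \<theta> i)"
      using \<Theta>(3)[unfolded spans_def, rule_format, OF f] by blast
    let ?q = "\<lambda>t. if t \<in> F then q t else 0"
    have "rv f i = (\<Sum>j < l. ?q (?h (\<theta>s ! j)) * of_int (iv (\<theta>s ! j) i))" if i: "i < l" for i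
    proof -
      have "rv f i = (\<Sum>\<theta> \<in> F. q \<theta> * rv \<theta> i)" using F(4) i by blast
      also have "\<dots> = (\<Sum>\<theta> \<in> ?\<Theta>. ?q \<theta> * rv \<theta> i)"
        using F(2) by (intro sum.mono_neutral_cong_left) auto
      also have "\<dots> = (\<Sum>j < l. ?q (?h (\<theta>s ! j)) * rv (?h (\<theta>s ! j)) i)"
        by (rule sum.reindex_bij_betw[OF bij, symmetric])
      finally show ?thesis using i by (simp add: rv_of_int_poly)
    qed
    moreover have "dg (\<theta>s ! j) \<le> d" if "j < l" "?q (?h (\<theta>s ! j)) \<noteq> 0" for j
      using that F(3) dg_of_int_poly[OF hom[OF that(1)]] by (auto split: if_splits)
    ultimately show ?thesis by (intro exI[of _ "\<lambda>j. ?q (?h (\<theta>s ! j))"]) blast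
  qed
  show "adapted \<theta>s" unfolding adapted_def using len i hom det sp by blast
next
  assume a: "adapted \<theta>s"
  let ?h = "of_int_poly :: int mpol \<Rightarrow> rat mpol"
  let ?\<Theta> = "?h ` set \<theta>s"
  note a = a[unfolded adapted_def]
  have len: "length \<theta>s = l" and i: "set \<theta>s \<subseteq> inv_ring n G" and hom: "\<And>j. j < l \<Longrightarrow> homogeneous (dg (\<theta>s ! j)) (\<theta>s ! j)"
    and det: "det (T \<theta>s) \<noteq> 0" using a by blast+
  have ker: "c j = 0" if "\<And>i. i < l \<Longrightarrow> (\<Sum>j < l. c j * of_int (iv (\<theta>s ! j) i)) = 0" "j < l" for c :: "nat \<Rightarrow> rat" and j
    using det[unfolded det_T_kernel] that by blast
  have d: "distinct \<theta>s"
    unfolding distinct_conv_nth len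
  proof (intro allI impI notI)
    fix j k assume jk: "j < l" "k < l" "j \<noteq> k" "\<theta>s ! j = \<theta>s ! k"
    let ?c = "\<lambda>m. if m = j then 1 else if m = k then - 1 else 0 :: rat"
    have "?c j = 0"
    proof (rule ker[of ?c, OF _ jk(1)])
      fix i assume "i < l"
      have "(\<Sum>m < l. ?c m * of_int (iv (\<theta>s ! m) i)) = (\<Sum>m \<in> {j, k}. ?c m * of_int (iv (\<theta>s ! m) i))"
        using jk by (intro sum.mono_neutral_right) auto
      then show "(\<Sum>m < l. ?c m * of_int (iv (\<theta>s ! m) i)) = 0" using jk by simp
    qed
    then show False by simp
  qed
  have bij: "bij_betw (\<lambda>j. ?h (\<theta>s ! j)) {..<l} ?\<Theta>" by (rule bij_betw_of_int_poly_nth[OF d len])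
  have f: "forms ?\<Theta>"
    unfolding forms_def using i hom len
    by (auto simp: in_set_conv_nth intro!: G.inv_ring_of_int_poly) (metis homogeneous_of_int_poly)
  moreover have "indep ?\<Theta>"
    unfolding indep_def
  proof (intro allI impI ballI)
    fix F q t
    assume F: "finite F" "F \<subseteq> ?\<Theta>" "\<forall>i < l. (\<Sum>\<theta> \<in> F. q \<theta> * rv \<theta> i) = 0" and t: "t \<in> F"
    obtain p where "p \<in> set \<theta>s" "t = ?h p" using t F(2) by blast
    then obtain j where j: "j < l" "t = ?h (\<theta>s ! j)" using len by (auto simp: in_set_conv_nth)
    let ?q = "\<lambda>t. if t \<in> F then q t else 0"
    have "?q (?h (\<theta>s ! j)) = 0"
    proof (rule ker[of "\<lambda>j. ?q (?h (\<theta>s ! j))", OF _ j(1)])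
      fix i assume i: "i < l"
      have "(\<Sum>j < l. ?q (?h (\<theta>s ! j)) * rv (?h (\<theta>s ! j)) i) = (\<Sum>\<theta> \<in> ?\<Theta>. ?q \<theta> * rv \<theta> i)"
        by (rule sum.reindex_bij_betw[OF bij])
      also have "\<dots> = (\<Sum>\<theta> \<in> F. q \<theta> * rv \<theta> i)"
        using F(2) by (intro sum.mono_neutral_cong_right) auto
      finally show "(\<Sum>j < l. ?q (?h (\<theta>s ! j)) * of_int (iv (\<theta>s ! j) i)) = 0"
        using F(3) i by (simp add: rv_of_int_poly)
    qed
    then show "q t = 0" using j(2) t by simp
  qed
  moreover have "spans ?\<Theta>"
    unfolding spans_def
  proof (intro allI ballI impI)
    fix d and f :: "rat mpol" assume f: "f \<in> inv_ring n G" "homogeneous d f"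
    obtain c :: "nat \<Rightarrow> rat" where c: "\<And>j. j < l \<Longrightarrow> c j \<noteq> 0 \<Longrightarrow> dg (\<theta>s ! j) \<le> d"
      "\<And>i. i < l \<Longrightarrow> rv f i = (\<Sum>j < l. c j * of_int (iv (\<theta>s ! j) i))" using a f by blast
    let ?k = "the_inv_into {..<l} (\<lambda>j. ?h (\<theta>s ! j))"
    have k: "?k (?h (\<theta>s ! j)) = j" if "j < l" for j
      using the_inv_into_f_f[OF bij_betw_imp_inj_on[OF bij]] that by simp
    let ?J = "{j \<in> {..<l}. c j \<noteq> 0}"
    let ?F = "(\<lambda>j. ?h (\<theta>s ! j)) ` ?J"
    have injJ: "inj_on (\<lambda>j. ?h (\<theta>s ! j)) ?J"
      using bij_betw_imp_inj_on[OF bij] by (rule inj_on_subset) auto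
    have "rv f i = (\<Sum>t \<in> ?F. c (?k t) * rv t i)" if i: "i < l" for i
    proof -
      have "(\<Sum>t \<in> ?F. c (?k t) * rv t i) = (\<Sum>j \<in> ?J. c (?k (?h (\<theta>s ! j))) * rv (?h (\<theta>s ! j)) i)"
        by (rule sum.reindex_cong[OF injJ refl refl])
      also have "\<dots> = (\<Sum>j \<in> ?J. c j * of_int (iv (\<theta>s ! j) i))"
        using i k by (intro sum.cong refl) (simp add: rv_of_int_poly)
      also have "\<dots> = (\<Sum>j < l. c j * of_int (iv (\<theta>s ! j) i))"
        by (intro sum.mono_neutral_left) auto
      finally show ?thesis using c(2)[OF i] by simp
    qed
    moreover have "dg t \<le> d" if "t \<in> ?F" for t
      using that c(1) dg_of_int_poly[OF hom] by auto
    moreover have "?F \<subseteq> ?\<Theta>" using len by auto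
    ultimately show "\<exists>F q. finite F \<and> F \<subseteq> ?\<Theta> \<and> (\<forall>\<theta> \<in> F. dg \<theta> \<le> d) \<and> (\<forall>i < l. rv f i = (\<Sum>\<theta> \<in> F. q \<theta> * rv \<theta> i))"
      by (intro exI[of _ ?F] exI[of _ "\<lambda>t. c (?k t)"]) simp
  qed
  ultimately show "int_secondaries n S G \<theta>s"
    using d i by (simp add: int_secondaries_def secondaries_iff[OF S])
qed

end

section \<open>The determinant of a matrix of secondaries\<close>

text \<open>Row operations that subtract multiples of rows outside \<open>R\<close> make each row in \<open>R\<close> divisible by \<open>L\<close>.\<close>

lemma det_dvd_rows:
  fixes A :: "'a::idom mat"
  assumes "finite R" "R \<subseteq> {..<l}" "A \<in> carrier_mat l l"
    and "\<And>i. i \<in> R \<Longrightarrow> (\<forall>k < l. L dvd A $$ (i, k)) \<or> (\<exists>i' c. i' < l \<and> i' \<notin> R \<and> (\<forall>k < l. L dvd A $$ (i, k) - c * A $$ (i', k)))"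
  shows "L ^ card R dvd det A"
  using assms
proof (induction R arbitrary: A rule: finite_induct)
  case (insert i R)
  note A = insert.prems(2)
  have i: "i < l" using insert.prems(1) by auto
  have "\<exists>A'. A' \<in> carrier_mat l l \<and> det A' = det A \<and> (\<forall>k < l. L dvd A' $$ (i, k)) \<and>
      (\<forall>r < l. \<forall>k < l. r \<noteq> i \<longrightarrow> A' $$ (r, k) = A $$ (r, k))"
    using insert.prems(3)[OF insertI1]
  proof
    assume "\<exists>i' c. i' < l \<and> i' \<notin> insert i R \<and> (\<forall>k < l. L dvd A $$ (i, k) - c * A $$ (i', k))"
    then obtain i' c where i': "i' < l" "i' \<noteq> i" "\<forall>k < l. L dvd A $$ (i, k) - c * A $$ (i', k)" by blast
    have "det (addrow (- c) i i' A) = det A" using i'(2) by (intro det_addrow[OF i'(1) _ A]) simp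
    then show ?thesis using A i i' by (intro exI[of _ "addrow (- c) i i' A"]) (auto simp: algebra_simps)
  qed (use A in blast)
  then obtain A' where A': "A' \<in> carrier_mat l l" "det A' = det A" "\<And>k. k < l \<Longrightarrow> L dvd A' $$ (i, k)"
    "\<And>r k. r < l \<Longrightarrow> k < l \<Longrightarrow> r \<noteq> i \<Longrightarrow> A' $$ (r, k) = A $$ (r, k)" by blast
  define q where "q k = (SOME x. A' $$ (i, k) = L * x)" for k
  have q: "A' $$ (i, k) = L * q k" if "k < l" for k
    unfolding q_def using A'(3)[OF that] by (auto simp: dvd_def intro: someI)
  define B where "B = mat l l (\<lambda>(r, k). if r = i then q k else A $$ (r, k))"
  have B: "B \<in> carrier_mat l l" by (simp add: B_def)
  have "A' = multrow i L B"
    by (rule eq_matI) (use A' B i q in \<open>auto simp: B_def\<close>)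
  then have dA: "det A = L * det B" using det_multrow[OF i B, of L] A'(2) by simp
  have "L ^ card R dvd det B"
  proof (rule insert.IH[OF _ B])
    show "R \<subseteq> {..<l}" using insert.prems(1) by blast
    fix k assume k: "k \<in> R"
    then have kl: "k < l" "k \<noteq> i" using insert.prems(1) insert.hyps(2) by auto
    show "(\<forall>m < l. L dvd B $$ (k, m)) \<or> (\<exists>k' c. k' < l \<and> k' \<notin> R \<and> (\<forall>m < l. L dvd B $$ (k, m) - c * B $$ (k', m)))"
      using insert.prems(3)[OF insertI2[OF k]]
    proof
      assume "\<exists>k' c. k' < l \<and> k' \<notin> insert i R \<and> (\<forall>m < l. L dvd A $$ (k, m) - c * A $$ (k', m))"
      then obtain k' c where "k' < l" "k' \<notin> insert i R" "\<forall>m < l. L dvd A $$ (k, m) - c * A $$ (k', m)" by blast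
      then have "k' < l \<and> k' \<notin> R \<and> (\<forall>m < l. L dvd B $$ (k, m) - c * B $$ (k', m))"
        using kl by (simp add: B_def)
      then show ?thesis by blast
    qed (use kl in \<open>simp add: B_def\<close>)
  qed
  then show ?case
    unfolding dA card.insert[OF insert.hyps] power_Suc by (rule mult_dvd_mono[OF dvd_refl])
qed simp

lemma idom_mat_inj:
  fixes A :: "nat \<Rightarrow> nat \<Rightarrow> 'a::idom"
  assumes "det (mat l l (\<lambda>(i, j). A i j)) \<noteq> 0" "\<And>i. i < l \<Longrightarrow> (\<Sum>j < l. A i j * x j) = 0" "j < l"
  shows "x j = 0"
proof (rule ccontr)
  assume "x j \<noteq> 0"
  let ?A = "mat l l (\<lambda>(i, j). A i j)"
  have "?A *\<^sub>v vec l x = 0\<^sub>v l"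
  proof (rule eq_vecI)
    fix i assume "i < dim_vec (0\<^sub>v l :: 'a vec)"
    then show "(?A *\<^sub>v vec l x) $ i = 0\<^sub>v l $ i"
      using assms(2)[of i] by (simp add: scalar_prod_def atLeast0LessThan)
  qed simp
  moreover have "vec l x \<noteq> 0\<^sub>v l"
  proof
    assume "vec l x = 0\<^sub>v l"
    then have "vec l x $ j = 0\<^sub>v l $ j" by simp
    then show False using \<open>x j \<noteq> 0\<close> assms(3) by simp
  qed
  moreover have "?A \<in> carrier_mat l l" by simp
  ultimately have "det ?A = 0" using det_0_iff_vec_prod_zero[of ?A l] by (metis vec_carrier)
  with assms(1) show False by simp
qed

context setting
begin

definition coset_perm :: "(nat \<Rightarrow> nat) \<Rightarrow> nat \<Rightarrow> nat" where
  "coset_perm g i = (THE i'. i' < l \<and> (\<exists>h \<in> G. g \<circ> \<gamma>s ! i = \<gamma>s ! i' \<circ> h))"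

definition moved :: "nat \<Rightarrow> nat \<Rightarrow> nat set" where
  "moved a b = {i. i < l \<and> i < coset_perm (transpose a b) i}"

definition DG :: "'a::comm_ring_1 mpol" where
  "DG = (\<Prod>(a, b) \<in> P. (var a - var b) ^ card (moved a b))"

lemma coset_perm_unique:
  assumes "i < l" "i' < l" "h \<in> G" "g \<circ> \<gamma>s ! i = \<gamma>s ! i' \<circ> h" "g \<in> Sig"
  shows "coset_perm g i = i'"
  unfolding coset_perm_def
proof (rule the_equality)
  show "i' < l \<and> (\<exists>h \<in> G. g \<circ> \<gamma>s ! i = \<gamma>s ! i' \<circ> h)" using assms by blast
  fix k assume "k < l \<and> (\<exists>h \<in> G. g \<circ> \<gamma>s ! i = \<gamma>s ! k \<circ> h)"
  then obtain h' where k: "k < l" "h' \<in> G" "g \<circ> \<gamma>s ! i = \<gamma>s ! k \<circ> h'" by blast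
  have "\<gamma>s ! k \<circ> (h' \<circ> Hilbert_Choice.inv h) = (\<gamma>s ! i' \<circ> h) \<circ> Hilbert_Choice.inv h"
    using k(3) assms(4) by (simp only: o_assoc)
  also have "\<dots> = \<gamma>s ! i'" unfolding comp_assoc G.inv_comp(2)[OF assms(3)] comp_id ..
  finally show "k = i'"
    using cosets_unique[OF assms(2) k(1) G.comp_in[OF k(2) G.inv_in[OF assms(3)]]] by blast
qed

lemma coset_perm:
  assumes "g \<in> Sig" "i < l"
  shows "coset_perm g i < l" "\<exists>h \<in> G. g \<circ> \<gamma>s ! i = \<gamma>s ! (coset_perm g i) \<circ> h"
proof -
  obtain i' h where i': "i' < l" "h \<in> G" "g \<circ> \<gamma>s ! i = \<gamma>s ! i' \<circ> h"
    using cosets[OF comp_in[OF assms(1) rep_in[OF assms(2)]]] by blast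
  have "coset_perm g i = i'" by (rule coset_perm_unique[OF assms(2) i' assms(1)])
  then show "coset_perm g i < l" "\<exists>h \<in> G. g \<circ> \<gamma>s ! i = \<gamma>s ! (coset_perm g i) \<circ> h" using i' by blast+
qed

lemma act_coset_perm:
  assumes g: "g \<in> Sig" and i: "i < l" and f: "f \<in> inv_ring n G"
  shows "act_poly g (act_poly (\<gamma>s ! i) f) = act_poly (\<gamma>s ! (coset_perm g i)) f"
proof -
  obtain h where h: "h \<in> G" "g \<circ> \<gamma>s ! i = \<gamma>s ! (coset_perm g i) \<circ> h" using coset_perm(2)[OF g i] by blast
  have "act_poly g (act_poly (\<gamma>s ! i) f) = act_poly (\<gamma>s ! (coset_perm g i) \<circ> h) f"
    unfolding act_comp[OF g rep_in[OF i]] h(2) ..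
  also have "\<dots> = act_poly (\<gamma>s ! (coset_perm g i)) (act_poly h f)"
    by (rule act_comp[OF rep_in[OF coset_perm(1)[OF g i]] G_in[OF h(1)], symmetric])
  finally show ?thesis unfolding G.inv_ring_act[OF f h(1)] .
qed

lemma coset_perm_invol:
  assumes g: "g \<in> Sig" "g \<circ> g = id" and i: "i < l"
  shows "coset_perm g (coset_perm g i) = i"
proof -
  obtain h where h: "h \<in> G" "g \<circ> \<gamma>s ! i = \<gamma>s ! (coset_perm g i) \<circ> h" using coset_perm(2)[OF g(1) i] by blast
  have "g \<circ> \<gamma>s ! (coset_perm g i) = g \<circ> ((\<gamma>s ! (coset_perm g i) \<circ> h) \<circ> Hilbert_Choice.inv h)"
    unfolding comp_assoc G.inv_comp(2)[OF h(1)] comp_id ..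
  also have "\<dots> = g \<circ> g \<circ> \<gamma>s ! i \<circ> Hilbert_Choice.inv h" unfolding h(2)[symmetric] by (simp only: o_assoc)
  also have "\<dots> = \<gamma>s ! i \<circ> Hilbert_Choice.inv h" unfolding g(2) id_comp ..
  finally show ?thesis
    by (rule coset_perm_unique[OF coset_perm(1)[OF g(1) i] i G.inv_in[OF h(1)] _ g(1)])
qed

lemma P_transpose: "(a, b) \<in> P \<Longrightarrow> transpose a b \<in> Sig"
  by (simp add: P_def)

lemma transpose_invol: "transpose a b \<circ> transpose a b = id"
  by (simp add: fun_eq_iff)

lemma moved_complement:
  assumes "(a, b) \<in> P"
  shows "card (moved a b) + card {i. i < l \<and> i \<le> coset_perm (transpose a b) i} = l"
proof -
  let ?p = "coset_perm (transpose a b)"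
  note t = P_transpose[OF assms] transpose_invol[of a b]
  have inv: "?p (?p i) = i" "?p i < l" if "i < l" for i
    using coset_perm_invol[OF t that] coset_perm(1)[OF t(1) that] by auto
  have "bij_betw ?p (moved a b) {i. i < l \<and> ?p i < i}"
    by (rule bij_betw_byWitness[where f' = ?p]) (auto simp: moved_def inv)
  then have "card (moved a b) = card {i. i < l \<and> ?p i < i}" by (rule bij_betw_same_card)
  moreover have "card ({i. i < l \<and> ?p i < i} \<union> {i. i < l \<and> i \<le> ?p i}) =
      card {i. i < l \<and> ?p i < i} + card {i. i < l \<and> i \<le> ?p i}"
    by (intro card_Un_disjoint) auto
  moreover have "{i. i < l \<and> ?p i < i} \<union> {i. i < l \<and> i \<le> ?p i} = {..<l}" by auto
  ultimately show ?thesis by simp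
qed

text \<open>Modulo \<open>x\<^sub>a - x\<^sub>b\<close> the rows of two cosets exchanged by the transposition agree, so each orbit of
  size two contributes one factor.\<close>

lemma DG_dvd_det:
  assumes inv: "set \<theta>s \<subseteq> inv_ring n G" and len: "length \<theta>s = l"
  shows "DG dvd det (sec_matrix \<gamma>s \<theta>s)"
  unfolding DG_def
proof (rule prod_diff_dvd[OF finite_P P_less])
  fix a b assume ab: "(a, b) \<in> P"
  let ?p = "coset_perm (transpose a b)"
  note t = P_transpose[OF ab] transpose_invol[of a b]
  show "(var a - var b) ^ card (moved a b) dvd det (sec_matrix \<gamma>s \<theta>s)"
  proof (rule det_dvd_rows[where l = l])
    show "finite (moved a b)" "moved a b \<subseteq> {..<l}" by (auto simp: moved_def)
    show "sec_matrix \<gamma>s \<theta>s \<in> carrier_mat l l" by (simp add: sec_matrix_def len)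
    fix i assume i: "i \<in> moved a b"
    then have il: "i < l" "i < ?p i" by (auto simp: moved_def)
    have p: "?p i < l" "?p (?p i) = i" using coset_perm(1)[OF t(1) il(1)] coset_perm_invol[OF t il(1)] .
    have "var a - var b dvd sec_matrix \<gamma>s \<theta>s $$ (i, k) - 1 * sec_matrix \<gamma>s \<theta>s $$ (?p i, k)" if k: "k < l" for k
    proof -
      have th: "\<theta>s ! k \<in> inv_ring n G" using inv k len by auto
      have "ident a b (act_poly (\<gamma>s ! (?p i)) (\<theta>s ! k)) = ident a b (act_poly (\<gamma>s ! i) (\<theta>s ! k))"
        unfolding act_coset_perm[OF t(1) il(1) th, symmetric] ident_act_transpose ..
      then show ?thesis
        using k il(1) p(1) len unfolding dvd_iff_ident by (simp add: sec_matrix_def ident.hom_minus)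
    qed
    moreover have "?p i \<notin> moved a b" using il p by (auto simp: moved_def)
    ultimately show "(\<forall>k < l. var a - var b dvd sec_matrix \<gamma>s \<theta>s $$ (i, k)) \<or> (\<exists>i' c. i' < l \<and> i' \<notin> moved a b \<and>
        (\<forall>k < l. var a - var b dvd sec_matrix \<gamma>s \<theta>s $$ (i, k) - c * sec_matrix \<gamma>s \<theta>s $$ (i', k)))"
      using p(1) by blast
  qed
qed

lemma of_int_poly_DG: "of_int_poly DG = (DG :: rat mpol)"
  by (simp add: DG_def oi.hom_prod oi.hom_power oi.hom_minus case_prod_beta)

text \<open>The companion matrix \<open>Y\<close> inverts the matrix of secondaries up to the factor \<open>\<Delta>\<close>, and its
  rows transform by the sign-twisted permutation. Its determinant therefore absorbs the
  complementary power of every linear form.\<close>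

lemma companion:
  assumes S: "carrier S = Sig" and s: "int_secondaries n S G \<theta>s"
  obtains y where "\<And>i i'. i < l \<Longrightarrow> i' < l \<Longrightarrow>
    (\<Sum>j < l. act_poly (\<gamma>s ! i') (of_int_poly (\<theta>s ! j)) * y i j) = (if i' = i then Delta else 0)"
proof -
  let ?h = "of_int_poly :: int mpol \<Rightarrow> rat mpol"
  let ?\<Theta> = "?h ` set \<theta>s"
  have \<Theta>: "forms ?\<Theta>" "indep ?\<Theta>" "spans ?\<Theta>" and d: "distinct \<theta>s"
    using s by (simp_all add: int_secondaries_def secondaries_iff[OF S])
  have len: "length \<theta>s = l" using s by (simp add: int_secondaries_iff[OF S] adapted_def)
  note bij = bij_betw_of_int_poly_nth[OF d len]
  have "\<exists>c. (\<forall>j. c j \<in> inv_ring n Sig) \<and> GS X = (\<Sum>j < l. c j * ?h (\<theta>s ! j))" if X: "X \<in> Pow P" for X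
  proof -
    have "GS X \<in> mspan ?\<Theta>" using spans_imp_generates[OF \<Theta>(1,3)] GS_inv X by blast
    then obtain F c where F: "F \<subseteq> ?\<Theta>" "\<And>t. t \<in> F \<Longrightarrow> c t \<in> inv_ring n Sig" "GS X = (\<Sum>t \<in> F. c t * t)"
      unfolding mspan_def by blast
    let ?c = "\<lambda>t. if t \<in> F then c t else 0"
    have "GS X = (\<Sum>t \<in> ?\<Theta>. ?c t * t)"
      unfolding F(3) using F(1) by (intro sum.mono_neutral_cong_left) auto
    also have "\<dots> = (\<Sum>j < l. ?c (?h (\<theta>s ! j)) * ?h (\<theta>s ! j))"
      by (rule sum.reindex_bij_betw[OF bij, symmetric])
    finally show ?thesis using F(2) by (intro exI[of _ "\<lambda>j. ?c (?h (\<theta>s ! j))"]) (simp add: inv_ring_0)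
  qed
  then obtain c where c: "\<And>X j. X \<in> Pow P \<Longrightarrow> c X j \<in> inv_ring n Sig"
    "\<And>X. X \<in> Pow P \<Longrightarrow> GS X = (\<Sum>j < l. c X j * ?h (\<theta>s ! j))" by metis
  define y where "y i j = Const (sgn_Sig (\<gamma>s ! i)) * (\<Sum>X \<in> Pow P. c X j * act_poly (\<gamma>s ! i) (aS X))" for i j
  show thesis
  proof (rule that[of y])
    fix i i' assume i: "i < l" "i' < l"
    note g = rep_in[OF i(2)]
    have "act_poly (\<gamma>s ! i') (GS X) = (\<Sum>j < l. c X j * act_poly (\<gamma>s ! i') (?h (\<theta>s ! j)))" if X: "X \<in> Pow P" for X
      unfolding c(2)[OF X] act_distribs(7)[OF g] act_distribs(3)[OF g]
      by (intro sum.cong refl) (simp add: inv_ring_act[OF c(1)[OF X] g])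
    then have "(\<Sum>X \<in> Pow P. act_poly (\<gamma>s ! i) (aS X) * act_poly (\<gamma>s ! i') (GS X)) =
        (\<Sum>X \<in> Pow P. \<Sum>j < l. act_poly (\<gamma>s ! i') (?h (\<theta>s ! j)) * (c X j * act_poly (\<gamma>s ! i) (aS X)))"
      by (simp add: sum_distrib_left ac_simps)
    also have "\<dots> = (\<Sum>j < l. act_poly (\<gamma>s ! i') (?h (\<theta>s ! j)) * (\<Sum>X \<in> Pow P. c X j * act_poly (\<gamma>s ! i) (aS X)))"
      by (subst sum.swap) (simp add: sum_distrib_left)
    finally have "(\<Sum>j < l. act_poly (\<gamma>s ! i') (?h (\<theta>s ! j)) * y i j) =
        Const (sgn_Sig (\<gamma>s ! i)) * (\<Sum>X \<in> Pow P. act_poly (\<gamma>s ! i) (aS X) * act_poly (\<gamma>s ! i') (GS X))"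
      by (simp only: y_def sum_distrib_left mult.left_commute)
    also have "\<dots> = (if i' = i then Delta else 0)"
      unfolding kernel_G[OF i] using sgn_Sig_square by (auto simp flip: mult.assoc Const.hom_mult)
    finally show "(\<Sum>j < l. act_poly (\<gamma>s ! i') (?h (\<theta>s ! j)) * y i j) = (if i' = i then Delta else 0)" .
  qed
qed

end

context setting
begin

text \<open>The determinants of \<open>M\<close> and of its companion \<open>Y\<close> are divisible by complementary factors of the
  power \<open>Delta ^ l\<close>, which is the product of the two determinants; the quotients multiply to a
  non-zero constant and are therefore constants.\<close>

lemma det_sec_matrix:
  assumes S: "carrier S = Sig" and s: "int_secondaries n S G \<theta>s"
  obtains c where "det (sec_matrix \<gamma>s \<theta>s) = Const c * DG"
proof -
  have a: "length \<theta>s = l" "set \<theta>s \<subseteq> inv_ring n G"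
    using s by (simp_all add: int_secondaries_iff[OF S] adapted_def)
  let ?h = "of_int_poly :: int mpol \<Rightarrow> rat mpol"
  obtain u where u: "det (sec_matrix \<gamma>s \<theta>s) = DG * u" using DG_dvd_det[OF a(2,1)] ..
  obtain y where y: "\<And>i i'. i < l \<Longrightarrow> i' < l \<Longrightarrow>
    (\<Sum>j < l. act_poly (\<gamma>s ! i') (?h (\<theta>s ! j)) * y i j) = (if i' = i then Delta else 0)"
    by (rule companion[OF S s]) (rule that)
  define m where "m i j = act_poly (\<gamma>s ! i) (?h (\<theta>s ! j))" for i j
  let ?M = "mat l l (\<lambda>(i, j). m i j)" and ?Y = "mat l l (\<lambda>(i, j). y i j)"
  have M: "?M = map_mat ?h (sec_matrix \<gamma>s \<theta>s)"
    by (rule eq_matI) (simp_all add: m_def sec_matrix_def a act_poly_of_int_poly rep_bij)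
  have detM: "det ?M = DG * ?h u"
    unfolding M oi.hom_det u oi.hom_mult of_int_poly_DG ..
  have "?M * transpose_mat ?Y = Delta \<cdot>\<^sub>m 1\<^sub>m l"
    by (rule eq_matI) (simp_all add: scalar_prod_def atLeast0LessThan y m_def)
  then have "det ?M * det (transpose_mat ?Y) = Delta ^ l"
    by (subst det_mult[symmetric, of _ l]) simp_all
  then have prod: "det ?M * det ?Y = Delta ^ l"
    using det_transpose[of ?Y l] by simp
  have detM0: "det ?M \<noteq> 0" using prod Delta_neq_0 by auto
  have ym: "act_poly g (y i j) = - y (coset_perm g i) j"
    if ab: "(a, b) \<in> P" and g: "g = transpose a b" and i: "i < l" and j: "j < l" for a b g i j
  proof -
    note t = P_transpose[OF ab, folded g] transpose_invol[of a b, folded g]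
    let ?p = "coset_perm g"
    have "act_poly g (y i j) + y (?p i) j = 0"
    proof (rule idom_mat_inj[OF detM0 _ j])
      fix i'' assume i'': "i'' < l"
      define k where "k = ?p i''"
      have k: "k < l" "?p k = i''"
        unfolding k_def using coset_perm(1)[OF t(1) i''] coset_perm_invol[OF t i''] .
      have mk: "m i'' j = act_poly g (m k j)" if "j < l" for j
        unfolding m_def using act_coset_perm[OF t(1) k(1), of "?h (\<theta>s ! j)"] k(2) a that
        by (simp add: G.inv_ring_of_int_poly subset_iff)
      have "(\<Sum>j < l. m i'' j * act_poly g (y i j)) = act_poly g (\<Sum>j < l. m k j * y i j)"
        unfolding act_distribs(7)[OF t(1)] act_distribs(3)[OF t(1)] by (intro sum.cong refl) (simp add: mk)
      also have "(\<Sum>j < l. m k j * y i j) = (if k = i then Delta else 0)"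
        unfolding m_def by (rule y[OF i k(1)])
      also have "act_poly g \<dots> = - (if k = i then Delta else 0)"
      proof (cases "k = i")
        case True
        have "act_poly g Delta = Const (- 1) * Delta"
          using act_Delta[OF t(1)] sgn_Sig_transpose[OF ab, folded g] by simp
        with True show ?thesis by (simp add: Const.hom_uminus)
      next
        case False
        then show ?thesis using act_distribs(5)[OF t(1)] by simp
      qed
      finally have 1: "(\<Sum>j < l. m i'' j * act_poly g (y i j)) = - (if k = i then Delta else 0)" .
      have "(\<Sum>j < l. m i'' j * y (?p i) j) = (if i'' = ?p i then Delta else 0)"
        unfolding m_def by (rule y[OF coset_perm(1)[OF t(1) i] i''])
      moreover have "i'' = ?p i \<longleftrightarrow> k = i"
      proof
        assume "i'' = ?p i"
        then show "k = i" unfolding k_def using coset_perm_invol[OF t i] by (simp only:)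
      next
        assume "k = i"
        with k(2) show "i'' = ?p i" by (simp only:)
      qed
      ultimately show "(\<Sum>j < l. m i'' j * (act_poly g (y i j) + y (?p i) j)) = 0"
        using 1 by (simp add: distrib_left sum.distrib)
    qed
    then show ?thesis by (simp add: eq_neg_iff_add_eq_0)
  qed
  define E :: "rat mpol" where "E = (\<Prod>(a, b) \<in> P. (var a - var b) ^ (l - card (moved a b)))"
  have "E dvd det ?Y"
    unfolding E_def
  proof (rule prod_diff_dvd[OF finite_P P_less])
    fix a b assume ab: "(a, b) \<in> P"
    let ?p = "coset_perm (transpose a b)" and ?R = "{i. i < l \<and> i \<le> coset_perm (transpose a b) i}"
    note t = P_transpose[OF ab] transpose_invol[of a b]
    have "(var a - var b) ^ card ?R dvd det ?Y"
    proof (rule det_dvd_rows[where l = l])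
      show "finite ?R" "?R \<subseteq> {..<l}" "?Y \<in> carrier_mat l l" by auto
      fix i assume "i \<in> ?R"
      then have i: "i < l" "i \<le> ?p i" by auto
      have p: "?p i < l" "?p (?p i) = i" using coset_perm(1)[OF t(1) i(1)] coset_perm_invol[OF t i(1)] .
      have id: "ident a b (y i k) = - ident a b (y (?p i) k)" if "k < l" for k
        using arg_cong[OF ym[OF ab refl i(1) that], of "ident a b"]
        unfolding ident_act_transpose ident.hom_uminus .
      show "(\<forall>k < l. var a - var b dvd ?Y $$ (i, k)) \<or>
          (\<exists>i' c. i' < l \<and> i' \<notin> ?R \<and> (\<forall>k < l. var a - var b dvd ?Y $$ (i, k) - c * ?Y $$ (i', k)))"
      proof (cases "?p i = i")
        case False
        have "var a - var b dvd ?Y $$ (i, k) - (- 1) * ?Y $$ (?p i, k)" if "k < l" for k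
          unfolding dvd_iff_ident using id[OF that] that i(1) p(1) by (simp add: ident.hom_add)
        moreover have "?p i \<notin> ?R" using i(2) False p(2) by auto
        ultimately show ?thesis using p(1) by blast
      next
        case True
        have "ident a b (y i k) = 0" if "k < l" for k
        proof -
          have "ident a b (y i k) = - ident a b (y i k)" using id[OF that] unfolding True .
          then have "ident a b (y i k) + ident a b (y i k) = ident a b (y i k) + - ident a b (y i k)"
            by (rule arg_cong)
          then have "2 * ident a b (y i k) = 0" unfolding mult_2 add.right_inverse .
          then show ?thesis by simp
        qed
        then show ?thesis using i(1) by (simp add: dvd_iff_ident)
      qed
    qed
    moreover have "card ?R = l - card (moved a b)" using moved_complement[OF ab] by linarith
    ultimately show "(var a - var b) ^ (l - card (moved a b)) dvd det ?Y" by simp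
  qed
  then obtain w where w: "det ?Y = E * w" ..
  have le: "card (moved a b) \<le> l" if "(a, b) \<in> P" for a b using moved_complement[OF that] by linarith
  have "DG * E = (\<Prod>p \<in> P. (case p of (a, b) \<Rightarrow> var a - var b) ^ l)"
    unfolding DG_def E_def prod.distrib[symmetric]
    using le by (intro prod.cong refl) (auto simp flip: power_add)
  also have "\<dots> = Delta ^ l" unfolding Delta_def by (rule prod_power_distrib[symmetric])
  finally have DE: "DG * E = Delta ^ l" .
  have ne: "Delta ^ l \<noteq> 0" using Delta_neq_0 by simp
  have "(DG * E) * (?h u * w) = (DG * ?h u) * (E * w)" by (simp only: ac_simps)
  also have "\<dots> = Delta ^ l * 1" using prod unfolding detM w by simp
  finally have "Delta ^ l * (?h u * w) = Delta ^ l * 1" unfolding DE .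
  then have "?h u * w = 1" using ne unfolding mult_cancel_left by blast
  then have "?h u * w = Const 1" by (simp add: Const_simps)
  then obtain b where b: "?h u = Const b" by (rule dvd_Const_imp_Const) simp_all
  have "homogeneous 0 (?h u)" unfolding b by (rule homogeneous_Const)
  then have "homogeneous 0 u" by (simp add: homogeneous_of_int_poly_iff)
  then obtain c where "u = Const c" using homogeneous_0_Const by blast
  then show thesis using u by (intro that[of c]) (simp only: mult.commute)
qed

lemma content_DG: "content DG = 1"
  unfolding DG_def by (rule content_prod_diff[OF finite_P P_less])

text \<open>As \<open>DG\<close> is primitive, the constant factor in the determinant is the content up to sign; evaluate
  at \<open>z\<close>.\<close>

lemma det_T_mho:
  assumes S: "carrier S = Sig" and s: "int_secondaries n S G \<theta>s"
  shows "\<bar>det (T \<theta>s)\<bar> = mho \<gamma>s \<theta>s * \<bar>eval_poly DG z\<bar>"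
proof -
  obtain c where c: "det (sec_matrix \<gamma>s \<theta>s) = Const c * DG" by (rule det_sec_matrix[OF S s])
  have len: "length \<theta>s = l" using s by (simp add: int_secondaries_iff[OF S] adapted_def)
  have "T \<theta>s = map_mat (\<lambda>p. eval_poly p z) (sec_matrix \<gamma>s \<theta>s)"
    by (rule eq_matI) (simp_all add: T_def iv_def sec_matrix_def len)
  then have "det (T \<theta>s) = eval_poly (Const c * DG) z"
    unfolding c[symmetric] by (simp only: ev.hom_det)
  moreover have "mho \<gamma>s \<theta>s = \<bar>c\<bar>"
    unfolding mho_def c content_Const_mult content_DG by simp
  ultimately show ?thesis by (simp add: ev.hom_mult abs_mult)
qed

end

section \<open>Young subgroups and cosets\<close>

context setting
begin

text \<open>An orbit of size two is counted by its member with the smaller index.\<close>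

lemma refl_exponent_eq:
  assumes S: "carrier S = Sig" "mult S = (\<circ>)" "one S = id" and ab: "(a, b) \<in> P"
  shows "refl_exponent S G a b = card (moved a b)"
proof -
  let ?t = "transpose a b" let ?p = "coset_perm ?t"
  note t = P_transpose[OF ab] transpose_invol[of a b]
  have invt: "m_inv S ?t = ?t"
    unfolding m_inv_def S
  proof (rule the_equality)
    fix y assume y: "y \<in> Sig \<and> ?t \<circ> y = id \<and> y \<circ> ?t = id"
    have "y = (?t \<circ> ?t) \<circ> y" unfolding t(2) id_comp ..
    also have "\<dots> = ?t" using y by (simp only: comp_assoc comp_id)
    finally show "y = ?t" .
  qed (use t in simp)
  have gen: "generate S {?t} = {id, ?t}"
  proof
    show "generate S {?t} \<subseteq> {id, ?t}"
    proof
      fix x assume "x \<in> generate S {?t}"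
      then show "x \<in> {id, ?t}"
        by (induction rule: generate.induct) (auto simp: S invt t(2))
    qed
    show "{id, ?t} \<subseteq> generate S {?t}"
      using generate.one[of S "{?t}"] generate.incl[of ?t "{?t}" S] by (simp add: S)
  qed
  have lc: "g <#\<^bsub>S\<^esub> C = (\<lambda>h. g \<circ> h) ` C" for g C by (auto simp: l_coset_def S)
  define Q where "Q i = (\<lambda>h. \<gamma>s ! i \<circ> h) ` G" for i
  have Qh: "(\<lambda>k. \<gamma>s ! i \<circ> h \<circ> k) ` G = Q i" if "h \<in> G" for i h
  proof -
    have "(\<lambda>k. \<gamma>s ! i \<circ> h \<circ> k) ` G = (\<lambda>k. \<gamma>s ! i \<circ> k) ` (\<lambda>k. h \<circ> k) ` G"
      by (simp add: image_image comp_assoc)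
    then show ?thesis unfolding bij_betw_imp_surj_on[OF G.bij_betw_comp(1)[OF that]] Q_def .
  qed
  have lcs: "lcosets\<^bsub>S\<^esub> G = Q ` {..<l}"
  proof -
    have "(\<lambda>h. g \<circ> h) ` G \<in> Q ` {..<l}" if g: "g \<in> Sig" for g
    proof -
      obtain i h where "i < l" "h \<in> G" "g = \<gamma>s ! i \<circ> h" using cosets[OF g] by blast
      then show ?thesis using Qh[of h i] by auto
    qed
    then have "(\<Union>a\<in>Sig. {(\<lambda>h. a \<circ> h) ` G}) \<subseteq> Q ` {..<l}" by blast
    moreover have "Q i \<in> (\<Union>a\<in>Sig. {(\<lambda>h. a \<circ> h) ` G})" if "i < l" for i
      using rep_in[OF that] by (auto simp: Q_def)
    ultimately show ?thesis unfolding LCOSETS_def lc S by blast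
  qed
  have tQ: "(\<lambda>h. ?t \<circ> h) ` Q i = Q (?p i)" if i: "i < l" for i
  proof -
    obtain h where h: "h \<in> G" "?t \<circ> \<gamma>s ! i = \<gamma>s ! (?p i) \<circ> h" using coset_perm(2)[OF t(1) i] by blast
    have "(\<lambda>h. ?t \<circ> h) ` Q i = (\<lambda>k. ?t \<circ> \<gamma>s ! i \<circ> k) ` G" unfolding Q_def by (simp add: image_image comp_assoc)
    also have "\<dots> = Q (?p i)" unfolding h(2) by (rule Qh[OF h(1)])
    finally show ?thesis .
  qed
  have Qinj: "Q i = Q i' \<longleftrightarrow> i = i'" if i: "i < l" "i' < l" for i i'
  proof
    assume "Q i = Q i'"
    moreover have "\<gamma>s ! i \<in> Q i" unfolding Q_def using G.id_in by (metis comp_id imageI)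
    ultimately obtain h where "h \<in> G" "\<gamma>s ! i = \<gamma>s ! i' \<circ> h" unfolding Q_def by blast
    then show "i = i'" using rep_comp_eq_iff[OF i] by blast
  qed simp
  have p: "?p i < l" "?p (?p i) = i" if "i < l" for i
    using coset_perm(1)[OF t(1) that] coset_perm_invol[OF t that] .
  have orb: "orbit (S\<lparr>carrier := generate S {?t}\<rparr>) (\<lambda>g C. g <#\<^bsub>S\<^esub> C) (Q i) = {Q i, Q (?p i)}" if "i < l" for i
  proof -
    have "orbit (S\<lparr>carrier := generate S {?t}\<rparr>) (\<lambda>g C. g <#\<^bsub>S\<^esub> C) (Q i) = (\<lambda>g. (\<lambda>h. g \<circ> h) ` Q i) ` {id, ?t}"
      unfolding orbit_def lc Setcompr_eq_image by (simp add: gen)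
    then show ?thesis by (simp add: tQ[OF that])
  qed
  have "{X \<in> orbits (S\<lparr>carrier := generate S {?t}\<rparr>) (lcosets\<^bsub>S\<^esub> G) (\<lambda>g C. g <#\<^bsub>S\<^esub> C). card X = 2} =
      (\<lambda>i. {Q i, Q (?p i)}) ` moved a b" (is "?L = ?R")
  proof
    show "?L \<subseteq> ?R"
    proof
      fix X assume X: "X \<in> ?L"
      then obtain i where i: "i < l" "X = {Q i, Q (?p i)}" unfolding orbits_def lcs using orb by auto
      have "?p i \<noteq> i" using X i(2) by auto
      then consider "i < ?p i" | "?p i < i" by linarith
      then show "X \<in> ?R"
      proof cases
        case 1
        then show ?thesis using i by (auto simp: moved_def)
      next
        case 2
        then have "?p i \<in> moved a b" using p[OF i(1)] by (simp add: moved_def)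
        moreover have "X = {Q (?p i), Q (?p (?p i))}" using i p(2) by auto
        ultimately show ?thesis by blast
      qed
    qed
    show "?R \<subseteq> ?L"
    proof
      fix X assume "X \<in> ?R"
      then obtain i where i: "i < l" "i < ?p i" "X = {Q i, Q (?p i)}" by (auto simp: moved_def)
      have "X \<in> orbits (S\<lparr>carrier := generate S {?t}\<rparr>) (lcosets\<^bsub>S\<^esub> G) (\<lambda>g C. g <#\<^bsub>S\<^esub> C)"
        unfolding orbits_def lcs using orb[OF i(1)] i(1,3) by blast
      moreover have "card X = 2" using i Qinj[OF i(1) p(1)[OF i(1)]] by simp
      ultimately show "X \<in> ?L" by blast
    qed
  qed
  moreover have "inj_on (\<lambda>i. {Q i, Q (?p i)}) (moved a b)"
  proof (rule inj_onI)
    fix i k assume ik: "i \<in> moved a b" "k \<in> moved a b" "{Q i, Q (?p i)} = {Q k, Q (?p k)}"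
    then have l: "i < l" "k < l" "i < ?p i" "k < ?p k" by (auto simp: moved_def)
    have "i = k \<or> (i = ?p k \<and> ?p i = k)"
      using ik(3) unfolding doubleton_eq_iff Qinj[OF l(1,2)] Qinj[OF l(1) p(1)[OF l(2)]] Qinj[OF p(1)[OF l(1)] l(2)]
      by blast
    then show "i = k" using l by linarith
  qed
  ultimately show ?thesis unfolding refl_exponent_def by (simp add: card_image)
qed

lemma group_discriminant_eq:
  assumes S: "carrier S = Sig" "mult S = (\<circ>)" "one S = id"
  shows "group_discriminant n S G = DG"
proof -
  have "{(i, j). i \<in> {1..n} \<and> j \<in> {1..n} \<and> i < j \<and> transpose i j \<in> carrier S} = P" by (simp add: P_def S(1))
  then have "group_discriminant n S G = (\<Prod>(i, j) \<in> P. (var i - var j) ^ refl_exponent S G i j)"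
    unfolding group_discriminant_def by (rule arg_cong)
  also have "\<dots> = DG"
    unfolding DG_def
  proof (intro prod.cong refl, clarify)
    fix i j assume "(i, j) \<in> P"
    then show "(var i - var j) ^ refl_exponent S G i j = (var i - var j) ^ card (moved i j)"
      by (simp only: refl_exponent_eq[OF S])
  qed
  finally show ?thesis .
qed

end

lemma young_group_young: "young (sum_list ks) (carrier (young_group ks))"
proof -
  let ?Sig = "carrier (young_group ks)" and ?n = "sum_list ks"
  have mem: "g \<in> ?Sig \<longleftrightarrow> g permutes {1..?n} \<and> (\<forall>i < length ks. g ` block ks i = block ks i)" for g
    by (simp add: young_group_def sym_group_def)
  show ?thesis
  proof
    fix g h assume g: "g \<in> ?Sig"
    show pg: "g permutes {1..?n}" using g mem by blast
    have ij: "inj g" using pg permutes_inj by blast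
    show "Hilbert_Choice.inv g \<in> ?Sig"
      unfolding mem using permutes_inv[OF pg]
    proof (intro conjI allI impI)
      fix i assume "i < length ks"
      then have "Hilbert_Choice.inv g ` block ks i = Hilbert_Choice.inv g ` (g ` block ks i)" using g mem by simp
      also have "\<dots> = block ks i" by (rule image_inv_f_f[OF ij])
      finally show "Hilbert_Choice.inv g ` block ks i = block ks i" .
    qed
    show "g \<circ> h \<in> ?Sig" if h: "h \<in> ?Sig"
      unfolding mem
    proof (intro conjI allI impI)
      show "g \<circ> h permutes {1..?n}" using g h mem permutes_compose by blast
      fix i assume i: "i < length ks"
      show "(g \<circ> h) ` block ks i = block ks i"
        unfolding image_comp[symmetric] using g h mem i by simp
    qed
    fix j
    show "transpose (g j) j \<in> ?Sig"
      unfolding mem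
    proof (intro conjI allI impI)
      show "transpose (g j) j permutes {1..?n}"
      proof (cases "j \<in> {1..?n}")
        case True
        then have "g j \<in> {1..?n}" using permutes_in_image[OF pg] by blast
        then show ?thesis using True by (rule permutes_swap_id)
      next
        case False
        then have "g j = j" using pg by (simp add: permutes_def)
        then show ?thesis by (simp add: permutes_id)
      qed
      fix i assume "i < length ks"
      then have B: "g ` block ks i = block ks i" using g mem by blast
      have "j \<in> block ks i \<longleftrightarrow> g j \<in> g ` block ks i" by (rule inj_image_mem_iff[OF ij, symmetric])
      then have "g j \<in> block ks i \<longleftrightarrow> j \<in> block ks i" unfolding B by blast
      then have sub: "transpose (g j) j ` block ks i \<subseteq> block ks i" by (auto simp: transpose_def)
      then have "transpose (g j) j ` (transpose (g j) j ` block ks i) \<subseteq> transpose (g j) j ` block ks i"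
        by (rule image_mono)
      then have "block ks i \<subseteq> transpose (g j) j ` block ks i" by (simp add: image_image)
      with sub show "transpose (g j) j ` block ks i = block ks i" by (rule subset_antisym)
    qed
  qed (simp add: mem permutes_id)
qed

lemma young_group_setting:
  assumes ks: "sum_list ks = n"
    and G: "subgroup G (young_group ks)"
    and reps: "left_coset_reps (young_group ks) G \<gamma>s"
    and om: "\<omega> \<in> inv_ring_deg n (carrier (young_group ks)) 1" "eval_poly \<omega> z \<noteq> 0"
    and st: "stabilizer (young_group ks) act_point z = {id}"
  shows "setting n (carrier (young_group ks)) G \<gamma>s z \<omega>"
proof -
  let ?S = "young_group ks" let ?Sig = "carrier ?S"
  interpret young n ?Sig using young_group_young[of ks] unfolding ks .
  have S: "mult ?S = (\<circ>)" "one ?S = id" by (simp_all add: young_group_def sym_group_def)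
  have Gsub: "h \<in> ?Sig" if "h \<in> G" for h using subgroup.mem_carrier[OF G that] .
  have inv: "m_inv ?S g = Hilbert_Choice.inv g" if "g \<in> ?Sig" for g
    unfolding m_inv_def S
  proof (rule the_equality)
    show "Hilbert_Choice.inv g \<in> ?Sig \<and> g \<circ> Hilbert_Choice.inv g = id \<and> Hilbert_Choice.inv g \<circ> g = id"
      using inv_in[OF that] inv_comp[OF that] by simp
    fix y assume y: "y \<in> ?Sig \<and> g \<circ> y = id \<and> y \<circ> g = id"
    have "y = (Hilbert_Choice.inv g \<circ> g) \<circ> y" unfolding inv_comp(1)[OF that] id_comp ..
    also have "\<dots> = Hilbert_Choice.inv g" using y by (simp only: comp_assoc comp_id)
    finally show "y = Hilbert_Choice.inv g" .
  qed
  interpret G: perm_group n G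
  proof
    show "g permutes {1..n}" if "g \<in> G" for g using perm[OF Gsub[OF that]] .
    show "id \<in> G" using subgroup.one_closed[OF G] by (simp add: S)
    show "g \<circ> h \<in> G" if "g \<in> G" "h \<in> G" for g h using subgroup.m_closed[OF G that] by (simp add: S)
    show "Hilbert_Choice.inv g \<in> G" if "g \<in> G" for g
      using subgroup.m_inv_closed[OF G that] by (simp add: inv[OF Gsub[OF that]])
  qed
  have lc: "g <#\<^bsub>?S\<^esub> C = (\<lambda>h. g \<circ> h) ` C" for g C by (auto simp: l_coset_def S)
  have r: "set \<gamma>s \<subseteq> ?Sig" "bij_betw (\<lambda>i. (\<lambda>h. \<gamma>s ! i \<circ> h) ` G) {..<length \<gamma>s} (lcosets\<^bsub>?S\<^esub> G)"
    using reps by (simp_all add: left_coset_reps_def lc)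
  show ?thesis
  proof
    show "G \<subseteq> ?Sig" using Gsub by blast
    show "set \<gamma>s \<subseteq> ?Sig" by (rule r(1))
    show "\<exists>i < length \<gamma>s. \<exists>h \<in> G. g = \<gamma>s ! i \<circ> h" if "g \<in> ?Sig" for g
    proof -
      have "(\<lambda>h. g \<circ> h) ` G \<in> lcosets\<^bsub>?S\<^esub> G" using that by (auto simp: LCOSETS_def lc)
      then have "(\<lambda>h. g \<circ> h) ` G \<in> (\<lambda>i. (\<lambda>h. \<gamma>s ! i \<circ> h) ` G) ` {..<length \<gamma>s}"
        unfolding bij_betw_imp_surj_on[OF r(2)] .
      then obtain i where i: "i < length \<gamma>s" "(\<lambda>h. g \<circ> h) ` G = (\<lambda>h. \<gamma>s ! i \<circ> h) ` G" by blast
      have "g \<in> (\<lambda>h. g \<circ> h) ` G" using G.id_in by (metis comp_id imageI)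
      then show ?thesis using i by auto
    qed
    show "i' = i" if i: "i < length \<gamma>s" "i' < length \<gamma>s" "h \<in> G" "\<gamma>s ! i' \<circ> h = \<gamma>s ! i" for i i' h
    proof -
      have "(\<lambda>k. \<gamma>s ! i \<circ> k) ` G = (\<lambda>k. \<gamma>s ! i' \<circ> k) ` (\<lambda>k. h \<circ> k) ` G"
        unfolding i(4)[symmetric] by (simp add: image_image comp_assoc)
      then have "(\<lambda>k. \<gamma>s ! i \<circ> k) ` G = (\<lambda>k. \<gamma>s ! i' \<circ> k) ` G"
        unfolding bij_betw_imp_surj_on[OF G.bij_betw_comp(1)[OF i(3)]] .
      then show ?thesis using inj_onD[OF bij_betw_imp_inj_on[OF r(2)], of i' i] i(1,2) by simp
    qed
    show "g = id" if g: "g \<in> ?Sig" "z \<circ> g = z" for g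
    proof -
      have "act_point (Hilbert_Choice.inv g) z = z" using g by (simp add: act_point_def inv_inv_eq bij_H)
      then have "Hilbert_Choice.inv g \<in> {id}" unfolding st[symmetric] stabilizer_def using inv_in[OF g(1)] by blast
      then have "g \<circ> Hilbert_Choice.inv g = g" by simp
      then show ?thesis using inv_comp(2)[OF g(1)] by simp
    qed
    show "\<omega> \<in> inv_ring n ?Sig" "homogeneous 1 \<omega>" using om(1) by (simp_all add: inv_ring_deg_def)
    show "eval_poly \<omega> z \<noteq> 0" by (rule om(2))
  qed
qed

section \<open>Graded matrices, projections and covolumes\<close>

text \<open>A permutation that contributes to the determinant satisfies \<open>a i \<le> b (p i)\<close> for all \<open>i\<close>, and the
  equal sums turn all of these into equalities.\<close>

lemma det_graded:
  fixes W :: "'a::idom mat"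
  assumes W: "W \<in> carrier_mat k k"
    and sum: "(\<Sum>i < k. a i) = (\<Sum>i < k. b i :: nat)"
    and nz: "\<And>i j. i < k \<Longrightarrow> j < k \<Longrightarrow> W $$ (i, j) \<noteq> 0 \<Longrightarrow> a i \<le> b j"
  shows "det W = det (mat k k (\<lambda>(i, j). if a i = b j then W $$ (i, j) else 0))"
proof -
  let ?V = "mat k k (\<lambda>(i, j). if a i = b j then W $$ (i, j) else 0)"
  have V: "?V \<in> carrier_mat k k" by simp
  show ?thesis
    unfolding det_def'[OF W] det_def'[OF V]
  proof (intro sum.cong refl arg_cong2[of _ _ _ _ "(*)"])
    fix p assume "p \<in> {p. p permutes {0..<k}}"
    then have p: "p permutes {0..<k}" by simp
    have pk: "p i < k" if "i < k" for i using permutes_in_image[OF p, of i] that by simp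
    show "(\<Prod>i = 0..<k. W $$ (i, p i)) = (\<Prod>i = 0..<k. ?V $$ (i, p i))"
    proof (cases "\<forall>i < k. a i \<le> b (p i)")
      case True
      have "(\<Sum>i < k. b (p i)) = (\<Sum>i < k. b i)"
        using sum.permute[of p "{..<k}" b] p by (simp add: atLeast0LessThan o_def)
      then have eq: "(\<Sum>i < k. a i) = (\<Sum>i < k. b (p i))" using sum by simp
      have "a i = b (p i)" if "i < k" for i
        using sum_mono_inv[OF eq, of i] True that by simp
      then show ?thesis using pk by (intro prod.cong) auto
    next
      case False
      then obtain i where i: "i < k" "\<not> a i \<le> b (p i)" by blast
      have "W $$ (i, p i) = 0" using nz[OF i(1) pk[OF i(1)]] i(2) by blast
      then have 1: "(\<Prod>i = 0..<k. W $$ (i, p i)) = 0" using i(1) by (intro prod_zero) auto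
      have "?V $$ (i, p i) = 0" using i pk[OF i(1)] by simp
      then have 2: "(\<Prod>i = 0..<k. ?V $$ (i, p i)) = 0" using i(1) by (intro prod_zero) auto
      show ?thesis unfolding 1 2 ..
    qed
  qed
qed

lemma det_one_plus_mult_commute:
  fixes X Y :: "'a::idom mat"
  assumes X: "X \<in> carrier_mat m k" and Y: "Y \<in> carrier_mat k m"
  shows "det (1\<^sub>m m + X * Y) = det (1\<^sub>m k + Y * X)"
proof -
  let ?A = "four_block_mat (1\<^sub>m m) (- X) Y (1\<^sub>m k)"
  let ?B = "four_block_mat (1\<^sub>m m) X (0\<^sub>m k m) (1\<^sub>m k)"
  have c: "1\<^sub>m m \<in> carrier_mat m m" "1\<^sub>m k \<in> carrier_mat k k" "- X \<in> carrier_mat m k" "0\<^sub>m k m \<in> carrier_mat k m"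
    using X by auto
  have A: "?A \<in> carrier_mat (m + k) (m + k)" and B: "?B \<in> carrier_mat (m + k) (m + k)" by auto
  have detB: "det ?B = 1"
    by (subst det_four_block_mat_lower_left_zero[OF c(1) X refl c(2)]) simp
  have z: "1\<^sub>m m * 1\<^sub>m m + - X * 0\<^sub>m k m = (1\<^sub>m m :: 'a mat)" "1\<^sub>m m * X + - X * 1\<^sub>m k = 0\<^sub>m m k"
    "Y * 1\<^sub>m m + 1\<^sub>m k * 0\<^sub>m k m = Y" "Y * X + 1\<^sub>m k * 1\<^sub>m k = 1\<^sub>m k + Y * X"
    "1\<^sub>m m * 1\<^sub>m m + X * Y = 1\<^sub>m m + X * Y" "1\<^sub>m m * - X + X * 1\<^sub>m k = 0\<^sub>m m k"
    "0\<^sub>m k m * 1\<^sub>m m + 1\<^sub>m k * Y = Y" "0\<^sub>m k m * - X + 1\<^sub>m k * 1\<^sub>m k = (1\<^sub>m k :: 'a mat)"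
  proof -
    have s: "1\<^sub>m m * X = X" "- X * 1\<^sub>m k = - X" "Y * 1\<^sub>m m = Y" "1\<^sub>m k * 0\<^sub>m k m = (0\<^sub>m k m :: 'a mat)"
      "- X * 0\<^sub>m k m = 0\<^sub>m m m" "1\<^sub>m m * - X = - X" "X * 1\<^sub>m k = X" "1\<^sub>m k * Y = Y"
      "0\<^sub>m k m * 1\<^sub>m m = (0\<^sub>m k m :: 'a mat)"
      "1\<^sub>m m * 1\<^sub>m m = (1\<^sub>m m :: 'a mat)" "1\<^sub>m k * 1\<^sub>m k = (1\<^sub>m k :: 'a mat)"
      using X Y by simp_all
    have s0: "0\<^sub>m k m * - X = (0\<^sub>m k k :: 'a mat)" by (rule left_mult_zero_mat) (use X in simp)
    have c: "dim_row X = m" "dim_col X = k" "dim_row Y = k" "dim_col Y = m" using X Y by auto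
    show "1\<^sub>m m * 1\<^sub>m m + - X * 0\<^sub>m k m = (1\<^sub>m m :: 'a mat)" unfolding s by (rule eq_matI) (auto simp: c)
    show "1\<^sub>m m * X + - X * 1\<^sub>m k = 0\<^sub>m m k" unfolding s by (rule eq_matI) (auto simp: c)
    show "Y * 1\<^sub>m m + 1\<^sub>m k * 0\<^sub>m k m = Y" unfolding s by (rule eq_matI) (auto simp: c)
    show "Y * X + 1\<^sub>m k * 1\<^sub>m k = 1\<^sub>m k + Y * X" unfolding s by (rule comm_add_mat[of _ k k]) (use X Y in auto)
    show "1\<^sub>m m * 1\<^sub>m m + X * Y = 1\<^sub>m m + X * Y" unfolding s ..
    show "1\<^sub>m m * - X + X * 1\<^sub>m k = 0\<^sub>m m k" unfolding s by (rule eq_matI) (auto simp: c)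
    show "0\<^sub>m k m * 1\<^sub>m m + 1\<^sub>m k * Y = Y" unfolding s by (rule eq_matI) (auto simp: c)
    show "0\<^sub>m k m * - X + 1\<^sub>m k * 1\<^sub>m k = (1\<^sub>m k :: 'a mat)" unfolding s s0 by (rule eq_matI) (auto simp: c)
  qed
  have "?A * ?B = four_block_mat (1\<^sub>m m) (0\<^sub>m m k) Y (1\<^sub>m k + Y * X)"
    unfolding mult_four_block_mat[OF c(1) c(3) Y c(2) c(1) X c(4) c(2)] z ..
  then have "det ?A * det ?B = det (1\<^sub>m k + Y * X)"
    by (subst det_mult[OF A B, symmetric], simp only:)
       (subst det_four_block_mat_upper_right_zero[OF c(1) refl Y], use X Y in auto)
  moreover have "?B * ?A = four_block_mat (1\<^sub>m m + X * Y) (0\<^sub>m m k) Y (1\<^sub>m k)"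
    unfolding mult_four_block_mat[OF c(1) X c(4) c(2) c(1) c(3) Y c(2)] z ..
  then have "det ?B * det ?A = det (1\<^sub>m m + X * Y)"
    by (subst det_mult[OF B A, symmetric], simp only:)
       (subst det_four_block_mat_upper_right_zero[OF _ refl Y c(2)], use X Y in auto)
  ultimately show ?thesis using detB by simp
qed

definition class_idx :: "nat \<Rightarrow> (nat \<Rightarrow> nat) \<Rightarrow> nat \<Rightarrow> nat list" where
  "class_idx k f d = filter (\<lambda>j. f j = d) [0..<k]"

lemma set_class_idx: "set (class_idx k f d) = {j. j < k \<and> f j = d}"
  and distinct_class_idx: "distinct (class_idx k f d)"
  by (auto simp: class_idx_def)

lemma class_idx_nth: "a < length (class_idx k f d) \<Longrightarrow> class_idx k f d ! a < k \<and> f (class_idx k f d ! a) = d"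
  using nth_mem[of a "class_idx k f d"] unfolding set_class_idx by simp

lemma sum_class_idx:
  fixes h :: "nat \<Rightarrow> 'b::comm_monoid_add"
  shows "(\<Sum>a < length (class_idx k f d). h (class_idx k f d ! a)) = (\<Sum>j \<in> {j. j < k \<and> f j = d}. h j)"
  using sum.reindex_bij_betw[OF bij_betw_nth[OF distinct_class_idx refl set_class_idx[symmetric]]] .

text \<open>The determinant of a matrix that is block diagonal with respect to the fibres of a map on the
  indices, which need not be intervals.\<close>

lemma det_classes:
  fixes H :: "'a::idom mat"
  assumes H: "H \<in> carrier_mat k k" and off: "\<And>i j. i < k \<Longrightarrow> j < k \<Longrightarrow> f i \<noteq> f j \<Longrightarrow> H $$ (i, j) = 0"
  shows "det H = (\<Prod>d \<in> f ` {..<k}. det (mat (length (class_idx k f d)) (length (class_idx k f d))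
    (\<lambda>(a, b). H $$ (class_idx k f d ! a, class_idx k f d ! b))))"
proof -
  let ?R = "\<lambda>d. mat (length (class_idx k f d)) (length (class_idx k f d))
    (\<lambda>(a, b). H $$ (class_idx k f d ! a, class_idx k f d ! b))"
  define HD where "HD D = mat k k (\<lambda>(i, j). if f i \<in> D then H $$ (i, j) else if i = j then 1 else 0)" for D
  have HDc: "HD D \<in> carrier_mat k k" for D by (simp add: HD_def)
  have single: "det (HD {d}) = det (?R d)" for d
  proof -
    let ?x = "class_idx k f d" let ?m = "length ?x"
    define X where "X = mat k ?m (\<lambda>(i, a). if i = ?x ! a then 1 else 0 :: 'a)"
    define Y where "Y = mat ?m k (\<lambda>(a, j). H $$ (?x ! a, j) - (if ?x ! a = j then 1 else 0))"
    have X: "X \<in> carrier_mat k ?m" and Y: "Y \<in> carrier_mat ?m k" by (simp_all add: X_def Y_def)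
    have "1\<^sub>m k + X * Y = HD {d}"
    proof (rule eq_matI)
      fix i j assume "i < dim_row (HD {d})" "j < dim_col (HD {d})"
      then have ij: "i < k" "j < k" by (simp_all add: HD_def)
      have "(X * Y) $$ (i, j) = (\<Sum>a < ?m. (if i = ?x ! a then 1 else 0) * (H $$ (?x ! a, j) - (if ?x ! a = j then 1 else 0)))"
        using ij by (simp add: X_def Y_def scalar_prod_def atLeast0LessThan)
      also have "\<dots> = (\<Sum>c \<in> {c. c < k \<and> f c = d}. (if i = c then 1 else 0) * (H $$ (c, j) - (if c = j then 1 else 0)))"
        by (rule sum_class_idx)
      also have "\<dots> = (\<Sum>c \<in> {c. c < k \<and> f c = d}. if c = i then H $$ (i, j) - (if i = j then 1 else 0) else 0)"
        by (intro sum.cong) auto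
      also have "\<dots> = (if f i = d then H $$ (i, j) - (if i = j then 1 else 0) else 0)"
        using ij(1) by simp
      finally show "(1\<^sub>m k + X * Y) $$ (i, j) = HD {d} $$ (i, j)"
        using ij X Y by (auto simp: HD_def)
    qed (simp_all add: HD_def X_def Y_def)
    moreover have "1\<^sub>m ?m + Y * X = ?R d"
    proof (rule eq_matI)
      fix a b assume "a < dim_row (?R d)" "b < dim_col (?R d)"
      then have ab: "a < ?m" "b < ?m" by simp_all
      have xb: "?x ! b < k" using class_idx_nth[OF ab(2)] by simp
      have "(Y * X) $$ (a, b) = (\<Sum>j < k. (H $$ (?x ! a, j) - (if ?x ! a = j then 1 else 0)) * (if j = ?x ! b then 1 else 0))"
        using ab by (simp add: X_def Y_def scalar_prod_def atLeast0LessThan)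
      also have "\<dots> = (\<Sum>j < k. if j = ?x ! b then H $$ (?x ! a, ?x ! b) - (if ?x ! a = ?x ! b then 1 else 0) else 0)"
        by (intro sum.cong) auto
      also have "\<dots> = H $$ (?x ! a, ?x ! b) - (if ?x ! a = ?x ! b then 1 else 0)"
        using xb by simp
      finally show "(1\<^sub>m ?m + Y * X) $$ (a, b) = ?R d $$ (a, b)"
        using ab X Y nth_eq_iff_index_eq[OF distinct_class_idx ab] by auto
    qed (simp_all add: X_def Y_def)
    ultimately show ?thesis using det_one_plus_mult_commute[OF X Y] by simp
  qed
  have prodD: "det (HD D) = (\<Prod>d \<in> D. det (?R d))" if "finite D" for D
    using that
  proof (induction D rule: finite_induct)
    case empty
    have "HD {} = 1\<^sub>m k" by (rule eq_matI) (auto simp: HD_def)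
    then show ?case by simp
  next
    case (insert d D)
    have "HD (insert d D) = HD {d} * HD D"
    proof (rule eq_matI)
      fix i j assume "i < dim_row (HD {d} * HD D)" "j < dim_col (HD {d} * HD D)"
      then have ij: "i < k" "j < k" by (simp_all add: HD_def)
      have "(HD {d} * HD D) $$ (i, j) = (\<Sum>m < k. HD {d} $$ (i, m) * HD D $$ (m, j))"
        using ij HDc[of "{d}"] HDc[of D] by (simp add: scalar_prod_def atLeast0LessThan)
      also have "\<dots> = HD (insert d D) $$ (i, j)"
      proof (cases "f i = d")
        case True
        have "HD {d} $$ (i, m) * HD D $$ (m, j) = (if m = j then H $$ (i, j) else 0)" if m: "m < k" for m
        proof (cases "f m = d")
          case True
          then show ?thesis using ij m \<open>f i = d\<close> insert.hyps(2) by (auto simp: HD_def)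
        next
          case False
          then have "H $$ (i, m) = 0" using off[OF ij(1) m] \<open>f i = d\<close> by simp
          then show ?thesis using ij m \<open>f i = d\<close> by (auto simp: HD_def)
        qed
        then have "(\<Sum>m < k. HD {d} $$ (i, m) * HD D $$ (m, j)) = (\<Sum>m < k. if m = j then H $$ (i, j) else 0)"
          by (intro sum.cong) auto
        then show ?thesis using ij True by (simp add: HD_def)
      next
        case False
        then have "(\<Sum>m < k. HD {d} $$ (i, m) * HD D $$ (m, j)) = (\<Sum>m < k. if m = i then HD D $$ (i, j) else 0)"
          using ij by (intro sum.cong) (auto simp: HD_def)
        then show ?thesis using ij False by (simp add: HD_def)
      qed
      finally show "HD (insert d D) $$ (i, j) = (HD {d} * HD D) $$ (i, j)" by simp
    qed (simp_all add: HD_def)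
    then have "det (HD (insert d D)) = det (HD {d}) * det (HD D)"
      by (simp only: det_mult[OF HDc HDc])
    then show ?case unfolding single insert.IH prod.insert[OF insert.hyps] .
  qed
  have HDf: "HD (f ` {..<k}) = H" by (rule eq_matI) (use H in \<open>auto simp: HD_def\<close>)
  have "det (HD (f ` {..<k})) = (\<Prod>d \<in> f ` {..<k}. det (?R d))" by (rule prodD) simp
  then show ?thesis unfolding HDf .
qed

lemma projection_exists:
  fixes x :: "'k \<Rightarrow> nat \<Rightarrow> real"
  assumes "finite S"
  shows "\<exists>u. \<forall>s \<in> S. (\<Sum>i < k. (v i - (\<Sum>m \<in> S. u m * x m i)) * x s i) = 0"
  using assms
proof (induction S arbitrary: v rule: finite_induct)
  case (insert s S)
  obtain u0 where u0: "\<forall>t \<in> S. (\<Sum>i < k. (x s i - (\<Sum>m \<in> S. u0 m * x m i)) * x t i) = 0"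
    using insert.IH[of "x s"] by blast
  obtain u1 where u1: "\<forall>t \<in> S. (\<Sum>i < k. (v i - (\<Sum>m \<in> S. u1 m * x m i)) * x t i) = 0"
    using insert.IH[of v] by blast
  define p where "p i = x s i - (\<Sum>m \<in> S. u0 m * x m i)" for i
  define r where "r i = v i - (\<Sum>m \<in> S. u1 m * x m i)" for i
  have p: "(\<Sum>i < k. p i * x t i) = 0" and r: "(\<Sum>i < k. r i * x t i) = 0" if "t \<in> S" for t
    using u0 u1 that by (simp_all add: p_def r_def)
  have xs: "x s i = p i + (\<Sum>m \<in> S. u0 m * x m i)" for i by (simp add: p_def)
  have red: "(\<Sum>i < k. h i * x s i) = (\<Sum>i < k. h i * p i)"
    if h: "\<And>t. t \<in> S \<Longrightarrow> (\<Sum>i < k. h i * x t i) = 0" for h :: "nat \<Rightarrow> real"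
  proof -
    have "(\<Sum>i < k. h i * (\<Sum>m \<in> S. u0 m * x m i)) = (\<Sum>m \<in> S. u0 m * (\<Sum>i < k. h i * x m i))"
      by (simp add: sum_distrib_left sum.swap[of _ S] ac_simps)
    also have "\<dots> = 0" using h by simp
    finally show ?thesis unfolding xs by (simp add: distrib_left sum.distrib)
  qed
  define q where "q = (\<Sum>i < k. p i * p i)"
  define t where "t = (\<Sum>i < k. r i * p i) / q"
  define u where "u m = (if m = s then t else u1 m - t * u0 m)" for m
  have key: "v i - (\<Sum>m \<in> insert s S. u m * x m i) = r i - t * p i" for i
  proof -
    have "(\<Sum>m \<in> S. u m * x m i) = (\<Sum>m \<in> S. u1 m * x m i - t * (u0 m * x m i))"
      using insert.hyps(2) by (intro sum.cong refl) (auto simp: u_def algebra_simps)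
    also have "\<dots> = (\<Sum>m \<in> S. u1 m * x m i) - t * (\<Sum>m \<in> S. u0 m * x m i)"
      by (simp add: sum_subtractf sum_distrib_left)
    finally show ?thesis
      using insert.hyps by (simp add: u_def r_def p_def algebra_simps)
  qed
  have S: "(\<Sum>i < k. (r i - t * p i) * x c i) = 0" if "c \<in> S" for c
    using p[OF that] r[OF that]
    by (simp add: left_diff_distrib sum_subtractf mult.assoc flip: sum_distrib_left)
  have "(\<Sum>i < k. (r i - t * p i) * x s i) = (\<Sum>i < k. (r i - t * p i) * p i)"
    by (rule red) (rule S)
  also have "\<dots> = (\<Sum>i < k. r i * p i) - t * q"
    by (simp add: left_diff_distrib sum_subtractf mult.assoc q_def flip: sum_distrib_left)
  also have "\<dots> = 0"
  proof (cases "q = 0")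
    case True
    then have "\<forall>i \<in> {..<k}. p i * p i = 0" unfolding q_def by (subst (asm) sum_nonneg_eq_0_iff) auto
    then show ?thesis using True by simp
  qed (simp add: t_def)
  finally show ?case using S key by (intro exI[of _ u]) auto
qed simp

lemma orth_projI:
  assumes W: "W \<subseteq> carrier_vec k" "\<And>a b. a \<in> W \<Longrightarrow> b \<in> W \<Longrightarrow> a - b \<in> W"
    and w: "w \<in> W" "v \<in> carrier_vec k" "\<And>u. u \<in> W \<Longrightarrow> scalar_prod (v - w) u = 0"
  shows "orth_proj W v = w"
  unfolding orth_proj_def
proof (rule the_equality)
  show "w \<in> W \<and> (\<forall>u \<in> W. scalar_prod (v - w) u = 0)" using w by blast
  fix w' assume w': "w' \<in> W \<and> (\<forall>u \<in> W. scalar_prod (v - w') u = 0)"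
  have d: "w - w' \<in> W" using W(2) w(1) w' by blast
  have c: "w \<in> carrier_vec k" "w' \<in> carrier_vec k" using W(1) w(1) w' by auto
  have "scalar_prod (w - w') (w - w') = scalar_prod (v - w') (w - w') - scalar_prod (v - w) (w - w')"
    using c w(2) by (simp add: scalar_prod_def sum_subtractf[symmetric] algebra_simps)
  also have "\<dots> = 0" using w(3)[OF d] w' d by simp
  finally have "(\<Sum>i \<in> {0..<k}. (w $ i - w' $ i) * (w $ i - w' $ i)) = 0"
    using c by (simp add: scalar_prod_def)
  then have "\<forall>i \<in> {0..<k}. (w $ i - w' $ i) * (w $ i - w' $ i) = 0"
    by (subst (asm) sum_nonneg_eq_0_iff) auto
  then show "w' = w" using c by (intro eq_vecI) auto
qed

lemma mult_unit_vec_col: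
  fixes B :: "'a::comm_ring_1 mat"
  assumes "B \<in> carrier_mat k m" "a < m"
  shows "B *\<^sub>v unit_vec m a = col B a"
proof (rule eq_vecI)
  fix i assume "i < dim_vec (col B a)"
  then show "(B *\<^sub>v unit_vec m a) $ i = col B a $ i"
    using assms by (simp add: scalar_prod_def unit_vec_def if_distrib cong: if_cong)
qed (use assms in simp)

lemma lattice_basis_rows: "lattice_basis k B L \<Longrightarrow> dim_row B = k"
  unfolding lattice_basis_def by (rule conjunct1)

lemma lattice_basis_change:
  assumes B: "lattice_basis k B L" and B': "lattice_basis k B' L"
  obtains N :: "int mat" where "N \<in> carrier_mat (dim_col B') (dim_col B)" "B = B' * map_mat real_of_int N"
proof -
  let ?m = "dim_col B" and ?m' = "dim_col B'"
  note rows = lattice_basis_rows[OF B] lattice_basis_rows[OF B']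
  have L: "L = {B *\<^sub>v map_vec real_of_int c | c. c \<in> carrier_vec ?m}"
    "L = {B' *\<^sub>v map_vec real_of_int c | c. c \<in> carrier_vec ?m'}"
    by (rule conjunct2[OF conjunct2[OF B[unfolded lattice_basis_def]]]
        conjunct2[OF conjunct2[OF B'[unfolded lattice_basis_def]]])+
  have ex: "\<exists>c. c \<in> carrier_vec ?m' \<and> col B a = B' *\<^sub>v map_vec real_of_int c" if a: "a < ?m" for a
  proof -
    have u: "map_vec real_of_int (unit_vec ?m a) = (unit_vec ?m a :: real vec)"
      by (rule eq_vecI) (auto simp: unit_vec_def)
    have "B \<in> carrier_mat k ?m" using rows(1) by (intro carrier_matI) simp_all
    then have "B *\<^sub>v map_vec real_of_int (unit_vec ?m a) = col B a"
      unfolding u using a by (rule mult_unit_vec_col)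
    then have "col B a \<in> {B *\<^sub>v map_vec real_of_int c | c. c \<in> carrier_vec ?m}"
      by (intro CollectI exI[of _ "unit_vec ?m a"] conjI unit_vec_carrier) (rule sym)
    then have "col B a \<in> {B' *\<^sub>v map_vec real_of_int c | c. c \<in> carrier_vec ?m'}"
      by (simp only: L(1)[symmetric] L(2)[symmetric])
    then show ?thesis by (elim CollectE exE conjE) (intro exI conjI)
  qed
  define c where "c a = (SOME c. c \<in> carrier_vec ?m' \<and> col B a = B' *\<^sub>v map_vec real_of_int c)" for a
  have c: "c a \<in> carrier_vec ?m'" "col B a = B' *\<^sub>v map_vec real_of_int (c a)" if "a < ?m" for a
    unfolding c_def by (rule conjunct1[OF someI_ex[OF ex[OF that]]])
      (rule conjunct2[OF someI_ex[OF ex[OF that]]])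
  define N where "N = mat ?m' ?m (\<lambda>(b, a). c a $ b)"
  have eq: "B = B' * map_mat real_of_int N"
  proof (rule eq_matI)
    fix i a assume "i < dim_row (B' * map_mat real_of_int N)" "a < dim_col (B' * map_mat real_of_int N)"
    then have ia: "i < k" "a < ?m" by (simp_all add: rows N_def)
    have "col (map_mat real_of_int N) a = map_vec real_of_int (c a)"
      by (rule eq_vecI) (use ia c(1)[OF ia(2)] in \<open>auto simp: N_def\<close>)
    then have "(B' * map_mat real_of_int N) $$ (i, a) = (B' *\<^sub>v map_vec real_of_int (c a)) $ i"
      using ia rows by (simp add: N_def)
    also have "\<dots> = B $$ (i, a)" unfolding c(2)[OF ia(2), symmetric] using ia rows by simp
    finally show "B $$ (i, a) = (B' * map_mat real_of_int N) $$ (i, a)" by (rule sym)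
  qed (simp_all add: rows N_def)
  have "N \<in> carrier_mat ?m' ?m" by (simp add: N_def)
  then show thesis using eq by (rule that)
qed

lemma lattice_basis_inj:
  assumes B: "lattice_basis k B L" and N: "N \<in> carrier_mat (dim_col B) (dim_col B)" "B = B * N"
  shows "N = 1\<^sub>m (dim_col B)"
proof -
  let ?m = "dim_col B"
  note rows = lattice_basis_rows[OF B]
  have Bc: "B \<in> carrier_mat k ?m" using rows by (intro carrier_matI) auto
  have "col N a = unit_vec ?m a" if a: "a < ?m" for a
  proof -
    have ca: "col N a \<in> carrier_vec ?m" using N(1) by (intro carrier_vecI) simp
    have "B *\<^sub>v col N a = col (B * N) a" by (rule col_mult2[OF Bc N(1) a, symmetric])
    also have "\<dots> = B *\<^sub>v unit_vec ?m a" unfolding N(2)[symmetric] by (rule mult_unit_vec_col[OF Bc a, symmetric])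
    finally have e: "B *\<^sub>v col N a = B *\<^sub>v unit_vec ?m a" .
    have "B *\<^sub>v (col N a - unit_vec ?m a) = B *\<^sub>v col N a - B *\<^sub>v unit_vec ?m a"
      by (rule mult_minus_distrib_mat_vec[OF Bc ca]) simp
    also have "\<dots> = 0\<^sub>v k" unfolding e
      by (rule minus_cancel_vec, rule mult_mat_vec_carrier[OF Bc], rule unit_vec_carrier)
    finally have z: "B *\<^sub>v (col N a - unit_vec ?m a) = 0\<^sub>v k" .
    have "col N a - unit_vec ?m a \<in> carrier_vec ?m" by (intro minus_carrier_vec ca unit_vec_carrier)
    then have "col N a - unit_vec ?m a = 0\<^sub>v ?m"
      by (rule mp[OF bspec[OF conjunct1[OF conjunct2[OF B[unfolded lattice_basis_def]]]] z])
    then have d: "(col N a - unit_vec ?m a) $ b = 0\<^sub>v ?m $ b" for b by (rule arg_cong)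
    show ?thesis
    proof (rule eq_vecI)
      fix b assume "b < dim_vec (unit_vec ?m a)"
      then have b: "b < ?m" by simp
      show "col N a $ b = unit_vec ?m a $ b"
        using d[of b] b by (simp only: index_minus_vec index_zero_vec index_unit_vec unit_vec_carrier dim_vec
            right_minus_eq carrier_vecD[OF unit_vec_carrier])
    qed (use carrier_vecD[OF ca] in simp)
  qed
  then have "col N a $ b = unit_vec ?m a $ b" if "a < ?m" "b < ?m" for a b using that by simp
  then show ?thesis using N(1) by (intro eq_matI) (auto simp: unit_vec_def)
qed

text \<open>Two bases of a lattice differ by an integer matrix with an integer inverse, so their Gram
  determinants agree.\<close>

lemma covol_eq:
  assumes B: "lattice_basis k B L"
  shows "covol k L = sqrt (det (transpose_mat B * B))"
  unfolding covol_def
proof (rule the_equality)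
  show "\<exists>B'. lattice_basis k B' L \<and> sqrt (det (transpose_mat B * B)) = sqrt (det (transpose_mat B' * B'))"
    by (intro exI[of _ B] conjI B refl)
  fix v assume "\<exists>B. lattice_basis k B L \<and> v = sqrt (det (transpose_mat B * B))"
  then obtain B' where B': "lattice_basis k B' L" and v: "v = sqrt (det (transpose_mat B' * B'))"
    by (elim exE conjE) (rule that)
  let ?m = "dim_col B" and ?m' = "dim_col B'"
  note rows = lattice_basis_rows[OF B] lattice_basis_rows[OF B']
  have Bc: "B \<in> carrier_mat k ?m" and Bc': "B' \<in> carrier_mat k ?m'" using rows by auto
  obtain N where N: "N \<in> carrier_mat ?m' ?m" "B = B' * map_mat real_of_int N"
    by (rule lattice_basis_change[OF B B'])
  obtain N' where N': "N' \<in> carrier_mat ?m ?m'" "B' = B * map_mat real_of_int N'"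
    by (rule lattice_basis_change[OF B' B])
  let ?N = "map_mat real_of_int N" and ?N' = "map_mat real_of_int N'"
  have Nc: "?N \<in> carrier_mat ?m' ?m" "?N' \<in> carrier_mat ?m ?m'" using N(1) N'(1) by auto
  have "B * (?N' * ?N) = B"
    unfolding assoc_mult_mat[OF Bc Nc(2,1), symmetric] N'(2)[symmetric] by (rule N(2)[symmetric])
  then have 1: "?N' * ?N = 1\<^sub>m ?m"
    by (rule lattice_basis_inj[OF B mult_carrier_mat[OF Nc(2,1)] sym])
  have "B' * (?N * ?N') = B'"
    unfolding assoc_mult_mat[OF Bc' Nc, symmetric] N(2)[symmetric] by (rule N'(2)[symmetric])
  then have 2: "?N * ?N' = 1\<^sub>m ?m'"
    by (rule lattice_basis_inj[OF B' mult_carrier_mat[OF Nc] sym])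
  \<comment> \<open>the trace shows that the two bases have the same length\<close>
  have "(\<Sum>a < ?m. \<Sum>b < ?m'. ?N' $$ (a, b) * ?N $$ (b, a)) = (\<Sum>a < ?m. (?N' * ?N) $$ (a, a))"
    using Nc by (intro sum.cong refl) (simp add: scalar_prod_def atLeast0LessThan)
  moreover have "(\<Sum>b < ?m'. \<Sum>a < ?m. ?N $$ (b, a) * ?N' $$ (a, b)) = (\<Sum>b < ?m'. (?N * ?N') $$ (b, b))"
    using Nc by (intro sum.cong refl) (simp add: scalar_prod_def atLeast0LessThan)
  moreover have "(\<Sum>a < ?m. \<Sum>b < ?m'. ?N' $$ (a, b) * ?N $$ (b, a)) = (\<Sum>b < ?m'. \<Sum>a < ?m. ?N $$ (b, a) * ?N' $$ (a, b))"
    by (subst sum.swap) (simp only: mult.commute)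
  ultimately have "real ?m = real ?m'" unfolding 1 2 by simp
  then have mm: "?m' = ?m" by simp
  have Nm: "N \<in> carrier_mat ?m ?m" "N' \<in> carrier_mat ?m ?m" using N(1) N'(1) mm by auto
  have "det (?N' * ?N) = det ?N' * det ?N" by (rule det_mult[of _ ?m]) (use Nm in auto)
  then have "det ?N' * det ?N = 1" unfolding 1 det_one by (rule sym)
  then have "real_of_int (det N' * det N) = real_of_int 1" by simp
  then have "det N' * det N = 1" by (simp only: of_int_eq_iff)
  then have "det N dvd 1" by (metis dvd_triv_right)
  then have "\<bar>det N\<bar> = 1" by simp
  then have dn: "det N * det N = 1" by (metis abs_mult_self_eq mult_1)
  have Nr: "?N \<in> carrier_mat ?m ?m" and Br: "B' \<in> carrier_mat k ?m" using Nm Bc' mm by auto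
  have "transpose_mat B * B = transpose_mat ?N * (transpose_mat B' * B') * ?N"
  proof -
    have tB: "transpose_mat B = transpose_mat ?N * transpose_mat B'"
    proof -
      have "transpose_mat B = transpose_mat (B' * ?N)" by (rule arg_cong[OF N(2)])
      also have "\<dots> = transpose_mat ?N * transpose_mat B'" by (rule transpose_mult[OF Br Nr])
      finally show ?thesis .
    qed
    have "transpose_mat B * B = transpose_mat B * (B' * ?N)" by (rule arg_cong[OF N(2)])
    also have "\<dots> = (transpose_mat ?N * transpose_mat B') * (B' * ?N)" unfolding tB ..
    also have "\<dots> = transpose_mat ?N * (transpose_mat B' * (B' * ?N))"
      by (rule assoc_mult_mat[of _ ?m ?m _ k _ ?m]) (use Nr Br in auto)
    also have "transpose_mat B' * (B' * ?N) = transpose_mat B' * B' * ?N"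
      by (rule assoc_mult_mat[of _ ?m k _ ?m _ ?m, symmetric]) (use Nr Br in auto)
    also have "transpose_mat ?N * (transpose_mat B' * B' * ?N) = transpose_mat ?N * (transpose_mat B' * B') * ?N"
      by (rule assoc_mult_mat[of _ ?m ?m _ ?m _ ?m, symmetric]) (use Nr Br in auto)
    finally show ?thesis .
  qed
  then have "det (transpose_mat B * B) = det (transpose_mat ?N * (transpose_mat B' * B') * ?N)" by (rule arg_cong)
  also have "\<dots> = det (transpose_mat ?N * (transpose_mat B' * B')) * det ?N"
    by (rule det_mult[of _ ?m]) (use Nr Br in auto)
  also have "det (transpose_mat ?N * (transpose_mat B' * B')) = det (transpose_mat ?N) * det (transpose_mat B' * B')"
    by (rule det_mult[of _ ?m]) (use Nr Br in auto)
  also have "det (transpose_mat ?N) = det ?N" by (rule det_transpose[OF Nr])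
  finally have "det (transpose_mat B * B) = det ?N * det (transpose_mat B' * B') * det ?N" .
  also have "\<dots> = real_of_int (det N * det N) * det (transpose_mat B' * B')" by simp
  also have "\<dots> = det (transpose_mat B' * B')" unfolding dn by simp
  finally show "v = sqrt (det (transpose_mat B * B))" unfolding v by simp
qed

section \<open>Optimal secondaries\<close>

context setting
begin

definition coords :: "int mpol list \<Rightarrow> int mpol \<Rightarrow> (nat \<Rightarrow> rat) \<Rightarrow> bool" where
  "coords \<theta>s f c \<longleftrightarrow> (\<forall>i < l. of_int (iv f i) = (\<Sum>j < l. c j * of_int (iv (\<theta>s ! j) i)))"

text \<open>Only the coordinates in the degree of the form itself are integral; those in smaller degrees may
  have denominators, which powers of \<open>\<omega>\<close> introduce.\<close>

definition optimal :: "int mpol list \<Rightarrow> bool" where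
  "optimal \<theta>s \<longleftrightarrow> adapted \<theta>s \<and> (\<forall>f \<in> inv_ring n G. \<forall>d c. homogeneous d f \<longrightarrow> coords \<theta>s f c \<longrightarrow>
     (\<forall>j < l. dg (\<theta>s ! j) = d \<longrightarrow> c j \<in> \<int>))"

lemma optimal_Ints:
  "optimal \<theta>s \<Longrightarrow> f \<in> inv_ring n G \<Longrightarrow> homogeneous d f \<Longrightarrow> coords \<theta>s f c \<Longrightarrow> j < l \<Longrightarrow>
    dg (\<theta>s ! j) = d \<Longrightarrow> c j \<in> \<int>"
  unfolding optimal_def by blast

lemma adapted_spans:
  assumes "adapted \<theta>s" "f \<in> inv_ring n G" "homogeneous d f"
  shows "\<exists>c :: nat \<Rightarrow> rat. (\<forall>j < l. c j \<noteq> 0 \<longrightarrow> dg (\<theta>s ! j) \<le> d) \<and>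
    (\<forall>i < l. rv f i = (\<Sum>j < l. c j * of_int (iv (\<theta>s ! j) i)))"
  using assms(1) unfolding adapted_def
  by (elim conjE) (erule allE[of _ d], drule bspec[OF _ assms(2)], erule mp, rule assms(3))

lemma adapted_det: "adapted \<theta>s \<Longrightarrow> det (T \<theta>s) \<noteq> 0"
  unfolding adapted_def by (elim conjE)

lemma adapted_coords:
  assumes "adapted \<theta>s" "f \<in> inv_ring n G" "homogeneous d f"
  obtains c where "coords \<theta>s f c" "\<And>j. j < l \<Longrightarrow> c j \<noteq> 0 \<Longrightarrow> dg (\<theta>s ! j) \<le> d"
proof -
  have "of_int_poly f \<in> (inv_ring n G :: rat mpol set)" "homogeneous d (of_int_poly f :: rat mpol)"
    using assms(2,3) by (simp_all add: G.inv_ring_of_int_poly homogeneous_of_int_poly)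
  from adapted_spans[OF assms(1) this] obtain c :: "nat \<Rightarrow> rat" where c: "\<forall>j < l. c j \<noteq> 0 \<longrightarrow> dg (\<theta>s ! j) \<le> d"
    "\<forall>i < l. rv (of_int_poly f) i = (\<Sum>j < l. c j * of_int (iv (\<theta>s ! j) i))"
    by (elim exE conjE) (rule that)
  show thesis
  proof (rule that[of c])
    show "coords \<theta>s f c" unfolding coords_def
    proof (intro allI impI)
      fix i assume i: "i < l"
      show "of_int (iv f i) = (\<Sum>j < l. c j * of_int (iv (\<theta>s ! j) i))"
        using c(2)[rule_format, OF i] unfolding rv_of_int_poly[OF i] .
    qed
    show "dg (\<theta>s ! j) \<le> d" if "j < l" "c j \<noteq> 0" for j using c(1) that by simp
  qed
qed

lemma coords_unique:
  assumes "adapted \<theta>s" "coords \<theta>s f c" "coords \<theta>s f c'" "j < l"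
  shows "c j = c' j"
proof -
  have c: "(\<Sum>j < l. c j * of_int (iv (\<theta>s ! j) i)) = of_int (iv f i)" if i: "i < l" for i
    by (rule assms(2)[unfolded coords_def, rule_format, OF i, symmetric])
  have c': "(\<Sum>j < l. c' j * of_int (iv (\<theta>s ! j) i)) = of_int (iv f i)" if i: "i < l" for i
    by (rule assms(3)[unfolded coords_def, rule_format, OF i, symmetric])
  have 0: "(\<Sum>j < l. (c j - c' j) * of_int (iv (\<theta>s ! j) i)) = 0" if i: "i < l" for i
    unfolding left_diff_distrib sum_subtractf c[OF i] c'[OF i] by (rule diff_self)
  have eq: "\<forall>j < l. c j - c' j = 0"
    by (rule det_T_kernel[THEN iffD1, OF adapted_det[OF assms(1)], THEN spec[of _ "\<lambda>j. c j - c' j"], THEN mp])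
      (intro allI impI 0)
  show ?thesis using eq[rule_format, OF assms(4)] by (simp only: right_minus_eq)
qed

lemma coords_support:
  assumes "adapted \<theta>s" "f \<in> inv_ring n G" "homogeneous d f" "coords \<theta>s f c" "j < l" "c j \<noteq> 0"
  shows "dg (\<theta>s ! j) \<le> d"
proof -
  obtain c' where c': "coords \<theta>s f c'" "\<And>j. j < l \<Longrightarrow> c' j \<noteq> 0 \<Longrightarrow> dg (\<theta>s ! j) \<le> d"
    by (rule adapted_coords[OF assms(1-3)]) (rule that)
  have "c' j = c j" by (rule coords_unique[OF assms(1) c'(1) assms(4,5)])
  then show ?thesis using c'(2)[OF assms(5)] assms(6) by simp
qed

lemma iv_minus: "i < l \<Longrightarrow> iv (f - g) i = iv f i - iv g i"
  and iv_mult: "i < l \<Longrightarrow> iv (f * g) i = iv f i * iv g i"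
  and iv_Const: "i < l \<Longrightarrow> iv (Const c) i = c"
  by (simp_all add: iv_def act_poly_distribs[OF rep_bij] ev.hom_minus ev.hom_mult rep_bij)

text \<open>Cramer's rule.\<close>

lemma det_T_replace:
  assumes "coords \<theta>s f c" "k < l" "length \<theta>s = l"
  shows "of_int (det (T (\<theta>s[k := f]))) = c k * of_int (det (T \<theta>s))"
proof -
  let ?A = "map_mat (of_int :: int \<Rightarrow> rat) (T \<theta>s)"
  have A: "?A \<in> carrier_mat l l" by (simp add: T_def)
  have "map_mat of_int (T (\<theta>s[k := f])) = replace_col ?A (?A *\<^sub>v vec l c) k"
  proof (rule eq_matI)
    fix i j assume "i < dim_row (replace_col ?A (?A *\<^sub>v vec l c) k)" "j < dim_col (replace_col ?A (?A *\<^sub>v vec l c) k)"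
    then have ij: "i < l" "j < l" by (simp_all add: replace_col_def T_def)
    have "(?A *\<^sub>v vec l c) $ i = of_int (iv f i)"
      using assms(1) ij unfolding coords_def
      by (simp add: T_def scalar_prod_def atLeast0LessThan mult.commute)
    then show "map_mat of_int (T (\<theta>s[k := f])) $$ (i, j) = replace_col ?A (?A *\<^sub>v vec l c) k $$ (i, j)"
      using ij assms(2,3) by (auto simp: replace_col_def T_def)
  qed (simp_all add: replace_col_def T_def)
  then have "det (map_mat of_int (T (\<theta>s[k := f]))) = vec l c $ k * det ?A"
    using cramer_lemma_mat[OF A vec_carrier assms(2)] by simp
  then show ?thesis using assms(2) by simp
qed

lemma adapted_replace:
  assumes a: "adapted \<theta>s" and k: "k < l" and f: "f \<in> inv_ring n G" "homogeneous (dg (\<theta>s ! k)) f"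
    and c: "coords \<theta>s f c" "c k \<noteq> 0"
  shows "adapted (\<theta>s[k := f])"
proof -
  let ?\<theta> = "\<theta>s[k := f]" and ?d = "dg (\<theta>s ! k)"
  note a' = a[unfolded adapted_def]
  have len: "length \<theta>s = l" using a' by blast
  have "f \<noteq> 0"
  proof
    assume "f = 0"
    then have "coords \<theta>s f (\<lambda>_. 0)" using iv_Const[of _ 0] by (simp add: coords_def)
    then show False using coords_unique[OF a c(1) _ k] c(2) by blast
  qed
  then have df: "dg f = ?d" using f(2) by (intro dg_homogeneous)
  have dgj: "dg (?\<theta> ! j) = dg (\<theta>s ! j)" if "j < l" for j using that len df by (cases "j = k") auto
  have sup: "dg (\<theta>s ! j) \<le> ?d" if "j < l" "c j \<noteq> 0" for j by (rule coords_support[OF a f c(1) that])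
  have "set ?\<theta> \<subseteq> inv_ring n G" using a' f(1) set_update_subset_insert[of \<theta>s k f] by blast
  moreover have "homogeneous (dg (?\<theta> ! j)) (?\<theta> ! j)" if "j < l" for j
    using a' that f(2) df len by (cases "j = k") auto
  moreover have "det (T ?\<theta>) \<noteq> 0"
  proof
    assume "det (T ?\<theta>) = 0"
    then have "c k * of_int (det (T \<theta>s)) = 0" using det_T_replace[OF c(1) k len] by simp
    then show False using c(2) a' by simp
  qed
  moreover have "\<exists>b :: nat \<Rightarrow> rat. (\<forall>j < l. b j \<noteq> 0 \<longrightarrow> dg (?\<theta> ! j) \<le> e) \<and>
      (\<forall>i < l. rv g i = (\<Sum>j < l. b j * of_int (iv (?\<theta> ! j) i)))"
    if g: "g \<in> inv_ring n G" "homogeneous e g" for g :: "rat mpol" and e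
  proof -
    obtain b :: "nat \<Rightarrow> rat" where b: "\<forall>j < l. b j \<noteq> 0 \<longrightarrow> dg (\<theta>s ! j) \<le> e"
      "\<forall>i < l. rv g i = (\<Sum>j < l. b j * of_int (iv (\<theta>s ! j) i))" 
      using adapted_spans[OF a g] by (elim exE conjE) (rule that)
    define b' where "b' j = (if j = k then b k / c k else b j - b k * c j / c k)" for j
    have "dg (?\<theta> ! j) \<le> e" if j: "j < l" "b' j \<noteq> 0" for j
    proof (cases "b k = 0")
      case True
      then have "b j \<noteq> 0" using j(2) by (auto simp: b'_def split: if_splits)
      then show ?thesis using b(1) j(1) dgj by simp
    next
      case False
      then have de: "?d \<le> e" using b(1) k by blast
      show ?thesis
      proof (cases "j = k \<or> c j \<noteq> 0")
        case True
        then have "dg (\<theta>s ! j) \<le> ?d" using sup[OF j(1)] by auto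
        then show ?thesis using de dgj[OF j(1)] by simp
      next
        case F: False
        then have "b j \<noteq> 0" using j(2) by (auto simp: b'_def)
        then show ?thesis using b(1) j(1) dgj by simp
      qed
    qed
    moreover have "rv g i = (\<Sum>j < l. b' j * of_int (iv (?\<theta> ! j) i))" if i: "i < l" for i
    proof -
      let ?t = "\<lambda>j. of_int (iv (\<theta>s ! j) i) :: rat"
      have split: "(\<Sum>j < l. h j) = h k + (\<Sum>j \<in> {..<l} - {k}. h j)" for h :: "nat \<Rightarrow> rat"
        using k by (intro sum.remove) auto
      have fi: "of_int (iv f i) = c k * ?t k + (\<Sum>j \<in> {..<l} - {k}. c j * ?t j)"
        using c(1) i split[of "\<lambda>j. c j * ?t j"] unfolding coords_def by simp
      have "(\<Sum>j < l. b' j * of_int (iv (?\<theta> ! j) i)) =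
          b k / c k * of_int (iv f i) + (\<Sum>j \<in> {..<l} - {k}. (b j - b k * c j / c k) * ?t j)"
        unfolding split using k len by (auto simp: b'_def intro!: sum.cong)
      also have "(\<Sum>j \<in> {..<l} - {k}. (b j - b k * c j / c k) * ?t j) =
          (\<Sum>j \<in> {..<l} - {k}. b j * ?t j) - b k / c k * (\<Sum>j \<in> {..<l} - {k}. c j * ?t j)"
        by (simp add: sum_subtractf sum_distrib_left algebra_simps)
      also have "b k / c k * of_int (iv f i) + \<dots> = b k * ?t k + (\<Sum>j \<in> {..<l} - {k}. b j * ?t j)"
        unfolding fi using c(2) by (simp add: field_simps)
      also have "\<dots> = rv g i" using b(2) i split[of "\<lambda>j. b j * ?t j"] by simp
      finally show ?thesis by simp
    qed
    ultimately show ?thesis by (intro exI[of _ b']) blast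
  qed
  ultimately show ?thesis unfolding adapted_def using len by simp
qed

text \<open>A list of secondaries with minimal non-zero determinant is optimal: a fractional coordinate
  could be used to make the determinant smaller.\<close>

lemma ex_optimal:
  fixes S :: "(nat \<Rightarrow> nat) monoid"
  assumes S: "carrier S = Sig"
  shows "\<exists>\<theta>s. optimal \<theta>s"
proof -
  have "\<exists>\<theta>s. adapted \<theta>s" using ex_int_secondaries[OF S] by (simp add: int_secondaries_iff[OF S])
  then obtain \<theta>0 where "adapted \<theta>0" ..
  from ex_has_least_nat[of adapted, OF this, of "\<lambda>\<theta>s. nat \<bar>det (T \<theta>s)\<bar>"] obtain \<theta>s
    where a: "adapted \<theta>s" and min: "\<And>\<eta>s. adapted \<eta>s \<Longrightarrow> nat \<bar>det (T \<theta>s)\<bar> \<le> nat \<bar>det (T \<eta>s)\<bar>" by blast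
  have hom: "homogeneous (dg (\<theta>s ! k)) (\<theta>s ! k)" "\<theta>s ! k \<in> inv_ring n G" if "k < l" for k
    using a that unfolding adapted_def by auto
  have len: "length \<theta>s = l" and det: "det (T \<theta>s) \<noteq> 0" using a unfolding adapted_def by blast+
  have "c k \<in> \<int>" if f: "f \<in> inv_ring n G" "homogeneous d f" "coords \<theta>s f c" "k < l" "dg (\<theta>s ! k) = d" for f d c k
  proof (rule ccontr)
    assume nint: "c k \<notin> \<int>"
    let ?r = "c k - of_int \<lfloor>c k\<rfloor>"
    have r: "0 < ?r" "?r < 1"
      using nint floor_correct[of "c k"] by (auto simp: less_le) (metis Ints_of_int)
    define f' where "f' = f - Const \<lfloor>c k\<rfloor> * \<theta>s ! k"
    have f': "f' \<in> inv_ring n G" "homogeneous (dg (\<theta>s ! k)) f'"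
      unfolding f'_def using f hom[OF f(4)]
      by (auto intro!: G.inv_ring_minus G.inv_ring_mult G.inv_ring_Const homogeneous_minus homogeneous_Const_mult)
    let ?c = "c(k := ?r)"
    have c': "coords \<theta>s f' ?c"
      unfolding coords_def
    proof (intro allI impI)
      fix i assume i: "i < l"
      have "(\<Sum>j < l. ?c j * of_int (iv (\<theta>s ! j) i)) =
          (\<Sum>j < l. c j * of_int (iv (\<theta>s ! j) i) - (if j = k then of_int \<lfloor>c k\<rfloor> * of_int (iv (\<theta>s ! k) i) else 0))"
        by (intro sum.cong) (auto simp: algebra_simps)
      also have "\<dots> = of_int (iv f i) - of_int \<lfloor>c k\<rfloor> * of_int (iv (\<theta>s ! k) i)"
        using f(3) i f(4) by (simp add: coords_def sum_subtractf)
      finally show "of_int (iv f' i) = (\<Sum>j < l. ?c j * of_int (iv (\<theta>s ! j) i))"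
        by (simp add: f'_def iv_minus iv_mult iv_Const i)
    qed
    have "adapted (\<theta>s[k := f'])" using r by (intro adapted_replace[OF a f(4) f' c']) simp
    then have m: "nat \<bar>det (T \<theta>s)\<bar> \<le> nat \<bar>det (T (\<theta>s[k := f']))\<bar>" by (rule min)
    have "of_int (det (T (\<theta>s[k := f']))) = ?r * of_int (det (T \<theta>s))"
      using det_T_replace[OF c' f(4) len] by simp
    then have "\<bar>of_int (det (T (\<theta>s[k := f'])))\<bar> = \<bar>?r\<bar> * \<bar>of_int (det (T \<theta>s)) :: rat\<bar>"
      by (simp only: abs_mult)
    also have "\<dots> < 1 * \<bar>of_int (det (T \<theta>s))\<bar>" using r det by (intro mult_strict_right_mono) auto
    finally have "of_int \<bar>det (T (\<theta>s[k := f']))\<bar> < (of_int \<bar>det (T \<theta>s)\<bar> :: rat)" by simp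
    then have "\<bar>det (T (\<theta>s[k := f']))\<bar> < \<bar>det (T \<theta>s)\<bar>" by (simp only: of_int_less_iff)
    then show False using m by linarith
  qed
  then have "optimal \<theta>s" unfolding optimal_def using a by blast
  then show ?thesis ..
qed

lemma card_dg:
  assumes S: "carrier S = Sig" and a: "adapted \<theta>s"
  shows "card {j. j < l \<and> dg (\<theta>s ! j) = d} = tau n S G d"
proof -
  let ?h = "of_int_poly :: int mpol \<Rightarrow> rat mpol" let ?\<Theta> = "?h ` set \<theta>s"
  have s: "int_secondaries n S G \<theta>s" using a by (simp add: int_secondaries_iff[OF S])
  then have \<Theta>: "secondaries n S G ?\<Theta>" "distinct \<theta>s" by (simp_all add: int_secondaries_def)
  have len: "length \<theta>s = l" using a by (simp add: adapted_def)
  note bij = bij_betw_of_int_poly_nth[OF \<Theta>(2) len]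
  have z: "0 \<notin> ?\<Theta>" using \<Theta>(1) zero_notin_indep by (simp add: secondaries_iff[OF S])
  have h: "homogeneous d (?h (\<theta>s ! j)) \<longleftrightarrow> dg (\<theta>s ! j) = d" if j: "j < l" for j
  proof -
    have hj: "homogeneous (dg (\<theta>s ! j)) (\<theta>s ! j)" using a j by (simp add: adapted_def)
    have "?h (\<theta>s ! j) \<in> ?\<Theta>" using j len by simp
    then have "?h (\<theta>s ! j) \<noteq> 0" using z by (intro notI) simp
    then have "\<theta>s ! j \<noteq> 0" by (intro notI) (simp only: oi.hom_zero)
    then have "dg (\<theta>s ! j) = d" if "homogeneous d (\<theta>s ! j)" using that by (rule dg_homogeneous[rotated])
    then show ?thesis unfolding homogeneous_of_int_poly_iff using hj by (intro iffI) (simp_all only: )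
  qed
  have surj: "?\<Theta> = (\<lambda>j. ?h (\<theta>s ! j)) ` {..<l}" by (rule bij_betw_imp_surj_on[OF bij, symmetric])
  have "{\<theta> \<in> ?\<Theta>. homogeneous d \<theta>} = (\<lambda>j. ?h (\<theta>s ! j)) ` {j. j < l \<and> dg (\<theta>s ! j) = d}"
  proof (intro equalityI subsetI)
    fix \<theta> assume "\<theta> \<in> {\<theta> \<in> ?\<Theta>. homogeneous d \<theta>}"
    then have \<theta>: "\<theta> \<in> (\<lambda>j. ?h (\<theta>s ! j)) ` {..<l}" "homogeneous d \<theta>" unfolding surj by simp_all
    from \<theta>(1) obtain j where "\<theta> = ?h (\<theta>s ! j)" "j < l" by (elim imageE) (simp only: lessThan_iff)
    then show "\<theta> \<in> (\<lambda>j. ?h (\<theta>s ! j)) ` {j. j < l \<and> dg (\<theta>s ! j) = d}"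
      using h[of j] \<theta>(2) by (intro image_eqI[of _ _ j]) simp_all
  next
    fix \<theta> assume "\<theta> \<in> (\<lambda>j. ?h (\<theta>s ! j)) ` {j. j < l \<and> dg (\<theta>s ! j) = d}"
    then obtain j where j: "\<theta> = ?h (\<theta>s ! j)" "j < l" "dg (\<theta>s ! j) = d" by (elim imageE) simp
    then show "\<theta> \<in> {\<theta> \<in> ?\<Theta>. homogeneous d \<theta>}" using h[of j] len by simp
  qed
  moreover have "inj_on (\<lambda>j. ?h (\<theta>s ! j)) {j. j < l \<and> dg (\<theta>s ! j) = d}"
    by (rule inj_on_subset[OF bij_betw_imp_inj_on[OF bij]]) (intro subsetI, simp)
  ultimately show ?thesis unfolding tau_eq[OF S \<Theta>(1)] by (simp only: card_image)
qed

lemma tau_support: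
  assumes S: "carrier S = Sig" and a: "adapted \<theta>s"
  shows "{d. tau n S G d \<noteq> 0} = (\<lambda>j. dg (\<theta>s ! j)) ` {..<l}"
  unfolding card_dg[OF S a, symmetric] by (auto simp: card_eq_0_iff)

lemma sum_dg:
  assumes S: "carrier S = Sig" and a: "adapted \<theta>s"
  shows "(\<Sum>j < l. dg (\<theta>s ! j)) = (\<Sum>d \<in> {d. tau n S G d \<noteq> 0}. d * tau n S G d)"
proof -
  have "(\<Sum>j < l. dg (\<theta>s ! j)) = (\<Sum>d \<in> (\<lambda>j. dg (\<theta>s ! j)) ` {..<l}. \<Sum>j \<in> {j \<in> {..<l}. dg (\<theta>s ! j) = d}. dg (\<theta>s ! j))"
    by (rule sum.image_gen) simp
  also have "\<dots> = (\<Sum>d \<in> (\<lambda>j. dg (\<theta>s ! j)) ` {..<l}. d * card {j. j < l \<and> dg (\<theta>s ! j) = d})"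
    by (intro sum.cong refl) (simp add: lessThan_def)
  finally show ?thesis unfolding tau_support[OF S a] card_dg[OF S a] .
qed

text \<open>The transition matrix is graded, so only its diagonal blocks matter for the determinant,
  and these are integral.\<close>

lemma optimal_dvd:
  fixes S :: "(nat \<Rightarrow> nat) monoid"
  assumes S: "carrier S = Sig" and o: "optimal \<theta>s" and a: "adapted \<eta>s"
  shows "det (T \<theta>s) dvd det (T \<eta>s)"
proof -
  have o': "adapted \<theta>s" using o by (simp add: optimal_def)
  have \<eta>: "\<eta>s ! k \<in> inv_ring n G" "homogeneous (dg (\<eta>s ! k)) (\<eta>s ! k)" if "k < l" for k
    using a that unfolding adapted_def by auto
  have ex: "\<exists>c. coords \<theta>s (\<eta>s ! k) c" if "k < l" for k
    by (rule adapted_coords[OF o' \<eta>[OF that]]) (rule exI)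
  have c: "coords \<theta>s (\<eta>s ! k) (SOME c. coords \<theta>s (\<eta>s ! k) c)" if "k < l" for k
    by (rule someI_ex[OF ex[OF that]])
  define w where "w k = (SOME c. coords \<theta>s (\<eta>s ! k) c)" for k
  have w: "coords \<theta>s (\<eta>s ! k) (w k)" if "k < l" for k unfolding w_def by (rule c[OF that])
  define W where "W = mat l l (\<lambda>(j, k). w k j)"
  have W: "W \<in> carrier_mat l l" by (simp add: W_def)
  let ?A = "map_mat (of_int :: int \<Rightarrow> rat)"
  have A: "?A (T \<theta>s) \<in> carrier_mat l l" by (simp add: T_def)
  have prod: "?A (T \<eta>s) = ?A (T \<theta>s) * W"
  proof (rule eq_matI)
    fix i k assume "i < dim_row (?A (T \<theta>s) * W)" "k < dim_col (?A (T \<theta>s) * W)"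
    then have ik: "i < l" "k < l" by (simp_all add: T_def W_def)
    show "?A (T \<eta>s) $$ (i, k) = (?A (T \<theta>s) * W) $$ (i, k)"
      using w[OF ik(2)] ik unfolding coords_def
      by (simp add: T_def W_def scalar_prod_def atLeast0LessThan mult.commute)
  qed (simp_all add: T_def W_def)
  have 1: "of_int (det (T \<eta>s)) = of_int (det (T \<theta>s)) * det W"
    using det_mult[OF A W] unfolding prod[symmetric] by simp
  define Z :: "int mat" where "Z = mat l l (\<lambda>(i, j). if dg (\<theta>s ! i) = dg (\<eta>s ! j) then \<lfloor>w j i\<rfloor> else 0)"
  let ?V = "mat l l (\<lambda>(i, j). if dg (\<theta>s ! i) = dg (\<eta>s ! j) then W $$ (i, j) else 0)"
  have "det W = det ?V"
  proof (rule det_graded[OF W])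
    show "(\<Sum>i < l. dg (\<theta>s ! i)) = (\<Sum>i < l. dg (\<eta>s ! i))" by (simp add: sum_dg[OF S o'] sum_dg[OF S a])
    fix i j assume ij: "i < l" "j < l" "W $$ (i, j) \<noteq> 0"
    show "dg (\<theta>s ! i) \<le> dg (\<eta>s ! j)"
      by (rule coords_support[OF o' \<eta>[OF ij(2)] w[OF ij(2)] ij(1)]) (use ij in \<open>simp add: W_def\<close>)
  qed
  also have "?V = ?A Z"
  proof (rule eq_matI)
    fix i j assume "i < dim_row (?A Z)" "j < dim_col (?A Z)"
    then have ij: "i < l" "j < l" by (simp_all add: Z_def)
    have "w j i \<in> \<int>" if e: "dg (\<theta>s ! i) = dg (\<eta>s ! j)"
      by (rule optimal_Ints[OF o \<eta>[OF ij(2)] w[OF ij(2)] ij(1) e])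
    then show "?V $$ (i, j) = ?A Z $$ (i, j)" using ij by (auto simp: W_def Z_def)
  qed (simp_all add: Z_def)
  finally have dW: "det W = of_int (det Z)" by simp
  then have "(of_int (det (T \<eta>s)) :: rat) = of_int (det (T \<theta>s) * det Z)" using 1 dW by simp
  then have "det (T \<eta>s) = det (T \<theta>s) * det Z" by (simp only: of_int_eq_iff)
  then show ?thesis by simp
qed

end

section \<open>Covolumes of the projected lattices\<close>

context setting
begin

definition La :: "int mpol list \<Rightarrow> (nat \<Rightarrow> real) \<Rightarrow> nat \<Rightarrow> real" where
  "La \<theta>s c i = (\<Sum>j < l. c j * real_of_int (iv (\<theta>s ! j) i))"

definition Lr :: "int mpol list \<Rightarrow> (nat \<Rightarrow> real) \<Rightarrow> real vec" where
  "Lr \<theta>s c = vec l (La \<theta>s c)"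

abbreviation zR :: "nat \<Rightarrow> real" where "zR \<equiv> (\<lambda>k. real_of_int (z k))"

lemma res_nth: "i < l \<Longrightarrow> res \<gamma>s z f $ i = eval_poly (act_poly (\<gamma>s ! i) f) zR"
  by (simp add: res_def point_def act_point_def inv_inv_eq rep_bij eval_act_poly o_def)

lemma dim_res: "dim_vec (res \<gamma>s z f) = l"
  by (simp add: res_def)

lemma res_of_int: "i < l \<Longrightarrow> res \<gamma>s z (of_int_poly f) $ i = real_of_int (iv f i)"
  by (simp add: res_nth act_poly_of_int_poly rep_bij eval_of_int_poly iv_def)

lemma coords_res:
  assumes "coords \<theta>s f c"
  shows "res \<gamma>s z (of_int_poly f) = Lr \<theta>s (\<lambda>j. real_of_rat (c j))"
proof (rule eq_vecI)
  fix i assume "i < dim_vec (Lr \<theta>s (\<lambda>j. real_of_rat (c j)))"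
  then have i: "i < l" by (simp add: Lr_def)
  have "real_of_int (iv f i) = real_of_rat (of_int (iv f i))" by simp
  also have "\<dots> = real_of_rat (\<Sum>j < l. c j * of_int (iv (\<theta>s ! j) i))"
    using assms[unfolded coords_def, rule_format, OF i] by (rule arg_cong)
  also have "\<dots> = La \<theta>s (\<lambda>j. real_of_rat (c j)) i" by (simp add: La_def of_rat_sum of_rat_mult)
  finally show "res \<gamma>s z (of_int_poly f) $ i = Lr \<theta>s (\<lambda>j. real_of_rat (c j)) $ i"
    using i by (simp add: res_of_int Lr_def)
qed (simp add: dim_res Lr_def)

lemma orbit_sum_sum: "G.orbit_sum (\<Sum>m\<in>A. f m) = (\<Sum>m\<in>A. G.orbit_sum (f m))"
  unfolding G.orbit_sum_def by (simp add: G.act_distribs sum.swap[of _ G])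

lemma adapted_nth:
  assumes "adapted \<theta>s" "j < l"
  shows "\<theta>s ! j \<in> inv_ring n G" "homogeneous (dg (\<theta>s ! j)) (\<theta>s ! j)"
  using assms unfolding adapted_def by auto

text \<open>Averages of monomials span the invariant forms over any coefficient field, so the real
  spaces are the spans of the integral values.\<close>

lemma RL_subset:
  assumes a: "adapted \<theta>s" and f: "f \<in> inv_ring_deg n G d"
  obtains c where "\<And>j. j < l \<Longrightarrow> c j \<noteq> 0 \<Longrightarrow> dg (\<theta>s ! j) \<le> d" "res \<gamma>s z f = Lr \<theta>s c"
proof -
  have f': "f \<in> inv_ring n G" "homogeneous d f" using f by (simp_all add: inv_ring_deg_def)
  define K where "K = Poly_Mapping.keys f"
  define p :: "monomial \<Rightarrow> int mpol" where "p m = G.orbit_sum (Poly_Mapping.single m 1)" for m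
  have p: "p m \<in> inv_ring n G" "homogeneous d (p m)" if "m \<in> K" for m
  proof -
    have "Poly_Mapping.keys m \<subseteq> {1..n}" using G.inv_ring_polys[OF f'(1)] that by (simp add: polys_def K_def)
    then show "p m \<in> inv_ring n G" unfolding p_def by (intro G.orbit_sum_inv polys_single)
    have "mon_degree m = d" using f'(2) that by (simp add: homogeneous_def K_def)
    then show "homogeneous d (p m)" unfolding p_def
      by (intro G.homogeneous_orbit_sum) (simp add: homogeneous_def)
  qed
  define q where "q m = (SOME c. coords \<theta>s (p m) c)" for m
  have q: "coords \<theta>s (p m) (q m)" if m: "m \<in> K" for m
  proof -
    obtain c where "coords \<theta>s (p m) c" by (rule adapted_coords[OF a p[OF m]])
    then show ?thesis unfolding q_def by (rule someI[of "coords \<theta>s (p m)"])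
  qed
  have ofp: "of_int_poly (p m) = (G.orbit_sum (mon_eval var m) :: real mpol)" for m
  proof -
    have "of_int_poly (Poly_Mapping.single m 1 :: int mpol) = (Poly_Mapping.single m 1 :: real mpol)"
      by (rule poly_mapping_eqI) (simp add: lookup_of_int_poly lookup_single when_def)
    also have "\<dots> = mon_eval var m" by (simp add: single_decompose Const_simps)
    finally show ?thesis unfolding p_def G.of_int_poly_orbit_sum by (rule arg_cong)
  qed
  have "of_nat (card G) * f = G.orbit_sum (\<Sum>m\<in>K. Const (Poly_Mapping.lookup f m) * mon_eval var m)"
    unfolding K_def mpol_expand[symmetric] by (rule G.orbit_sum_of_inv[OF f'(1), symmetric])
  also have "\<dots> = (\<Sum>m\<in>K. Const (Poly_Mapping.lookup f m) * of_int_poly (p m))"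
    unfolding orbit_sum_sum G.orbit_sum_inv_mult[OF G.inv_ring_Const] ofp ..
  finally have "Const (of_nat (card G)) * f = (\<Sum>m\<in>K. Const (Poly_Mapping.lookup f m) * of_int_poly (p m))"
    by (simp only: Const.hom_of_nat)
  then have ev: "eval_poly (act_poly (\<gamma>s ! i) (Const (of_nat (card G)) * f)) zR =
      eval_poly (act_poly (\<gamma>s ! i) (\<Sum>m\<in>K. Const (Poly_Mapping.lookup f m) * of_int_poly (p m))) zR" for i
    by (rule arg_cong)
  have v: "of_nat (card G) * res \<gamma>s z f $ i = (\<Sum>m\<in>K. Poly_Mapping.lookup f m * real_of_int (iv (p m) i))"
    if "i < l" for i
    using ev[of i] unfolding act_poly_distribs[OF rep_bij[OF that]] ev.hom_sum ev.hom_mult act_poly_Const[OF rep_bij[OF that]]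
      eval_poly_Const res_nth[OF that, symmetric] res_of_int[OF that] .
  define c where "c j = (\<Sum>m\<in>K. Poly_Mapping.lookup f m * real_of_rat (q m j)) / of_nat (card G)" for j
  show thesis
  proof (rule that[of c])
    fix j assume j: "j < l" "c j \<noteq> 0"
    have "\<exists>m\<in>K. q m j \<noteq> 0"
    proof (rule ccontr)
      assume "\<not> (\<exists>m\<in>K. q m j \<noteq> 0)"
      then have "c j = 0" unfolding c_def by simp
      with j(2) show False ..
    qed
    then obtain m where m: "m \<in> K" "q m j \<noteq> 0" by blast
    show "dg (\<theta>s ! j) \<le> d" by (rule coords_support[OF a p[OF m(1)] q[OF m(1)] j(1) m(2)])
  next
    show "res \<gamma>s z f = Lr \<theta>s c"
    proof (rule eq_vecI)
      fix i assume "i < dim_vec (Lr \<theta>s c)"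
      then have i: "i < l" by (simp add: Lr_def)
      have "real_of_int (iv (p m) i) = La \<theta>s (\<lambda>j. real_of_rat (q m j)) i" if "m \<in> K" for m
        using arg_cong[OF coords_res[OF q[OF that]], of "\<lambda>v. v $ i"] i by (simp add: res_of_int Lr_def)
      then have "of_nat (card G) * res \<gamma>s z f $ i =
          (\<Sum>m\<in>K. Poly_Mapping.lookup f m * La \<theta>s (\<lambda>j. real_of_rat (q m j)) i)"
        unfolding v[OF i] by (intro sum.cong refl) simp
      also have "\<dots> = (\<Sum>j < l. (\<Sum>m\<in>K. Poly_Mapping.lookup f m * real_of_rat (q m j)) * real_of_int (iv (\<theta>s ! j) i))"
        by (simp add: La_def sum_distrib_left sum_distrib_right mult.assoc sum.swap[of _ K])
      also have "\<dots> = of_nat (card G) * La \<theta>s c i"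
        using G.card_H_pos by (simp add: La_def c_def sum_distrib_left)
      finally show "res \<gamma>s z f $ i = Lr \<theta>s c $ i" using G.card_H_pos i by (simp add: Lr_def)
    qed (simp add: dim_res Lr_def)
  qed
qed

lemma RL_superset:
  assumes a: "adapted \<theta>s" and c: "\<And>j. j < l \<Longrightarrow> c j \<noteq> 0 \<Longrightarrow> dg (\<theta>s ! j) \<le> d"
  shows "Lr \<theta>s c \<in> RL n G \<gamma>s z d"
proof -
  let ?w = "real_of_int (eval_poly \<omega> z)" and ?k = "\<lambda>j. d - dg (\<theta>s ! j)"
  let ?W = "of_int_poly \<omega> :: real mpol"
  let ?f = "\<Sum>j < l. Const (c j / ?w ^ ?k j) * (of_int_poly (\<theta>s ! j) * ?W ^ ?k j)"
  have W: "?W \<in> inv_ring n Sig" "homogeneous 1 ?W" "eval_poly ?W zR = ?w" "?w \<noteq> 0"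
    using omega by (simp_all add: inv_ring_of_int_poly homogeneous_of_int_poly eval_of_int_poly)
  have "?f \<in> inv_ring n G"
    by (intro G.inv_ring_sum G.inv_ring_mult G.inv_ring_Const G.inv_ring_of_int_poly
        inv_Sig_G[OF inv_ring_power[OF W(1)]] adapted_nth(1)[OF a]) simp
  moreover have "homogeneous d ?f"
  proof (rule homogeneous_sum)
    fix j assume "j \<in> {..<l}"
    then have j: "j < l" by simp
    show "homogeneous d (Const (c j / ?w ^ ?k j) * (of_int_poly (\<theta>s ! j) * ?W ^ ?k j))"
    proof (cases "c j = 0")
      case False
      have "homogeneous (dg (\<theta>s ! j) + ?k j * 1) (of_int_poly (\<theta>s ! j) * ?W ^ ?k j)"
        by (intro homogeneous_mult homogeneous_power W(2) homogeneous_of_int_poly adapted_nth(2)[OF a j])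
      moreover have "dg (\<theta>s ! j) + ?k j * 1 = d" using c[OF j False] by simp
      ultimately show ?thesis by (intro homogeneous_Const_mult) simp
    qed simp
  qed
  ultimately have f: "?f \<in> inv_ring_deg n G d" by (simp add: inv_ring_deg_def)
  have rf: "res \<gamma>s z ?f = Lr \<theta>s c"
  proof (rule eq_vecI)
    fix i assume "i < dim_vec (Lr \<theta>s c)"
    then have i: "i < l" by (simp add: Lr_def)
    have w: "eval_poly (act_poly (\<gamma>s ! i) (?W ^ k)) zR = ?w ^ k" for k
      unfolding inv_ring_act[OF inv_ring_power[OF W(1)] rep_in[OF i]] ev.hom_power W(3) ..
    have v: "eval_poly (act_poly (\<gamma>s ! i) (of_int_poly g)) zR = real_of_int (iv g i)" for g
      using res_of_int[OF i, of g] unfolding res_nth[OF i] .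
    have "res \<gamma>s z ?f $ i = eval_poly (act_poly (\<gamma>s ! i) ?f) zR" by (rule res_nth[OF i])
    also have "\<dots> = (\<Sum>j < l. c j / ?w ^ ?k j * (real_of_int (iv (\<theta>s ! j) i) * ?w ^ ?k j))"
      unfolding act_poly_distribs[OF rep_bij[OF i]] ev.hom_sum ev.hom_mult
        act_poly_Const[OF rep_bij[OF i]] eval_poly_Const w v ..
    also have "\<dots> = La \<theta>s c i"
      unfolding La_def using W(4) by (intro sum.cong refl) simp
    finally show "res \<gamma>s z ?f $ i = Lr \<theta>s c $ i" using i by (simp add: Lr_def)
  qed (simp add: dim_res Lr_def)
  show ?thesis unfolding RL_def rf[symmetric] by (rule imageI[OF f])
qed

lemma RL_eq:
  assumes a: "adapted \<theta>s"
  shows "RL n G \<gamma>s z d = {Lr \<theta>s c | c. \<forall>j < l. c j \<noteq> 0 \<longrightarrow> dg (\<theta>s ! j) \<le> d}" (is "_ = ?R")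
proof
  show "RL n G \<gamma>s z d \<subseteq> ?R"
    unfolding RL_def
  proof (rule image_subsetI)
    fix f :: "real mpol" assume "f \<in> inv_ring_deg n G d"
    then obtain c where "\<And>j. j < l \<Longrightarrow> c j \<noteq> 0 \<Longrightarrow> dg (\<theta>s ! j) \<le> d" "res \<gamma>s z f = Lr \<theta>s c"
      by (rule RL_subset[OF a]) (rule that)
    then show "res \<gamma>s z f \<in> ?R" by (intro CollectI exI[of _ c]) simp
  qed
  show "?R \<subseteq> RL n G \<gamma>s z d"
  proof
    fix v assume "v \<in> ?R"
    then obtain c where c: "v = Lr \<theta>s c" "\<forall>j < l. c j \<noteq> 0 \<longrightarrow> dg (\<theta>s ! j) \<le> d" by (elim CollectE exE conjE) (rule that)
    show "v \<in> RL n G \<gamma>s z d" unfolding c(1) by (rule RL_superset[OF a]) (use c(2) in simp)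
  qed
qed

lemma RL_prev_eq:
  assumes a: "adapted \<theta>s"
  shows "RL_prev n G \<gamma>s z d = {Lr \<theta>s c | c. \<forall>j < l. c j \<noteq> 0 \<longrightarrow> dg (\<theta>s ! j) < d}"
proof (cases d)
  case 0
  have "Lr \<theta>s c = 0\<^sub>v l" if "\<forall>j < l. c j = 0" for c
    using that by (intro eq_vecI) (simp_all add: Lr_def La_def)
  then have "{Lr \<theta>s c | c. \<forall>j < l. c j = 0} = {0\<^sub>v l}" by (auto intro!: exI[of _ "\<lambda>_. 0"])
  then show ?thesis by (simp add: RL_prev_def 0)
next
  case (Suc e)
  then show ?thesis by (simp add: RL_prev_def RL_eq[OF a] less_Suc_eq_le)
qed

lemma La_diff: "La \<theta>s (\<lambda>j. a j - b j) i = La \<theta>s a i - La \<theta>s b i"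
  by (simp add: La_def left_diff_distrib sum_subtractf)

lemma Lr_diff: "Lr \<theta>s a - Lr \<theta>s b = Lr \<theta>s (\<lambda>j. a j - b j)"
  by (rule eq_vecI) (simp_all add: Lr_def La_diff)

lemma La_sum: "La \<theta>s (\<lambda>k. \<Sum>j\<in>A. c j * e j k) i = (\<Sum>j\<in>A. c j * La \<theta>s (e j) i)"
  by (simp add: La_def sum_distrib_left sum_distrib_right mult.assoc sum.swap[of _ A])

lemma Lr_carrier: "Lr \<theta>s c \<in> carrier_vec l"
  by (simp add: Lr_def)

lemma scalar_prod_Lr: "scalar_prod (Lr \<theta>s a) (Lr \<theta>s b) = (\<Sum>i < l. La \<theta>s a i * La \<theta>s b i)"
  by (simp add: Lr_def scalar_prod_def atLeast0LessThan)

text \<open>Coordinates of the values made orthogonal to all values of smaller degree.\<close>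

definition orthogonalizer :: "int mpol list \<Rightarrow> (nat \<Rightarrow> nat \<Rightarrow> real) \<Rightarrow> bool" where
  "orthogonalizer \<theta>s e \<longleftrightarrow> (\<forall>j < l. e j j = 1 \<and> (\<forall>k < l. k \<noteq> j \<longrightarrow> e j k \<noteq> 0 \<longrightarrow> dg (\<theta>s ! k) < dg (\<theta>s ! j)) \<and>
     (\<forall>k < l. dg (\<theta>s ! k) < dg (\<theta>s ! j) \<longrightarrow> (\<Sum>i < l. La \<theta>s (e j) i * real_of_int (iv (\<theta>s ! k) i)) = 0))"

lemma ex_orthogonalizer: "\<exists>e. orthogonalizer \<theta>s e"
proof -
  let ?t = "\<lambda>m i. real_of_int (iv (\<theta>s ! m) i)"
  let ?low = "\<lambda>j. {k. k < l \<and> dg (\<theta>s ! k) < dg (\<theta>s ! j)}"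
  have proj: "\<exists>u. \<forall>s \<in> ?low j. (\<Sum>i < l. (?t j i - (\<Sum>m \<in> ?low j. u m * ?t m i)) * ?t s i) = 0" for j
    by (rule projection_exists) simp
  define u where "u j = (SOME u. \<forall>s \<in> ?low j. (\<Sum>i < l. (?t j i - (\<Sum>m \<in> ?low j. u m * ?t m i)) * ?t s i) = 0)" for j
  have u: "\<forall>s \<in> ?low j. (\<Sum>i < l. (?t j i - (\<Sum>m \<in> ?low j. u j m * ?t m i)) * ?t s i) = 0" for j
    unfolding u_def by (rule someI_ex[OF proj])
  define e where "e j k = (if k = j then 1 else if k \<in> ?low j then - u j k else 0)" for j k
  have La: "La \<theta>s (e j) i = ?t j i - (\<Sum>m \<in> ?low j. u j m * ?t m i)" if j: "j < l" for i j
  proof -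
    have "La \<theta>s (e j) i = (\<Sum>k < l. (if k = j then ?t j i else 0) - (if k \<in> ?low j then u j k * ?t k i else 0))"
      unfolding La_def by (intro sum.cong refl) (auto simp: e_def)
    also have "\<dots> = ?t j i - (\<Sum>k < l. if k \<in> ?low j then u j k * ?t k i else 0)"
      using j by (simp add: sum_subtractf)
    also have "(\<Sum>k < l. if k \<in> ?low j then u j k * ?t k i else 0) = (\<Sum>m \<in> ?low j. u j m * ?t m i)"
      by (rule sum.mono_neutral_cong_right) auto
    finally show ?thesis .
  qed
  have "orthogonalizer \<theta>s e"
    unfolding orthogonalizer_def
  proof (intro allI impI conjI)
    fix j assume j: "j < l"
    show "e j j = 1" by (simp add: e_def)
    show "dg (\<theta>s ! k) < dg (\<theta>s ! j)" if "k < l" "k \<noteq> j" "e j k \<noteq> 0" for k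
      using that by (simp add: e_def split: if_splits)
    show "(\<Sum>i < l. La \<theta>s (e j) i * ?t k i) = 0" if "k < l" "dg (\<theta>s ! k) < dg (\<theta>s ! j)" for k
      unfolding La[OF j] using u[of j] that by simp
  qed
  then show ?thesis by (rule exI[of _ e])
qed

context
  fixes \<theta>s e
  assumes a: "adapted \<theta>s" and e: "orthogonalizer \<theta>s e"
begin

lemma e_diag: "j < l \<Longrightarrow> e j j = 1"
  using e unfolding orthogonalizer_def by simp

lemma e_less: "j < l \<Longrightarrow> k < l \<Longrightarrow> k \<noteq> j \<Longrightarrow> e j k \<noteq> 0 \<Longrightarrow> dg (\<theta>s ! k) < dg (\<theta>s ! j)"
  using e unfolding orthogonalizer_def by simp

lemma e_same: "j < l \<Longrightarrow> k < l \<Longrightarrow> dg (\<theta>s ! k) = dg (\<theta>s ! j) \<Longrightarrow> e j k = (if k = j then 1 else 0)"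
  using e_diag[of j] e_less[of j k] by (cases "k = j") auto

lemma e_orth:
  assumes j: "j < l" and b: "\<And>k. k < l \<Longrightarrow> b k \<noteq> 0 \<Longrightarrow> dg (\<theta>s ! k) < dg (\<theta>s ! j)"
  shows "(\<Sum>i < l. La \<theta>s (e j) i * La \<theta>s b i) = 0"
proof -
  have "(\<Sum>i < l. La \<theta>s (e j) i * La \<theta>s b i) =
      (\<Sum>k < l. b k * (\<Sum>i < l. La \<theta>s (e j) i * real_of_int (iv (\<theta>s ! k) i)))"
    unfolding La_def[of _ b] sum_distrib_left by (subst sum.swap) (simp only: mult.left_commute)
  also have "\<dots> = 0"
  proof (rule sum.neutral, rule ballI)
    fix k assume "k \<in> {..<l}"
    then have k: "k < l" by simp
    show "b k * (\<Sum>i < l. La \<theta>s (e j) i * real_of_int (iv (\<theta>s ! k) i)) = 0"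
    proof (cases "b k = 0")
      case False
      have "(\<Sum>i < l. La \<theta>s (e j) i * real_of_int (iv (\<theta>s ! k) i)) = 0"
        using e j k b[OF k False] unfolding orthogonalizer_def by simp
      then show ?thesis by simp
    qed simp
  qed
  finally show ?thesis .
qed

lemma eps_Lr:
  assumes c: "\<And>j. j < l \<Longrightarrow> c j \<noteq> 0 \<Longrightarrow> dg (\<theta>s ! j) \<le> d"
  shows "eps n G \<gamma>s z d (Lr \<theta>s c) = Lr \<theta>s (\<lambda>k. \<Sum>j \<in> {j. j < l \<and> dg (\<theta>s ! j) = d}. c j * e j k)"
proof -
  let ?J = "{j. j < l \<and> dg (\<theta>s ! j) = d}"
  let ?w = "\<lambda>k. \<Sum>j \<in> ?J. c j * e j k"
  let ?P = "RL_prev n G \<gamma>s z d" and ?R = "RL n G \<gamma>s z d"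
  show ?thesis
    unfolding eps_def
  proof (rule orth_projI[where k = l])
    have Rc: "v \<in> carrier_vec l" if "v \<in> ?R" for v using that unfolding RL_eq[OF a] by (auto simp: Lr_carrier)
    have Pc: "v \<in> carrier_vec l" if "v \<in> ?P" for v using that unfolding RL_prev_eq[OF a] by (auto simp: Lr_carrier)
    show "orth_compl_in ?P ?R \<subseteq> carrier_vec l" using Rc by (auto simp: orth_compl_in_def)
    show "x - y \<in> orth_compl_in ?P ?R" if xy: "x \<in> orth_compl_in ?P ?R" "y \<in> orth_compl_in ?P ?R" for x y
    proof -
      have R: "x \<in> ?R" "y \<in> ?R" using xy by (simp_all add: orth_compl_in_def)
      obtain b where b: "x = Lr \<theta>s b" "\<forall>j < l. b j \<noteq> 0 \<longrightarrow> dg (\<theta>s ! j) \<le> d"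
        using R(1) unfolding RL_eq[OF a] by (elim CollectE exE conjE) (rule that)
      obtain b' where b': "y = Lr \<theta>s b'" "\<forall>j < l. b' j \<noteq> 0 \<longrightarrow> dg (\<theta>s ! j) \<le> d"
        using R(2) unfolding RL_eq[OF a] by (elim CollectE exE conjE) (rule that)
      have "x - y \<in> ?R"
        unfolding b(1) b'(1) Lr_diff
      proof (rule RL_superset[OF a])
        fix j assume "j < l" "b j - b' j \<noteq> 0"
        then show "dg (\<theta>s ! j) \<le> d" using b(2) b'(2) by (cases "b j = 0") simp_all
      qed
      moreover have "scalar_prod (x - y) v = 0" if v: "v \<in> ?P" for v
        using xy v minus_scalar_prod_distrib[OF Rc[OF R(1)] Rc[OF R(2)] Pc[OF v]] by (simp add: orth_compl_in_def)
      ultimately show ?thesis by (simp add: orth_compl_in_def)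
    qed
    show "Lr \<theta>s c \<in> carrier_vec l" by (rule Lr_carrier)
    have "Lr \<theta>s ?w \<in> ?R"
    proof (rule RL_superset[OF a])
      fix k assume k: "k < l" "?w k \<noteq> 0"
      obtain j where j: "j \<in> ?J" "c j * e j k \<noteq> 0" using k(2) by (rule sum.not_neutral_contains_not_neutral)
      then have "k = j \<or> dg (\<theta>s ! k) < dg (\<theta>s ! j)" using e_less[of j k] k(1) by auto
      then show "dg (\<theta>s ! k) \<le> d" using j(1) by auto
    qed
    moreover have "scalar_prod (Lr \<theta>s ?w) v = 0" if v: "v \<in> ?P" for v
    proof -
      obtain b where b: "v = Lr \<theta>s b" "\<forall>j < l. b j \<noteq> 0 \<longrightarrow> dg (\<theta>s ! j) < d"
        using v unfolding RL_prev_eq[OF a] by (elim CollectE exE conjE) (rule that)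
      have "scalar_prod (Lr \<theta>s ?w) v = (\<Sum>i < l. \<Sum>j \<in> ?J. c j * (La \<theta>s (e j) i * La \<theta>s b i))"
        unfolding b(1) scalar_prod_Lr La_sum by (simp only: sum_distrib_right mult.assoc)
      also have "\<dots> = (\<Sum>j \<in> ?J. c j * (\<Sum>i < l. La \<theta>s (e j) i * La \<theta>s b i))"
        by (subst sum.swap) (simp only: sum_distrib_left)
      also have "\<dots> = 0"
      proof (rule sum.neutral, rule ballI)
        fix j assume "j \<in> ?J"
        then have "(\<Sum>i < l. La \<theta>s (e j) i * La \<theta>s b i) = 0" using b(2) by (intro e_orth) auto
        then show "c j * (\<Sum>i < l. La \<theta>s (e j) i * La \<theta>s b i) = 0" by simp
      qed
      finally show ?thesis .
    qed
    ultimately show "Lr \<theta>s ?w \<in> orth_compl_in ?P ?R" by (simp add: orth_compl_in_def)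
    show "scalar_prod (Lr \<theta>s c - Lr \<theta>s ?w) v = 0" if v: "v \<in> orth_compl_in ?P ?R" for v
    proof -
      have vR: "v \<in> ?R" and vo: "\<And>u. u \<in> ?P \<Longrightarrow> scalar_prod v u = 0" using v by (simp_all add: orth_compl_in_def)
      have "Lr \<theta>s c - Lr \<theta>s ?w \<in> ?P"
        unfolding Lr_diff RL_prev_eq[OF a]
      proof (intro CollectI exI conjI allI impI)
        fix k assume k: "k < l" "c k - ?w k \<noteq> 0"
        show "dg (\<theta>s ! k) < d"
        proof (rule ccontr)
          assume ge: "\<not> dg (\<theta>s ! k) < d"
          have "c j * e j k = (if j = k then c k else 0)" if j: "j \<in> ?J" for j
            using j k(1) ge e_diag[of k] e_less[of j k] by (cases "j = k") auto
          then have "?w k = (\<Sum>j \<in> ?J. if j = k then c k else 0)" by (intro sum.cong) auto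
          also have "\<dots> = (if k \<in> ?J then c k else 0)" by simp
          also have "\<dots> = c k" using c[OF k(1)] k(1) ge by (cases "c k = 0") auto
          finally show False using k(2) by simp
        qed
      qed (rule refl)
      from vo[OF this] show ?thesis
        using comm_scalar_prod[OF Rc[OF vR], of "Lr \<theta>s c - Lr \<theta>s ?w"] Lr_carrier[of \<theta>s]
        by (simp add: Lr_diff)
    qed
  qed
qed

definition Bm :: "nat \<Rightarrow> real mat" where
  "Bm d = mat l (length (class_idx l (\<lambda>j. dg (\<theta>s ! j)) d))
     (\<lambda>(i, x). La \<theta>s (e (class_idx l (\<lambda>j. dg (\<theta>s ! j)) d ! x)) i)"

lemma Lr_class:
  fixes d c
  defines "idx \<equiv> class_idx l (\<lambda>j. dg (\<theta>s ! j)) d"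
  shows "Lr \<theta>s (\<lambda>k. \<Sum>j \<in> {j. j < l \<and> dg (\<theta>s ! j) = d}. c j * e j k) = Bm d *\<^sub>v vec (length idx) (\<lambda>x. c (idx ! x))"
proof (rule eq_vecI)
  fix i assume "i < dim_vec (Bm d *\<^sub>v vec (length idx) (\<lambda>x. c (idx ! x)))"
  then have i: "i < l" by (simp add: Bm_def)
  have "(\<Sum>j \<in> {j. j < l \<and> dg (\<theta>s ! j) = d}. c j * La \<theta>s (e j) i) = (\<Sum>x < length idx. c (idx ! x) * La \<theta>s (e (idx ! x)) i)"
    unfolding idx_def by (rule sum_class_idx[symmetric])
  then show "Lr \<theta>s (\<lambda>k. \<Sum>j \<in> {j. j < l \<and> dg (\<theta>s ! j) = d}. c j * e j k) $ i =
      (Bm d *\<^sub>v vec (length idx) (\<lambda>x. c (idx ! x))) $ i"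
    using i by (simp add: Lr_def La_sum Bm_def idx_def scalar_prod_def atLeast0LessThan mult.commute)
qed (simp add: Lr_def Bm_def)

lemma eps_Bm:
  assumes "\<And>j. j < l \<Longrightarrow> c j \<noteq> 0 \<Longrightarrow> dg (\<theta>s ! j) \<le> d"
  shows "eps n G \<gamma>s z d (Lr \<theta>s c) = Bm d *\<^sub>v
    vec (length (class_idx l (\<lambda>j. dg (\<theta>s ! j)) d)) (\<lambda>x. c (class_idx l (\<lambda>j. dg (\<theta>s ! j)) d ! x))"
  by (rule trans[OF eps_Lr[where c = c and d = d] Lr_class]) (rule assms)

lemma La_inj:
  assumes "\<And>i. i < l \<Longrightarrow> La \<theta>s b i = 0" "k < l"
  shows "b k = 0"
proof -
  have "mat l l (\<lambda>(i, j). real_of_int (iv (\<theta>s ! j) i)) = map_mat real_of_int (T \<theta>s)"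
    by (rule eq_matI) (simp_all add: T_def)
  then have "det (mat l l (\<lambda>(i, j). real_of_int (iv (\<theta>s ! j) i))) \<noteq> 0"
    using adapted_det[OF a] by simp
  then show ?thesis
    by (rule idom_mat_inj[OF _ _ assms(2)]) (use assms(1) in \<open>simp add: La_def mult.commute\<close>)
qed

text \<open>The projection annihilates the coordinates of smaller degree, and optimality makes the remaining
  ones range over all integers.\<close>

lemma lattice_basis_Bm:
  assumes o: "optimal \<theta>s"
  shows "lattice_basis l (Bm d) (eps n G \<gamma>s z d ` M_lattice n G \<gamma>s z d)"
proof -
  define idx where "idx = class_idx l (\<lambda>j. dg (\<theta>s ! j)) d"
  have idx: "idx ! x < l" "dg (\<theta>s ! (idx ! x)) = d" if "x < length idx" for x
    using class_idx_nth[of x l "\<lambda>j. dg (\<theta>s ! j)" d] that unfolding idx_def by simp_all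
  have dc: "dim_col (Bm d) = length idx" by (simp add: Bm_def idx_def)
  have inj: "\<forall>c \<in> carrier_vec (length idx). Bm d *\<^sub>v c = 0\<^sub>v l \<longrightarrow> c = 0\<^sub>v (length idx)"
  proof (intro ballI impI)
    fix c assume c: "c \<in> carrier_vec (length idx)" "Bm d *\<^sub>v c = 0\<^sub>v l"
    define b where "b k = (\<Sum>x < length idx. c $ x * e (idx ! x) k)" for k
    have "La \<theta>s b i = 0" if i: "i < l" for i
    proof -
      have "La \<theta>s b i = (\<Sum>x < length idx. c $ x * La \<theta>s (e (idx ! x)) i)" unfolding b_def by (rule La_sum)
      also have "\<dots> = (Bm d *\<^sub>v c) $ i"
        using i c(1) by (simp add: Bm_def idx_def scalar_prod_def atLeast0LessThan mult.commute)
      also have "\<dots> = 0" unfolding c(2) using i by simp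
      finally show ?thesis .
    qed
    then have b0: "b k = 0" if "k < l" for k using La_inj[of b k] that by simp
    show "c = 0\<^sub>v (length idx)"
    proof (rule eq_vecI)
      fix y assume "y < dim_vec (0\<^sub>v (length idx) :: real vec)"
      then have y: "y < length idx" by simp
      have "c $ x * e (idx ! x) (idx ! y) = (if x = y then c $ y else 0)" if x: "x < length idx" for x
        using e_same[OF idx(1)[OF x] idx(1)[OF y]] idx(2)[OF x] idx(2)[OF y]
          nth_eq_iff_index_eq[OF distinct_class_idx[of l "\<lambda>j. dg (\<theta>s ! j)" d], folded idx_def, OF y x] by auto
      then have "b (idx ! y) = (\<Sum>x < length idx. if x = y then c $ y else 0)"
        unfolding b_def by (intro sum.cong) auto
      then show "c $ y = 0\<^sub>v (length idx) $ y" using y b0[OF idx(1)[OF y]] by simp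
    qed (use c(1) in simp)
  qed
  have img: "eps n G \<gamma>s z d ` M_lattice n G \<gamma>s z d = {Bm d *\<^sub>v map_vec real_of_int c | c. c \<in> carrier_vec (length idx)}"
    (is "?L = ?R")
  proof
    show "?L \<subseteq> ?R"
      unfolding M_lattice_def image_image
    proof (rule image_subsetI)
      fix f :: "int mpol" assume "f \<in> inv_ring_deg n G d"
      then have f: "f \<in> inv_ring n G" "homogeneous d f" by (simp_all add: inv_ring_deg_def)
      obtain c where c: "coords \<theta>s f c" by (rule adapted_coords[OF a f])
      have "eps n G \<gamma>s z d (res \<gamma>s z (of_int_poly f)) =
          Bm d *\<^sub>v vec (length idx) (\<lambda>x. real_of_rat (c (idx ! x)))"
        unfolding coords_res[OF c] idx_def
      proof (rule eps_Bm[where c = "\<lambda>j. real_of_rat (c j)"])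
        fix j assume "j < l" "real_of_rat (c j) \<noteq> 0"
        then show "dg (\<theta>s ! j) \<le> d" by (intro coords_support[OF a f c]) simp_all
      qed
      also have "vec (length idx) (\<lambda>x. real_of_rat (c (idx ! x))) = map_vec real_of_int (vec (length idx) (\<lambda>x. \<lfloor>c (idx ! x)\<rfloor>))"
      proof (rule eq_vecI)
        fix x assume "x < dim_vec (map_vec real_of_int (vec (length idx) (\<lambda>x. \<lfloor>c (idx ! x)\<rfloor>)))"
        then have x: "x < length idx" by simp
        have "c (idx ! x) \<in> \<int>" by (rule optimal_Ints[OF o f c idx[OF x]])
        then have "c (idx ! x) = of_int \<lfloor>c (idx ! x)\<rfloor>" by simp
        then have "real_of_rat (c (idx ! x)) = real_of_rat (of_int \<lfloor>c (idx ! x)\<rfloor>)" by (rule arg_cong)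
        then show "vec (length idx) (\<lambda>x. real_of_rat (c (idx ! x))) $ x =
            map_vec real_of_int (vec (length idx) (\<lambda>x. \<lfloor>c (idx ! x)\<rfloor>)) $ x"
          using x by (simp only: index_vec index_map_vec dim_vec of_rat_of_int_eq)
      qed simp
      finally show "eps n G \<gamma>s z d (res \<gamma>s z (of_int_poly f)) \<in> ?R"
        by (intro CollectI exI[of _ "vec (length idx) (\<lambda>x. \<lfloor>c (idx ! x)\<rfloor>)"] conjI vec_carrier)
    qed
    show "?R \<subseteq> ?L"
    proof
      fix v assume "v \<in> ?R"
      then obtain c where c: "v = Bm d *\<^sub>v map_vec real_of_int c" "c \<in> carrier_vec (length idx)"
        by (elim CollectE exE conjE) (rule that)
      define f where "f = (\<Sum>x < length idx. Const (c $ x) * \<theta>s ! (idx ! x))"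
      have f: "f \<in> inv_ring_deg n G d"
        unfolding f_def inv_ring_deg_def
      proof (intro CollectI conjI G.inv_ring_sum G.inv_ring_mult G.inv_ring_Const homogeneous_sum homogeneous_Const_mult)
        fix x assume "x \<in> {..<length idx}"
        then have x: "x < length idx" by simp
        show "\<theta>s ! (idx ! x) \<in> inv_ring n G" by (rule adapted_nth(1)[OF a idx(1)[OF x]])
        show "homogeneous d (\<theta>s ! (idx ! x))" using adapted_nth(2)[OF a idx(1)[OF x]] unfolding idx(2)[OF x] .
      qed
      define b where "b j = (\<Sum>x < length idx. if idx ! x = j then real_of_int (c $ x) else 0)" for j
      have bidx: "b (idx ! y) = real_of_int (c $ y)" if y: "y < length idx" for y
      proof -
        have "b (idx ! y) = (\<Sum>x < length idx. if x = y then real_of_int (c $ y) else 0)"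
          unfolding b_def using nth_eq_iff_index_eq[OF distinct_class_idx[of l "\<lambda>j. dg (\<theta>s ! j)" d], folded idx_def] y
          by (intro sum.cong) auto
        then show ?thesis using y by simp
      qed
      have "res \<gamma>s z (of_int_poly f) = Lr \<theta>s b"
      proof (rule eq_vecI)
        fix i assume "i < dim_vec (Lr \<theta>s b)"
        then have i: "i < l" by (simp add: Lr_def)
        have "iv f i = (\<Sum>x < length idx. c $ x * iv (\<theta>s ! (idx ! x)) i)"
          unfolding f_def iv_def act_poly_distribs[OF rep_bij[OF i]] ev.hom_sum ev.hom_mult
            act_poly_Const[OF rep_bij[OF i]] eval_poly_Const ..
        then have "real_of_int (iv f i) = (\<Sum>x < length idx. real_of_int (c $ x) * real_of_int (iv (\<theta>s ! (idx ! x)) i))"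
          by simp
        also have "\<dots> = (\<Sum>x < length idx. \<Sum>j < l. if idx ! x = j then real_of_int (c $ x) * real_of_int (iv (\<theta>s ! j) i) else 0)"
          using idx(1) by (intro sum.cong refl) simp
        also have "\<dots> = (\<Sum>j < l. \<Sum>x < length idx. if idx ! x = j then real_of_int (c $ x) * real_of_int (iv (\<theta>s ! j) i) else 0)"
          by (rule sum.swap)
        also have "\<dots> = La \<theta>s b i"
          unfolding La_def b_def sum_distrib_right by (intro sum.cong refl) simp
        finally show "res \<gamma>s z (of_int_poly f) $ i = Lr \<theta>s b $ i" using i by (simp add: res_of_int Lr_def)
      qed (simp add: dim_res Lr_def)
      moreover have "eps n G \<gamma>s z d (Lr \<theta>s b) = v"
      proof -
        have "eps n G \<gamma>s z d (Lr \<theta>s b) = Bm d *\<^sub>v vec (length idx) (\<lambda>x. b (idx ! x))"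
          unfolding idx_def
        proof (rule eps_Bm)
          fix j assume "j < l" "b j \<noteq> 0"
          then obtain x where "x \<in> {..<length idx}" "(if idx ! x = j then real_of_int (c $ x) else 0) \<noteq> 0"
            unfolding b_def by (elim sum.not_neutral_contains_not_neutral)
          then have "x < length idx" "idx ! x = j" by (auto split: if_splits)
          then show "dg (\<theta>s ! j) \<le> d" using idx(2)[of x] by simp
        qed
        also have "vec (length idx) (\<lambda>x. b (idx ! x)) = map_vec real_of_int c"
          using c(2) by (intro eq_vecI) (simp_all add: bidx)
        finally show ?thesis using c(1) by simp
      qed
      ultimately have "v = eps n G \<gamma>s z d (res \<gamma>s z (of_int_poly f))" by simp
      then show "v \<in> ?L" unfolding M_lattice_def image_image using f by (rule image_eqI)
    qed
  qed
  show ?thesis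
    unfolding lattice_basis_def dc using inj img by (intro conjI) (simp_all only: Bm_def dim_row_mat)
qed

text \<open>The change of coordinates to the orthogonalized values is unitriangular with respect to the degree
  and keeps the determinant. Afterwards different degrees are orthogonal, so the Gram matrix is block
  diagonal, with the Gram matrices of the projected lattices as blocks.\<close>

lemma prod_covol:
  assumes o: "optimal \<theta>s"
  shows "(\<Prod>d \<in> (\<lambda>j. dg (\<theta>s ! j)) ` {..<l}. covol l (eps n G \<gamma>s z d ` M_lattice n G \<gamma>s z d)) = \<bar>real_of_int (det (T \<theta>s))\<bar>"
proof -
  let ?f = "\<lambda>j. dg (\<theta>s ! j)"
  define RT where "RT = mat l l (\<lambda>(i, j). real_of_int (iv (\<theta>s ! j) i))"
  define U where "U = mat l l (\<lambda>(k, j). e j k)"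
  define C where "C = mat l l (\<lambda>(i, j). La \<theta>s (e j) i)"
  have car: "RT \<in> carrier_mat l l" "U \<in> carrier_mat l l" "C \<in> carrier_mat l l" by (simp_all add: RT_def U_def C_def)
  have "RT = map_mat real_of_int (T \<theta>s)" by (rule eq_matI) (simp_all add: RT_def T_def)
  then have dRT: "det RT = real_of_int (det (T \<theta>s))" by simp
  have "RT * U = C"
    by (rule eq_matI) (simp_all add: RT_def U_def C_def La_def scalar_prod_def atLeast0LessThan mult.commute)
  then have dC: "det C = det RT * det U" using det_mult[OF car(1,2)] by simp
  have "det U = det (mat l l (\<lambda>(i, j). if ?f i = ?f j then U $$ (i, j) else 0))"
  proof (rule det_graded[OF car(2) refl])
    fix i j assume ij: "i < l" "j < l" "U $$ (i, j) \<noteq> 0"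
    then show "?f i \<le> ?f j" using e_less[of j i] by (cases "i = j") (auto simp: U_def)
  qed
  also have "mat l l (\<lambda>(i, j). if ?f i = ?f j then U $$ (i, j) else 0) = 1\<^sub>m l"
    by (rule eq_matI) (auto simp: U_def e_same)
  finally have dU: "det U = 1" by simp
  define H where "H = transpose_mat C * C"
  have H: "H \<in> carrier_mat l l" using car(3) by (simp add: H_def)
  have Hij: "H $$ (i, j) = (\<Sum>k < l. La \<theta>s (e i) k * La \<theta>s (e j) k)" if "i < l" "j < l" for i j
    using that by (simp add: H_def C_def scalar_prod_def atLeast0LessThan)
  have off: "H $$ (i, j) = 0" if ij: "i < l" "j < l" "?f i \<noteq> ?f j" for i j
  proof (cases "?f j < ?f i")
    case True
    have "(\<Sum>k < l. La \<theta>s (e i) k * La \<theta>s (e j) k) = 0"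
    proof (rule e_orth[OF ij(1)])
      fix k assume "k < l" "e j k \<noteq> 0"
      then show "?f k < ?f i" using e_less[OF ij(2), of k] True by (cases "k = j") auto
    qed
    then show ?thesis by (simp only: Hij[OF ij(1,2)])
  next
    case False
    then have lt: "?f i < ?f j" using ij(3) by simp
    have "(\<Sum>k < l. La \<theta>s (e j) k * La \<theta>s (e i) k) = 0"
    proof (rule e_orth[OF ij(2)])
      fix k assume "k < l" "e i k \<noteq> 0"
      then show "?f k < ?f j" using e_less[OF ij(1), of k] lt by (cases "k = i") auto
    qed
    then show ?thesis by (simp only: Hij[OF ij(1,2)] mult.commute)
  qed
  let ?M = "\<lambda>d. mat (length (class_idx l ?f d)) (length (class_idx l ?f d))
    (\<lambda>(a, b). H $$ (class_idx l ?f d ! a, class_idx l ?f d ! b))"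
  have "covol l (eps n G \<gamma>s z d ` M_lattice n G \<gamma>s z d) = sqrt (det (?M d))" for d
  proof -
    have "transpose_mat (Bm d) * Bm d = ?M d"
    proof (rule eq_matI)
      fix x y assume "x < dim_row (?M d)" "y < dim_col (?M d)"
      then have xy: "x < length (class_idx l ?f d)" "y < length (class_idx l ?f d)" by simp_all
      show "(transpose_mat (Bm d) * Bm d) $$ (x, y) = ?M d $$ (x, y)"
        using xy class_idx_nth[OF xy(1)] class_idx_nth[OF xy(2)]
        by (simp add: Hij Bm_def scalar_prod_def atLeast0LessThan)
    qed (simp_all add: Bm_def)
    then show ?thesis unfolding covol_eq[OF lattice_basis_Bm[OF o]] by (intro arg_cong[of _ _ sqrt] arg_cong[of _ _ det])
  qed
  then have "(\<Prod>d \<in> ?f ` {..<l}. covol l (eps n G \<gamma>s z d ` M_lattice n G \<gamma>s z d)) = (\<Prod>d \<in> ?f ` {..<l}. sqrt (det (?M d)))"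
    by (intro prod.cong refl)
  also have "\<dots> = sqrt (\<Prod>d \<in> ?f ` {..<l}. det (?M d))"
  proof -
    have "(\<Prod>x\<in>A. sqrt (h x)) = sqrt (\<Prod>x\<in>A. h x)" for A :: "nat set" and h
      by (induction A rule: infinite_finite_induct) (simp_all add: real_sqrt_mult)
    then show ?thesis .
  qed
  also have "(\<Prod>d \<in> ?f ` {..<l}. det (?M d)) = det H" by (rule det_classes[OF H off, symmetric])
  also have "det H = (det C)\<^sup>2"
    unfolding H_def power2_eq_square using det_mult[of "transpose_mat C" l C] det_transpose[OF car(3)] car(3) by simp
  also have "sqrt ((det C)\<^sup>2) = \<bar>det C\<bar>" by simp
  finally show ?thesis unfolding dC dU dRT by simp
qed

end

lemma mho_nonneg: "mho \<gamma>s \<theta>s \<ge> 0"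
  by (simp add: mho_def content_def)

lemma eval_DG:
  fixes S :: "(nat \<Rightarrow> nat) monoid"
  assumes S: "carrier S = Sig" and o: "optimal \<theta>s"
  shows "eval_poly DG z \<noteq> 0"
proof
  assume 0: "eval_poly DG z = 0"
  have a: "adapted \<theta>s" using o by (simp add: optimal_def)
  have s: "int_secondaries n S G \<theta>s" using a by (simp add: int_secondaries_iff[OF S])
  have "\<bar>det (T \<theta>s)\<bar> = 0" unfolding det_T_mho[OF S s] 0 by simp
  then show False using adapted_det[OF a] by simp
qed

text \<open>The determinants of values differ from the contents by the same non-zero factor.\<close>

lemma optimal_mho_dvd:
  assumes S: "carrier S = Sig" and o: "optimal \<theta>s" and s: "int_secondaries n S G \<eta>s"
  shows "mho \<gamma>s \<theta>s dvd mho \<gamma>s \<eta>s"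
proof -
  have a: "adapted \<theta>s" using o by (simp add: optimal_def)
  have s': "int_secondaries n S G \<theta>s" using a by (simp add: int_secondaries_iff[OF S])
  have a': "adapted \<eta>s" using s by (simp add: int_secondaries_iff[OF S])
  have "\<bar>det (T \<theta>s)\<bar> dvd \<bar>det (T \<eta>s)\<bar>" using optimal_dvd[OF S o a'] by simp
  then show ?thesis
    unfolding det_T_mho[OF S s'] det_T_mho[OF S s] using eval_DG[OF S o] by simp
qed

lemma mho_group_formula:
  fixes S :: "(nat \<Rightarrow> nat) monoid"
  assumes S: "carrier S = Sig" "mult S = (\<circ>)" "one S = id"
  shows "(\<exists>m. is_mho_group n S G \<gamma>s m) \<and>
    (\<forall>m. is_mho_group n S G \<gamma>s m \<longrightarrow>
       real_of_int \<bar>m\<bar> =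
         (\<Prod>d \<in> {d. tau n S G d \<noteq> 0}. covol l (eps n G \<gamma>s z d ` M_lattice n G \<gamma>s z d)) /
         \<bar>real_of_int (eval_poly (group_discriminant n S G) z)\<bar> \<and>
       (\<forall>\<theta>s. int_secondaries n S G \<theta>s \<longrightarrow> m dvd mho \<gamma>s \<theta>s))"
proof -
  obtain \<theta>s where o: "optimal \<theta>s" using ex_optimal[OF S(1)] ..
  have a: "adapted \<theta>s" using o by (simp add: optimal_def)
  have s: "int_secondaries n S G \<theta>s" using a by (simp add: int_secondaries_iff[OF S(1)])
  obtain e where e: "orthogonalizer \<theta>s e" using ex_orthogonalizer ..
  have min: "mho \<gamma>s \<theta>s dvd mho \<gamma>s \<eta>s" if "int_secondaries n S G \<eta>s" for \<eta>s
    by (rule optimal_mho_dvd[OF S(1) o that])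
  have "is_mho_group n S G \<gamma>s (mho \<gamma>s \<theta>s)"
    unfolding is_mho_group_def using s min mho_nonneg[of \<theta>s] by (auto intro!: exI[of _ \<theta>s])
  moreover have "real_of_int \<bar>m\<bar> =
      (\<Prod>d \<in> {d. tau n S G d \<noteq> 0}. covol l (eps n G \<gamma>s z d ` M_lattice n G \<gamma>s z d)) /
      \<bar>real_of_int (eval_poly (group_discriminant n S G) z)\<bar>"
    "\<forall>\<theta>s. int_secondaries n S G \<theta>s \<longrightarrow> m dvd mho \<gamma>s \<theta>s" if m: "is_mho_group n S G \<gamma>s m" for m
  proof -
    obtain \<eta>s where \<eta>: "int_secondaries n S G \<eta>s" "\<bar>m\<bar> = mho \<gamma>s \<eta>s" using m unfolding is_mho_group_def by (elim conjE exE) (rule that)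
    show d: "\<forall>\<theta>s. int_secondaries n S G \<theta>s \<longrightarrow> m dvd mho \<gamma>s \<theta>s" using m unfolding is_mho_group_def by (elim conjE)
    have "mho \<gamma>s \<theta>s dvd \<bar>m\<bar>" unfolding \<eta>(2) by (rule min[OF \<eta>(1)])
    moreover have "\<bar>m\<bar> dvd mho \<gamma>s \<theta>s" using d s by simp
    ultimately have ms: "\<bar>m\<bar> = mho \<gamma>s \<theta>s" using mho_nonneg[of \<theta>s] by (intro zdvd_antisym_nonneg) simp_all
    have "real_of_int \<bar>det (T \<theta>s)\<bar> = real_of_int (mho \<gamma>s \<theta>s * \<bar>eval_poly DG z\<bar>)"
      by (rule arg_cong[OF det_T_mho[OF S(1) s]])
    then have "\<bar>real_of_int (det (T \<theta>s))\<bar> = real_of_int \<bar>m\<bar> * \<bar>real_of_int (eval_poly DG z)\<bar>" unfolding ms by simp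
    then show "real_of_int \<bar>m\<bar> =
      (\<Prod>d \<in> {d. tau n S G d \<noteq> 0}. covol l (eps n G \<gamma>s z d ` M_lattice n G \<gamma>s z d)) /
      \<bar>real_of_int (eval_poly (group_discriminant n S G) z)\<bar>"
      unfolding tau_support[OF S(1) a] prod_covol[OF a e o] group_discriminant_eq[OF S]
      using eval_DG[OF S(1) o] by simp
  qed
  ultimately show ?thesis by blast
qed

end

theorem mainTheorem7:
  fixes n :: nat and ks :: "nat list" and G :: "(nat \<Rightarrow> nat) set"
    and \<gamma>s :: "(nat \<Rightarrow> nat) list" and \<omega> :: "int mpol" and z :: "nat \<Rightarrow> int"
  assumes "sum_list ks = n"
    and "subgroup G (young_group ks)"
    and "left_coset_reps (young_group ks) G \<gamma>s"
    and "\<omega> \<in> inv_ring_deg n (carrier (young_group ks)) 1" and "\<omega> \<noteq> 0"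
    and "stabilizer (young_group ks) act_point z = {id}"
    and "eval_poly \<omega> z \<noteq> 0"
  shows "(\<exists>m. is_mho_group n (young_group ks) G \<gamma>s m) \<and>
    (\<forall>m. is_mho_group n (young_group ks) G \<gamma>s m \<longrightarrow>
       real_of_int \<bar>m\<bar> =
         (\<Prod>d \<in> {d. tau n (young_group ks) G d \<noteq> 0}.
            covol (length \<gamma>s) (eps n G \<gamma>s z d ` M_lattice n G \<gamma>s z d)) /
         \<bar>real_of_int (eval_poly (group_discriminant n (young_group ks) G) z)\<bar> \<and>
       (\<forall>\<theta>s. int_secondaries n (young_group ks) G \<theta>s \<longrightarrow> m dvd mho \<gamma>s \<theta>s))"
proof -
  interpret setting n "carrier (young_group ks)" G \<gamma>s z \<omega>
    by (rule young_group_setting[OF assms(1-4,7,6)])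
  show ?thesis
    by (rule mho_group_formula) (simp_all add: young_group_def sym_group_def)
qed

end
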